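(* Let $G$ be a reflection group such that $e_H=2$ for each reflecting hyperplane $H$, and let $\Gamma_0:=\ker(\varepsilon\otimes\gamma_{m/2})\subseteq\Gamma$. Then $$P^\Gamma(F,t)=(1\otimes\gamma_0+\varepsilon\otimes\gamma_{m/2})\,P_0^\Gamma(F,t),$$ where $P_0^\Gamma(F,t)$ is an element of $R_+(\Gamma)[t]$ whose restriction to $\Gamma_0$ is $P^{\Gamma_0}(F_0,t)$. In particular, $$\chi^\Gamma(F)=(1\otimes\gamma_0+\varepsilon\otimes\gamma_{m/2})\,\chi_0^\Gamma(F),$$ where $\chi_0^\Gamma(F)$ is an element of $R(\Gamma)$ whose restriction to $\Gamma_0$ is $\chi^{\Gamma_0}(F_0)$.
   Context: $V=\mathbb C^\ell$ and $G\subset GL(V)$ is an irreducible finite complex (unitary) reflection group. $\mathcal A$ is its set of reflecting hyperplanes; for $H\in\mathcal A$, $e_H$ is the order of the pointwise stabiliser of $H$ and $\ell_H\in V^*$ has kernel $H$. $Q=\prod_{H}\ell_H^{e_H}$ ($G$-invariant), $m=\deg Q$ (here even), $Q_0=\prod_H\ell_H$ (so here $Q=Q_0^2$), $F=\{Q=1\}$, $F_0=\{Q_0=1\}$. $\varepsilon$ is the character of $G$ with $Q_0(g^{-1}v)=\varepsilon(g)Q_0(v)$; in fact $\varepsilon(g)=\det_V(g)$. $\mu_m$ is the group of $m$-th roots of unity and $\gamma_i$ is its character $\xi\mapsto\xi^i$. $\Gamma=G\times\mu_m$ acts on $F$ by $(g,\xi)v=\xi^{-1}gv$, and on cohomology by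 the inverse of pullback; $\Gamma_0$ is the stabiliser of $F_0$ in $\Gamma$. $\rho\otimes\gamma_i$ denotes the representation $(g,\xi)\mapsto\gamma_i(\xi)\rho(g)$. For a finite group $K$, $R(K)$ is the Grothendieck ring of complex representations and $R_+(K)\subset R(K)$ the set of classes of actual representations. For a $K$-variety $X$, $P^K(X,t)=\sum_{i\ge0}H^i(X,\mathbb C)t^i\in R_+(K)[t]$ and $\chi^K(X)=P^K(X,-1)$. *)

theory Defs
  imports
    "HOL-Analysis.Analysis"
    "HOL-Homology.Homology"
    "HOL-Algebra.UnivPoly"
    "Jordan_Normal_Form.VS_Connect"
begin

section \<open>The Grothendieck ring of complex representations of a finite group\<close>

text \<open>
  Finite-dimensional representations are taken in matrix form.  The degree of a representation
  is read off from the matrix of the unit element; degree 0 is allowed.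
\<close>

type_synonym 'g rep = "'g \<Rightarrow> complex Matrix.mat"

definition rep_degree :: "('g, 'b) monoid_scheme \<Rightarrow> 'g rep \<Rightarrow> nat" where
  "rep_degree K \<rho> = dim_row (\<rho> \<one>\<^bsub>K\<^esub>)"

definition is_rep :: "('g, 'b) monoid_scheme \<Rightarrow> 'g rep \<Rightarrow> bool" where
  "is_rep K \<rho> \<longleftrightarrow>
     \<rho> \<in> hom K (ring_mat TYPE(complex) (rep_degree K \<rho>) ()) \<and> \<rho> \<one>\<^bsub>K\<^esub> = 1\<^sub>m (rep_degree K \<rho>)"

definition rep_iso :: "('g, 'b) monoid_scheme \<Rightarrow> 'g rep \<Rightarrow> 'g rep \<Rightarrow> bool" where
  "rep_iso K \<rho> \<sigma> \<longleftrightarrow>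
     rep_degree K \<rho> = rep_degree K \<sigma> \<and>
     (\<exists>S \<in> carrier_mat (rep_degree K \<rho>) (rep_degree K \<rho>).
        invertible_mat S \<and> (\<forall>g \<in> carrier K. S * \<rho> g = \<sigma> g * S))"

definition rep_zero :: "'g rep" where
  "rep_zero = (\<lambda>g. 1\<^sub>m 0)"

definition rep_one :: "'g rep" where
  "rep_one = (\<lambda>g. 1\<^sub>m 1)"

definition rep_sum :: "'g rep \<Rightarrow> 'g rep \<Rightarrow> 'g rep" where
  "rep_sum \<rho> \<sigma> = (\<lambda>g. four_block_mat (\<rho> g) (0\<^sub>m (dim_row (\<rho> g)) (dim_col (\<sigma> g)))
                                     (0\<^sub>m (dim_row (\<sigma> g)) (dim_col (\<rho> g))) (\<sigma> g))"

definition kronecker :: "complex Matrix.mat \<Rightarrow> complex Matrix.mat \<Rightarrow> complex Matrix.mat" where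
  "kronecker A B = Matrix.mat (dim_row A * dim_row B) (dim_col A * dim_col B)
     (\<lambda>(i, j). A $$ (i div dim_row B, j div dim_col B) * B $$ (i mod dim_row B, j mod dim_col B))"

definition rep_tensor :: "'g rep \<Rightarrow> 'g rep \<Rightarrow> 'g rep" where
  "rep_tensor \<rho> \<sigma> = (\<lambda>g. kronecker (\<rho> g) (\<sigma> g))"

text \<open>
  The class of the formal difference of \<open>\<rho>\<close> and \<open>\<sigma>\<close>.  Short exact sequences of complex
  representations of a finite group split, so the relations of the Grothendieck group are those
  given by direct sums, and it is the group completion of the monoid of isomorphism classes.
\<close>

type_synonym 'g virtual_rep = "('g rep \<times> 'g rep) set"

definition virtual_class :: "('g, 'b) monoid_scheme \<Rightarrow> 'g rep \<Rightarrow> 'g rep \<Rightarrow> 'g virtual_rep" where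
  "virtual_class K \<rho> \<sigma> = {(\<rho>', \<sigma>'). is_rep K \<rho>' \<and> is_rep K \<sigma>' \<and>
     (\<exists>\<tau>. is_rep K \<tau> \<and>
        rep_iso K (rep_sum (rep_sum \<rho> \<sigma>') \<tau>) (rep_sum (rep_sum \<rho>' \<sigma>) \<tau>))}"

definition rep_class :: "('g, 'b) monoid_scheme \<Rightarrow> 'g rep \<Rightarrow> 'g virtual_rep" where
  "rep_class K \<rho> = virtual_class K \<rho> rep_zero"

text \<open>The ring \<open>R(K)\<close>, followed by the subset \<open>R\<^sub>+(K)\<close>.\<close>

definition rep_ring :: "('g, 'b) monoid_scheme \<Rightarrow> 'g virtual_rep ring" where
  "rep_ring K =
     \<lparr>carrier = {virtual_class K \<rho> \<sigma> | \<rho> \<sigma>. is_rep K \<rho> \<and> is_rep K \<sigma>},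
      mult = (\<lambda>a b. \<Union>(\<rho>, \<sigma>) \<in> a. \<Union>(\<rho>', \<sigma>') \<in> b.
                virtual_class K (rep_sum (rep_tensor \<rho> \<rho>') (rep_tensor \<sigma> \<sigma>'))
                          (rep_sum (rep_tensor \<rho> \<sigma>') (rep_tensor \<sigma> \<rho>'))),
      one = rep_class K rep_one,
      zero = rep_class K rep_zero,
      add = (\<lambda>a b. \<Union>(\<rho>, \<sigma>) \<in> a. \<Union>(\<rho>', \<sigma>') \<in> b. virtual_class K (rep_sum \<rho> \<rho>') (rep_sum \<sigma> \<sigma>'))\<rparr>"

definition rep_ring_pos :: "('g, 'b) monoid_scheme \<Rightarrow> 'g virtual_rep set" where
  "rep_ring_pos K = {rep_class K \<rho> | \<rho>. is_rep K \<rho>}"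

text \<open>\<open>R\<^sub>+(K)[t]\<close>, as a subset of the polynomial ring \<open>R(K)[t]\<close>.\<close>

definition rep_poly_pos :: "('g, 'b) monoid_scheme \<Rightarrow> (nat \<Rightarrow> 'g virtual_rep) set" where
  "rep_poly_pos K = {p \<in> carrier (UP (rep_ring K)). \<forall>i. coeff (UP (rep_ring K)) p i \<in> rep_ring_pos K}"

text \<open>Restriction to a subgroup \<open>L\<close>, where \<open>L\<close> is given as a group.\<close>

definition restrict_virtual :: "('g, 'b) monoid_scheme \<Rightarrow> 'g virtual_rep \<Rightarrow> 'g virtual_rep" where
  "restrict_virtual L a = (\<Union>(\<rho>, \<sigma>) \<in> a. virtual_class L \<rho> \<sigma>)"

definition restrict_poly ::
    "('g, 'b) monoid_scheme \<Rightarrow> (nat \<Rightarrow> 'g virtual_rep) \<Rightarrow> nat \<Rightarrow> 'g virtual_rep" where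
  "restrict_poly L p = (\<lambda>i. restrict_virtual L (p i))"

text \<open>
  The class of a representation of \<open>K\<close> by operators \<open>T g\<close> on a finite-dimensional complex
  vector space \<open>V\<close>; the choice of a matrix form does not matter, as all are isomorphic.
\<close>

definition matrix_form ::
    "('g, 'b) monoid_scheme \<Rightarrow> (complex, 'v) module \<Rightarrow> ('g \<Rightarrow> 'v \<Rightarrow> 'v) \<Rightarrow> 'g rep \<Rightarrow> bool" where
  "matrix_form K V T \<rho> \<longleftrightarrow>
     is_rep K \<rho> \<and>
     (\<exists>\<phi>. linear_map class_ring V (module_vec TYPE(complex) (rep_degree K \<rho>)) \<phi> \<and>
          bij_betw \<phi> (carrier V) (carrier_vec (rep_degree K \<rho>)) \<and>
          (\<forall>g \<in> carrier K. \<forall>v \<in> carrier V. \<phi> (T g v) = \<rho> g *\<^sub>v \<phi> v))"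

definition class_of_module ::
    "('g, 'b) monoid_scheme \<Rightarrow> (complex, 'v) module \<Rightarrow> ('g \<Rightarrow> 'v \<Rightarrow> 'v) \<Rightarrow> 'g virtual_rep" where
  "class_of_module K V T = rep_class K (SOME \<rho>. matrix_form K V T \<rho>)"


section \<open>Singular cohomology with complex coefficients\<close>

text \<open>
  A cochain is a complex function on singular simplices, set to 0 outside
  the singular simplices of the space.
\<close>

type_synonym 'a cochain = "((nat \<Rightarrow> real) \<Rightarrow> 'a) \<Rightarrow> complex"

definition cochains :: "nat \<Rightarrow> 'a topology \<Rightarrow> 'a cochain set" where
  "cochains p X = {c. \<forall>s. \<not> singular_simplex p X s \<longrightarrow> c s = 0}"

definition coboundary :: "nat \<Rightarrow> 'a topology \<Rightarrow> 'a cochain \<Rightarrow> 'a cochain" where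
  "coboundary p X c = (\<lambda>s. if singular_simplex (Suc p) X s
     then \<Sum>k\<le>Suc p. (-1) ^ k * c (singular_face (Suc p) k s) else 0)"

definition cocycles :: "nat \<Rightarrow> 'a topology \<Rightarrow> 'a cochain set" where
  "cocycles p X = {c \<in> cochains p X. coboundary p X c = (\<lambda>s. 0)}"

definition coboundaries :: "nat \<Rightarrow> 'a topology \<Rightarrow> 'a cochain set" where
  "coboundaries p X =
     (case p of 0 \<Rightarrow> {\<lambda>s. 0} | Suc q \<Rightarrow> coboundary q X ` cochains q X)"

definition cohom_class :: "nat \<Rightarrow> 'a topology \<Rightarrow> 'a cochain \<Rightarrow> 'a cochain set" where
  "cohom_class p X c = {\<lambda>s. c s + b s | b. b \<in> coboundaries p X}"

text \<open>
  \<open>H\<^sup>p(X, \<complex>)\<close> as a complex vector space.  The record type of modules has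
  fields \<open>mult\<close> and \<open>one\<close> that play no role for modules.
\<close>

definition cohomology :: "nat \<Rightarrow> 'a topology \<Rightarrow> (complex, 'a cochain set) module" where
  "cohomology p X =
     \<lparr>carrier = cohom_class p X ` cocycles p X,
      mult = undefined,
      one = undefined,
      zero = cohom_class p X (\<lambda>s. 0),
      add = (\<lambda>a b. \<Union>c \<in> a. \<Union>d \<in> b. cohom_class p X (\<lambda>s. c s + d s)),
      smult = (\<lambda>z a. \<Union>c \<in> a. cohom_class p X (\<lambda>s. z * c s))\<rparr>"

definition cohom_pullback ::
    "nat \<Rightarrow> 'a topology \<Rightarrow> ('a \<Rightarrow> 'b) \<Rightarrow> 'b cochain set \<Rightarrow> 'a cochain set" where
  "cohom_pullback p X f a =
     (\<Union>c \<in> a. cohom_class p X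
        (\<lambda>s. if singular_simplex p X s then c (simplex_map p f s) else 0))"

text \<open>The inverse of the pullback along \<open>act k\<close> is the pullback along the action of \<open>k\<inverse>\<close>.\<close>

definition cohom_action ::
    "('k, 'b) monoid_scheme \<Rightarrow> ('k \<Rightarrow> 'a \<Rightarrow> 'a) \<Rightarrow> 'a topology \<Rightarrow> nat \<Rightarrow>
     'k \<Rightarrow> 'a cochain set \<Rightarrow> 'a cochain set" where
  "cohom_action K act X p k = cohom_pullback p X (act (inv\<^bsub>K\<^esub> k))"

text \<open>
  \<open>P\<^sup>K(X, t)\<close>, an element of \<open>R\<^sub>+(K)[t]\<close> whenever the total cohomology of \<open>X\<close> has finite
  dimension, as is the case for all complex algebraic varieties.  For other spaces it is not
  meaningful and is given the value 0.
\<close>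

definition finite_total_cohomology :: "'a topology \<Rightarrow> bool" where
  "finite_total_cohomology X \<longleftrightarrow>
     (\<forall>p. vectorspace.fin_dim class_ring (cohomology p X)) \<and>
     (\<exists>N. \<forall>p>N. carrier (cohomology p X) = {zero (cohomology p X)})"

definition poincare_poly ::
    "('k, 'b) monoid_scheme \<Rightarrow> ('k \<Rightarrow> 'a \<Rightarrow> 'a) \<Rightarrow> 'a::topological_space set \<Rightarrow>
     nat \<Rightarrow> 'k virtual_rep" where
  "poincare_poly K act S =
     (if finite_total_cohomology (top_of_set S)
      then (\<lambda>i. class_of_module K (cohomology i (top_of_set S)) (cohom_action K act (top_of_set S) i))
      else zero (UP (rep_ring K)))"

definition equivariant_euler ::
    "('k, 'b) monoid_scheme \<Rightarrow> ('k \<Rightarrow> 'a \<Rightarrow> 'a) \<Rightarrow> 'a::topological_space set \<Rightarrow> 'k virtual_rep" where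
  "equivariant_euler K act S =
     eval (rep_ring K) (rep_ring K) id (\<ominus>\<^bsub>rep_ring K\<^esub> \<one>\<^bsub>rep_ring K\<^esub>) (poincare_poly K act S)"


section \<open>Complex reflection groups\<close>

text \<open>The index type \<open>'n\<close> has \<open>\<ell>\<close> elements, and \<open>vec.dim\<close> is the dimension over \<open>\<complex>\<close>.\<close>

definition GL_group :: "(complex^'n^'n) monoid" where
  "GL_group = \<lparr>carrier = {g. invertible g}, mult = (**), one = Finite_Cartesian_Product.mat 1\<rparr>"

definition fixed_space :: "complex^'n^'n \<Rightarrow> (complex^'n) set" where
  "fixed_space g = {v. g *v v = v}"

text \<open>Only applied to elements of finite groups, so finite order is not required here.\<close>

definition is_reflection :: "complex^'n^'n \<Rightarrow> bool" where
  "is_reflection g \<longleftrightarrow> invertible g \<and> vec.dim (fixed_space g) = CARD('n) - 1"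

definition finite_reflection_group :: "(complex^'n^'n) set \<Rightarrow> bool" where
  "finite_reflection_group G \<longleftrightarrow>
     finite G \<and> subgroup G GL_group \<and> generate GL_group {g \<in> G. is_reflection g} = G"

definition acts_irreducibly :: "(complex^'n^'n) set \<Rightarrow> bool" where
  "acts_irreducibly G \<longleftrightarrow>
     (\<forall>W. vec.subspace W \<and> (\<forall>g \<in> G. \<forall>w \<in> W. g *v w \<in> W) \<longrightarrow> W = {0} \<or> W = UNIV)"

definition reflecting_hyperplanes :: "(complex^'n^'n) set \<Rightarrow> (complex^'n) set set" where
  "reflecting_hyperplanes G = fixed_space ` {g \<in> G. is_reflection g}"

definition stabiliser_order :: "(complex^'n^'n) set \<Rightarrow> (complex^'n) set \<Rightarrow> nat" where
  "stabiliser_order G H = card {g \<in> G. \<forall>v \<in> H. g *v v = v}"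

text \<open>The argument \<open>l\<close> below assigns to every reflecting hyperplane a linear form.\<close>

definition defining_forms ::
    "(complex^'n^'n) set \<Rightarrow> ((complex^'n) set \<Rightarrow> complex^'n \<Rightarrow> complex) \<Rightarrow> bool" where
  "defining_forms G l \<longleftrightarrow>
     (\<forall>H \<in> reflecting_hyperplanes G. Vector_Spaces.linear (*s) (*) (l H) \<and> {v. l H v = 0} = H)"

definition defining_poly :: "(complex^'n^'n) set \<Rightarrow> ((complex^'n) set \<Rightarrow> complex^'n \<Rightarrow> complex) \<Rightarrow>
    complex^'n \<Rightarrow> complex" where
  "defining_poly G l v = (\<Prod>H \<in> reflecting_hyperplanes G. l H v ^ stabiliser_order G H)"

text \<open>The degree \<open>m\<close> of \<open>Q = \<Prod>\<^sub>H \<ell>\<^sub>H ^ e\<^sub>H\<close>, the following product of linear forms.\<close>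

definition poly_degree :: "(complex^'n^'n) set \<Rightarrow> nat" where
  "poly_degree G = (\<Sum>H \<in> reflecting_hyperplanes G. stabiliser_order G H)"

definition reduced_poly :: "(complex^'n^'n) set \<Rightarrow> ((complex^'n) set \<Rightarrow> complex^'n \<Rightarrow> complex) \<Rightarrow>
    complex^'n \<Rightarrow> complex" where
  "reduced_poly G l v = (\<Prod>H \<in> reflecting_hyperplanes G. l H v)"

definition milnor_fibre :: "(complex^'n^'n) set \<Rightarrow> ((complex^'n) set \<Rightarrow> complex^'n \<Rightarrow> complex) \<Rightarrow>
    (complex^'n) set" where
  "milnor_fibre G l = {v. defining_poly G l v = 1}"

definition reduced_fibre :: "(complex^'n^'n) set \<Rightarrow> ((complex^'n) set \<Rightarrow> complex^'n \<Rightarrow> complex) \<Rightarrow>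
    (complex^'n) set" where
  "reduced_fibre G l = {v. reduced_poly G l v = 1}"

text \<open>The character \<open>\<epsilon>\<close>, as a representation of degree 1.\<close>

definition eps :: "(complex^'n^'n) set \<Rightarrow> ((complex^'n) set \<Rightarrow> complex^'n \<Rightarrow> complex) \<Rightarrow>
    (complex^'n^'n) rep" where
  "eps G l g = (THE c. \<forall>v. reduced_poly G l (matrix_inv g *v v) = c * reduced_poly G l v) \<cdot>\<^sub>m 1\<^sub>m 1"

definition roots_of_unity_group :: "nat \<Rightarrow> complex monoid" where
  "roots_of_unity_group m = \<lparr>carrier = {\<xi>. \<xi> ^ m = 1}, mult = (*), one = 1\<rparr>"

definition Gamma_group :: "(complex^'n^'n) set \<Rightarrow> ((complex^'n^'n) \<times> complex) monoid" where
  "Gamma_group G = (GL_group\<lparr>carrier := G\<rparr>) \<times>\<times> roots_of_unity_group (poly_degree G)"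

definition Gamma_act :: "(complex^'n^'n) \<times> complex \<Rightarrow> complex^'n \<Rightarrow> complex^'n" where
  "Gamma_act = (\<lambda>(g, \<xi>) v. inverse \<xi> *s (g *v v))"

text \<open>The representation \<open>\<rho> \<otimes> \<gamma>\<^sub>i\<close> of \<open>\<Gamma>\<close>.\<close>

definition twist :: "'g rep \<Rightarrow> nat \<Rightarrow> ('g \<times> complex) rep" where
  "twist \<rho> i = (\<lambda>(g, \<xi>). \<xi> ^ i \<cdot>\<^sub>m \<rho> g)"

definition Gamma0 :: "(complex^'n^'n) set \<Rightarrow> ((complex^'n) set \<Rightarrow> complex^'n \<Rightarrow> complex) \<Rightarrow>
    ((complex^'n^'n) \<times> complex) set" where
  "Gamma0 G l =
     kernel (Gamma_group G) (ring_mat TYPE(complex) 1 ()) (twist (eps G l) (poly_degree G div 2))"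

end

theory Submission
  imports Defs "HOL-Computational_Algebra.Fundamental_Theorem_Algebra"
begin

text \<open>
  The fibre \<open>F\<close> is the disjoint union of the clopen pieces \<open>F\<^sub>0 = {Q\<^sub>0 = 1}\<close> and \<open>{Q\<^sub>0 = -1}\<close>, which an
  element \<open>(g, \<xi>)\<close> of \<open>\<Gamma>\<close> preserves or swaps according to the sign
  \<open>\<theta>(g, \<xi>) = \<epsilon>(g) \<xi> ^ (m/2)\<close>.  Hence \<open>H(F)\<close> is induced from the representation \<open>\<rho>\<^sub>0\<close> of \<open>\<Gamma>\<^sub>0\<close> on \<open>H(F\<^sub>0)\<close>.
  The element \<open>s = (1, exp (2 \<pi> i / m))\<close> is central and has sign \<open>-1\<close>, and \<open>\<rho>\<^sub>0(s\<^sup>2)\<close> has finite order,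
  so it has a square root that is a polynomial in \<open>\<rho>\<^sub>0(s\<^sup>2)\<close>.  Sending \<open>s\<close> to this square root extends
  \<open>\<rho>\<^sub>0\<close> to a representation \<open>\<rho>\<close> of \<open>\<Gamma>\<close>, and the induced representation is \<open>\<rho> \<oplus> \<theta>\<rho>\<close>.  The value 0
  that the polynomials take when the total cohomology is infinite does no harm, because \<open>F\<close> and
  \<open>F\<^sub>0\<close> have finite total cohomology simultaneously.
\<close>

section \<open>Direct sums and tensor products of matrix representations\<close>

text \<open>Why a square root is needed: if m/2 is odd, the scalar -1 has order two and sign -1, so
  Gamma splits as Gamma_0 times a group of order two and every representation of Gamma_0 extends at
  once. A reflection has order two, but extending to a non-central element requires an operator that
  intertwines the representation with a conjugate of itself. For the central element s the only
  requirement is a matrix Q that commutes with the image of Gamma_0 and satisfies Q Q = rho_0(s^2).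
  A root that is a polynomial in rho_0(s^2) commutes automatically, because s^2 is central. The
  second task is that R(K) is a set of concrete classes of pairs, whose ring laws have to be proved.
  They are reduced to laws of the semiring of isomorphism classes. Equality in R(K) allows a common
  extra summand, so no cancellation law for representations is required.\<close>

lemma is_repI:
  assumes "\<And>g. g \<in> carrier K \<Longrightarrow> \<rho> g \<in> carrier_mat n n"
    and "\<And>g h. g \<in> carrier K \<Longrightarrow> h \<in> carrier K \<Longrightarrow> \<rho> (g \<otimes>\<^bsub>K\<^esub> h) = \<rho> g * \<rho> h"
    and "\<rho> \<one>\<^bsub>K\<^esub> = 1\<^sub>m n"
  shows "is_rep K \<rho>" and "rep_degree K \<rho> = n"
  using assms unfolding is_rep_def rep_degree_def hom_def by (auto simp: ring_mat_simps)

lemma is_repD: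
  assumes "is_rep K \<rho>"
  shows "g \<in> carrier K \<Longrightarrow> \<rho> g \<in> carrier_mat (rep_degree K \<rho>) (rep_degree K \<rho>)"
    and "g \<in> carrier K \<Longrightarrow> h \<in> carrier K \<Longrightarrow> \<rho> (g \<otimes>\<^bsub>K\<^esub> h) = \<rho> g * \<rho> h"
    and "\<rho> \<one>\<^bsub>K\<^esub> = 1\<^sub>m (rep_degree K \<rho>)"
  using assms unfolding is_rep_def hom_def by (auto simp: ring_mat_simps)

lemma rep_zero: "is_rep K rep_zero" "rep_degree K rep_zero = 0"
  by (rule is_repI; simp add: rep_zero_def)+

lemma rep_one: "is_rep K rep_one" "rep_degree K rep_one = 1"
  by (rule is_repI; simp add: rep_one_def)+

lemma rep_sum:
  assumes \<rho>: "is_rep K \<rho>" and \<sigma>: "is_rep K \<sigma>"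
  shows "is_rep K (rep_sum \<rho> \<sigma>)"
    and "rep_degree K (rep_sum \<rho> \<sigma>) = rep_degree K \<rho> + rep_degree K \<sigma>"
proof -
  let ?n = "rep_degree K \<rho>" and ?m = "rep_degree K \<sigma>"
  have c: "\<rho> g \<in> carrier_mat ?n ?n" "\<sigma> g \<in> carrier_mat ?m ?m" if "g \<in> carrier K" for g
    using is_repD(1)[OF \<rho> that] is_repD(1)[OF \<sigma> that] by auto
  have 1: "rep_sum \<rho> \<sigma> g \<in> carrier_mat (?n + ?m) (?n + ?m)" if "g \<in> carrier K" for g
    using c[OF that] unfolding rep_sum_def by auto
  have 2: "rep_sum \<rho> \<sigma> (g \<otimes>\<^bsub>K\<^esub> h) = rep_sum \<rho> \<sigma> g * rep_sum \<rho> \<sigma> h"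
    if g: "g \<in> carrier K" and h: "h \<in> carrier K" for g h
    using c[OF g] c[OF h] unfolding rep_sum_def is_repD(2)[OF \<rho> g h] is_repD(2)[OF \<sigma> g h]
    by (subst mult_four_block_mat[of _ ?n ?n _ ?m _ ?m _ _ ?n _ ?m]) auto
  have 3: "rep_sum \<rho> \<sigma> \<one>\<^bsub>K\<^esub> = 1\<^sub>m (?n + ?m)"
    using is_repD(3)[OF \<rho>] is_repD(3)[OF \<sigma>] unfolding rep_sum_def by auto
  show "is_rep K (rep_sum \<rho> \<sigma>)" "rep_degree K (rep_sum \<rho> \<sigma>) = ?n + ?m"
    by (rule is_repI[of K _ "?n + ?m"]; fact 1 2 3)+
qed

lemma kronecker_carrier:
  "A \<in> carrier_mat a b \<Longrightarrow> B \<in> carrier_mat c d \<Longrightarrow> kronecker A B \<in> carrier_mat (a * c) (b * d)"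
  unfolding kronecker_def by auto

text \<open>Rows and columns of a Kronecker product are numbered by two digits,
  \<open>k = p * d + q\<close>. Matrix multiplication sums over such \<open>k\<close>, and the sum
  factors only after it has been split by digits.\<close>

lemma sum_div_mod:
  fixes f :: "nat \<Rightarrow> nat \<Rightarrow> 'a::comm_monoid_add"
  shows "(\<Sum>k = 0..<b * d. f (k div d) (k mod d)) = (\<Sum>p = 0..<b. \<Sum>q = 0..<d. f p q)"
proof -
  have "(\<Sum>k = 0..<b * d. f (k div d) (k mod d))
      = (\<Sum>p<b. \<Sum>k = p * d..<p * d + d. f (k div d) (k mod d))"
    unfolding sum.nat_group by (simp add: lessThan_atLeast0)
  also have "\<dots> = (\<Sum>p<b. \<Sum>q = 0..<d. f p q)"
  proof (rule sum.cong[OF refl])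
    fix p
    have "(\<Sum>k = p * d..<p * d + d. f (k div d) (k mod d))
        = (\<Sum>k = 0 + p * d..<d + p * d. f (k div d) (k mod d))" by (simp add: add.commute)
    also have "\<dots> = (\<Sum>q = 0..<d. f ((q + p * d) div d) ((q + p * d) mod d))"
      by (rule sum.shift_bounds_nat_ivl)
    also have "\<dots> = (\<Sum>q = 0..<d. f p q)" by (rule sum.cong) auto
    finally show "(\<Sum>k = p * d..<p * d + d. f (k div d) (k mod d)) = (\<Sum>q = 0..<d. f p q)" .
  qed
  finally show ?thesis by (simp add: lessThan_atLeast0)
qed

lemma less_mult_div_mod:
  assumes "i < a * (c::nat)" shows "i div c < a" "i mod c < c"
proof -
  have "c > 0" using assms by (auto intro!: Nat.gr0I)
  thus "i div c < a" "i mod c < c" using assms by (auto simp: less_mult_imp_div_less)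
qed

lemma kronecker_mult:
  assumes "A \<in> carrier_mat a b" "B \<in> carrier_mat c d" "A' \<in> carrier_mat b e" "B' \<in> carrier_mat d f"
  shows "kronecker A B * kronecker A' B' = kronecker (A * A') (B * B')"
proof (rule eq_matI)
  fix i j assume "i < dim_row (kronecker (A * A') (B * B'))" "j < dim_col (kronecker (A * A') (B * B'))"
  hence i: "i < a * c" and j: "j < e * f" using assms by (auto simp: kronecker_def)
  note ii = less_mult_div_mod[OF i] and jj = less_mult_div_mod[OF j]
  have "(kronecker A B * kronecker A' B') $$ (i, j)
     = (\<Sum>k = 0..<b * d. A $$ (i div c, k div d) * B $$ (i mod c, k mod d) *
          (A' $$ (k div d, j div f) * B' $$ (k mod d, j mod f)))"
    using assms i j by (simp add: kronecker_def scalar_prod_def)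
  also have "\<dots> = (\<Sum>p = 0..<b. \<Sum>q = 0..<d. A $$ (i div c, p) * B $$ (i mod c, q) *
          (A' $$ (p, j div f) * B' $$ (q, j mod f)))"
    by (rule sum_div_mod)
  also have "\<dots> = (\<Sum>p = 0..<b. A $$ (i div c, p) * A' $$ (p, j div f)) *
      (\<Sum>q = 0..<d. B $$ (i mod c, q) * B' $$ (q, j mod f))"
    unfolding sum_product by (intro sum.cong) auto
  also have "\<dots> = kronecker (A * A') (B * B') $$ (i, j)"
    using assms i j ii jj by (simp add: kronecker_def scalar_prod_def)
  finally show "(kronecker A B * kronecker A' B') $$ (i, j) = kronecker (A * A') (B * B') $$ (i, j)" .
qed (use assms in \<open>auto simp: kronecker_def\<close>)

lemma kronecker_one: "kronecker (1\<^sub>m a) (1\<^sub>m b) = 1\<^sub>m (a * b)"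
proof (rule eq_matI)
  fix i j assume "i < dim_row (1\<^sub>m (a * b) :: complex Matrix.mat)" "j < dim_col (1\<^sub>m (a * b) :: complex Matrix.mat)"
  hence i: "i < a * b" and j: "j < a * b" by auto
  have "i = j" if "i div b = j div b" "i mod b = j mod b"
  proof -
    have "i = i div b * b + i mod b" by simp
    also have "\<dots> = j" unfolding that by simp
    finally show ?thesis .
  qed
  thus "kronecker (1\<^sub>m a) (1\<^sub>m b) $$ (i, j) = 1\<^sub>m (a * b) $$ (i, j)"
    using i j less_mult_div_mod[OF i] less_mult_div_mod[OF j] by (auto simp: kronecker_def)
qed (auto simp: kronecker_def)

lemma kronecker_one_left: "kronecker (1\<^sub>m 1) A = A"
  by (rule eq_matI) (auto simp: kronecker_def)

text \<open>Both bracketings number the triples of indices by the same three digits, so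
  associativity is an equality and not only an isomorphism.\<close>

lemma kronecker_assoc: "kronecker (kronecker A B) C = kronecker A (kronecker B C)"
proof (rule eq_matI)
  fix i j assume "i < dim_row (kronecker A (kronecker B C))" "j < dim_col (kronecker A (kronecker B C))"
  hence i: "i < dim_row A * dim_row B * dim_row C" and j: "j < dim_col A * dim_col B * dim_col C"
    by (auto simp: kronecker_def mult.assoc)
  note ii = less_mult_div_mod[OF i] and jj = less_mult_div_mod[OF j]
  have key: "k mod (b * c) div c = k div c mod b" "k mod (b * c) mod c = k mod c"
      "k div (b * c) = k div c div b" if "c > 0" for k b c :: nat
    using that by (auto simp: mult.commute[of b c] mod_mult2_eq div_mult2_eq)
  have pos: "dim_row C > 0" "dim_col C > 0" "dim_row B > 0" "dim_col B > 0"
    using i j by (auto intro!: Nat.gr0I)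
  show "kronecker (kronecker A B) C $$ (i, j) = kronecker A (kronecker B C) $$ (i, j)"
    using i j ii jj pos key[OF pos(1), of i "dim_row B"] key[OF pos(2), of j "dim_col B"]
    by (auto simp: kronecker_def mult.assoc[symmetric])
qed (auto simp: kronecker_def)

text \<open>The left factor supplies the leading digit of an index, so cutting it into blocks cuts
  the product into consecutive blocks. A block decomposition of the right factor would come out with
  its basis reordered.\<close>

lemma kronecker_block_diag:
  assumes "A \<in> carrier_mat a a" "D \<in> carrier_mat d d" "B \<in> carrier_mat b b"
  shows "kronecker (four_block_mat A (0\<^sub>m a d) (0\<^sub>m d a) D) B
     = four_block_mat (kronecker A B) (0\<^sub>m (a * b) (d * b)) (0\<^sub>m (d * b) (a * b)) (kronecker D B)"
    (is "?L = ?R")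
proof (rule eq_matI)
  fix i j assume "i < dim_row ?R" "j < dim_col ?R"
  hence i: "i < (a + d) * b" and j: "j < (a + d) * b"
    using assms by (auto simp: kronecker_def distrib_right)
  note ii = less_mult_div_mod[OF i] and jj = less_mult_div_mod[OF j]
  have b: "b > 0" using i by (auto intro!: Nat.gr0I)
  have lt: "k div b < a \<longleftrightarrow> k < a * b" for k using b by (simp add: div_less_iff_less_mult)
  have bnd: "k div b - a < d" if "k < (a + d) * b" "\<not> k < a * b" for k
    using less_mult_div_mod(1)[OF that(1)] that(2) lt[of k] by linarith
  \<comment> \<open>Passing to the second diagonal block subtracts \<open>a * b\<close> from the
    index, that is, \<open>a\<close> from its leading digit.\<close>
  have ge: "(k - a * b) div b = k div b - a \<and> (k - a * b) mod b = k mod b" if "\<not> k < a * b" for k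
  proof -
    obtain r where "k = a * b + r" using \<open>\<not> k < a * b\<close> by (metis le_Suc_ex not_less)
    thus ?thesis using b by simp
  qed
  show "?L $$ (i, j) = ?R $$ (i, j)"
  proof -
    have dims: "dim_row A = a" "dim_col A = a" "dim_row D = d" "dim_col D = d" "dim_row B = b" "dim_col B = b"
      using assms by auto
    have "?L $$ (i, j) = four_block_mat A (0\<^sub>m a d) (0\<^sub>m d a) D $$ (i div b, j div b) * B $$ (i mod b, j mod b)"
      using i j dims by (simp add: kronecker_def)
    moreover have "?R $$ (i, j) = (if i < a * b then if j < a * b then kronecker A B $$ (i, j) else 0
        else if j < a * b then 0 else kronecker D B $$ (i - a * b, j - a * b))"
      using i j dims by (simp add: kronecker_def distrib_right)
    ultimately show ?thesis
      using ii jj i j dims by (auto simp: kronecker_def lt ge bnd less_diff_conv2 distrib_right)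
  qed
qed (use assms in \<open>auto simp: kronecker_def distrib_right\<close>)

lemma rep_tensor:
  assumes \<rho>: "is_rep K \<rho>" and \<sigma>: "is_rep K \<sigma>"
  shows "is_rep K (rep_tensor \<rho> \<sigma>)"
    and "rep_degree K (rep_tensor \<rho> \<sigma>) = rep_degree K \<rho> * rep_degree K \<sigma>"
proof -
  let ?n = "rep_degree K \<rho>" and ?m = "rep_degree K \<sigma>"
  note c = is_repD(1)[OF \<rho>] is_repD(1)[OF \<sigma>]
  have 1: "rep_tensor \<rho> \<sigma> g \<in> carrier_mat (?n * ?m) (?n * ?m)" if "g \<in> carrier K" for g
    using c[OF that] unfolding rep_tensor_def by (auto intro: kronecker_carrier)
  have 2: "rep_tensor \<rho> \<sigma> (g \<otimes>\<^bsub>K\<^esub> h) = rep_tensor \<rho> \<sigma> g * rep_tensor \<rho> \<sigma> h"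
    if g: "g \<in> carrier K" and h: "h \<in> carrier K" for g h
    unfolding rep_tensor_def is_repD(2)[OF \<rho> g h] is_repD(2)[OF \<sigma> g h]
    by (rule kronecker_mult[symmetric, OF c(1)[OF g] c(2)[OF g] c(1)[OF h] c(2)[OF h]])
  have 3: "rep_tensor \<rho> \<sigma> \<one>\<^bsub>K\<^esub> = 1\<^sub>m (?n * ?m)"
    unfolding rep_tensor_def is_repD(3)[OF \<rho>] is_repD(3)[OF \<sigma>] by (rule kronecker_one)
  show "is_rep K (rep_tensor \<rho> \<sigma>)" "rep_degree K (rep_tensor \<rho> \<sigma>) = ?n * ?m"
    by (rule is_repI[of K _ "?n * ?m"]; fact 1 2 3)+
qed

section \<open>Isomorphisms of representations and their compatibility with sums and tensor
  products\<close>

lemma rep_isoI: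
  assumes "is_rep K \<rho>" "is_rep K \<sigma>" "rep_degree K \<rho> = n" "rep_degree K \<sigma> = n"
    and "S \<in> carrier_mat n n" "S' \<in> carrier_mat n n" "S * S' = 1\<^sub>m n" "S' * S = 1\<^sub>m n"
    and "\<And>g. g \<in> carrier K \<Longrightarrow> S * \<rho> g = \<sigma> g * S"
  shows "rep_iso K \<rho> \<sigma>"
proof -
  have "invertible_mat S"
    using assms unfolding invertible_mat_def inverts_mat_def by (auto intro!: exI[of _ S'])
  thus ?thesis using assms unfolding rep_iso_def by auto
qed

lemma rep_isoE:
  assumes "rep_iso K \<rho> \<sigma>"
  obtains n S S' where "rep_degree K \<rho> = n" "rep_degree K \<sigma> = n"
    "S \<in> carrier_mat n n" "S' \<in> carrier_mat n n" "S * S' = 1\<^sub>m n" "S' * S = 1\<^sub>m n"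
    "\<And>g. g \<in> carrier K \<Longrightarrow> S * \<rho> g = \<sigma> g * S"
proof -
  obtain S where S: "S \<in> carrier_mat (rep_degree K \<rho>) (rep_degree K \<rho>)" "invertible_mat S"
      "\<forall>g \<in> carrier K. S * \<rho> g = \<sigma> g * S" and deg: "rep_degree K \<rho> = rep_degree K \<sigma>"
    using assms unfolding rep_iso_def by auto
  then obtain S' where S': "S * S' = 1\<^sub>m (rep_degree K \<rho>)" "S' * S = 1\<^sub>m (dim_row S')"
    unfolding invertible_mat_def inverts_mat_def by auto
  \<comment> \<open>Invertibility says nothing explicit about the size of the inverse; it is read
    off from the columns of the two identity matrices.\<close>
  have "dim_col S' = rep_degree K \<rho>" "dim_row S' = rep_degree K \<rho>"
    using S(1) arg_cong[OF S'(1), of dim_col] arg_cong[OF S'(2), of dim_col] by auto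
  hence c: "S' \<in> carrier_mat (rep_degree K \<rho>) (rep_degree K \<rho>)" and d: "dim_row S' = rep_degree K \<rho>"
    by auto
  show thesis
    by (rule that[OF refl deg[symmetric] S(1) c S'(1) S'(2)[unfolded d]]) (use S(3) in blast)
qed

text \<open>Representations are total functions with arbitrary values off the carrier. Agreement on
  the carrier therefore does not make them equal, but it does put them into the same class.\<close>

lemma rep_iso_eqI:
  assumes "is_rep K \<rho>" "is_rep K \<sigma>" "\<And>g. g \<in> carrier K \<Longrightarrow> \<rho> g = \<sigma> g" "\<one>\<^bsub>K\<^esub> \<in> carrier K"
  shows "rep_iso K \<rho> \<sigma>"
proof -
  have n: "rep_degree K \<sigma> = rep_degree K \<rho>" using assms(3)[OF assms(4)] by (simp add: rep_degree_def)
  show ?thesis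
    by (rule rep_isoI[OF assms(1,2) refl n, of "1\<^sub>m _" "1\<^sub>m _"])
      (auto simp: assms(3)[symmetric] left_mult_one_mat[OF is_repD(1)[OF assms(1)]]
        right_mult_one_mat[OF is_repD(1)[OF assms(1)]])
qed

lemma rep_iso_refl: "is_rep K \<rho> \<Longrightarrow> rep_iso K \<rho> \<rho>"
  by (rule rep_isoI[OF _ _ refl refl, of _ _ "1\<^sub>m _" "1\<^sub>m _"])
    (auto simp: left_mult_one_mat[OF is_repD(1)] right_mult_one_mat[OF is_repD(1)])

lemma rep_iso_sym:
  assumes r: "is_rep K \<rho>" "is_rep K \<sigma>" and iso: "rep_iso K \<rho> \<sigma>" shows "rep_iso K \<sigma> \<rho>"
proof -
  obtain n S S' where *: "rep_degree K \<rho> = n" "rep_degree K \<sigma> = n"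
    "S \<in> carrier_mat n n" "S' \<in> carrier_mat n n" "S * S' = 1\<^sub>m n" "S' * S = 1\<^sub>m n"
    "\<And>g. g \<in> carrier K \<Longrightarrow> S * \<rho> g = \<sigma> g * S" using rep_isoE[OF iso] by metis
  have "S' * \<sigma> g = \<rho> g * S'" if g: "g \<in> carrier K" for g
  proof -
    have c: "\<rho> g \<in> carrier_mat n n" "\<sigma> g \<in> carrier_mat n n"
      using is_repD(1)[OF r(1) g] is_repD(1)[OF r(2) g] * by auto
    have "S' * \<sigma> g = S' * (\<sigma> g * (S * S'))" unfolding *(5) using c(2) by simp
    also have "\<dots> = S' * (\<sigma> g * S * S')" by (simp only: assoc_mult_mat[OF c(2) *(3,4)])
    also have "\<dots> = S' * (S * \<rho> g * S')" using *(7)[OF g] by simp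
    also have "\<dots> = S' * (S * (\<rho> g * S'))" by (simp only: assoc_mult_mat[OF *(3) c(1) *(4)])
    also have "\<dots> = S' * S * (\<rho> g * S')"
      using c(1) *(3,4) by (intro assoc_mult_mat[symmetric, of _ n n _ n _ n]) auto
    also have "\<dots> = \<rho> g * S'" unfolding *(6) using c(1) *(4) by simp
    finally show ?thesis .
  qed
  thus ?thesis by (intro rep_isoI[OF r(2,1) *(2,1,4,3,6,5)])
qed

lemma rep_iso_trans:
  assumes r: "is_rep K \<rho>" "is_rep K \<sigma>" "is_rep K \<tau>"
    and iso: "rep_iso K \<rho> \<sigma>" "rep_iso K \<sigma> \<tau>" shows "rep_iso K \<rho> \<tau>"
proof -
  obtain n S S' where S: "rep_degree K \<rho> = n" "rep_degree K \<sigma> = n"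
    "S \<in> carrier_mat n n" "S' \<in> carrier_mat n n" "S * S' = 1\<^sub>m n" "S' * S = 1\<^sub>m n"
    "\<And>g. g \<in> carrier K \<Longrightarrow> S * \<rho> g = \<sigma> g * S" using rep_isoE[OF iso(1)] by metis
  obtain m T T' where T': "rep_degree K \<sigma> = m" "rep_degree K \<tau> = m"
    "T \<in> carrier_mat m m" "T' \<in> carrier_mat m m" "T * T' = 1\<^sub>m m" "T' * T = 1\<^sub>m m"
    "\<And>g. g \<in> carrier K \<Longrightarrow> T * \<sigma> g = \<tau> g * T" using rep_isoE[OF iso(2)] by metis
  have "m = n" using S T' by simp
  note T = T'[unfolded this]
  have inv: "(A * B) * (B' * A') = 1\<^sub>m n" if "A \<in> carrier_mat n n" "B \<in> carrier_mat n n"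
      "A' \<in> carrier_mat n n" "B' \<in> carrier_mat n n" "A * A' = 1\<^sub>m n" "B * B' = 1\<^sub>m n"
    for A B A' B' :: "complex Matrix.mat"
  proof -
    have "(A * B) * (B' * A') = A * (B * (B' * A'))"
      using that by (intro assoc_mult_mat[of _ n n _ n _ n]) auto
    also have "B * (B' * A') = (B * B') * A'"
      using that by (intro assoc_mult_mat[symmetric, of _ n n _ n _ n]) auto
    finally show ?thesis using that by simp
  qed
  have "T * S * \<rho> g = \<tau> g * (T * S)" if g: "g \<in> carrier K" for g
  proof -
    have c: "\<rho> g \<in> carrier_mat n n" "\<sigma> g \<in> carrier_mat n n" "\<tau> g \<in> carrier_mat n n"
      using is_repD(1)[OF r(1) g] is_repD(1)[OF r(2) g] is_repD(1)[OF r(3) g] S T by auto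
    have "T * S * \<rho> g = T * (S * \<rho> g)" by (rule assoc_mult_mat[of _ n n _ n _ n]) (fact c S T)+
    also have "\<dots> = T * (\<sigma> g * S)" using S(7)[OF g] by simp
    also have "\<dots> = T * \<sigma> g * S" by (rule assoc_mult_mat[symmetric, of _ n n _ n _ n]) (fact c S T)+
    also have "\<dots> = \<tau> g * T * S" using T(7)[OF g] by simp
    also have "\<dots> = \<tau> g * (T * S)" by (rule assoc_mult_mat[of _ n n _ n _ n]) (fact c S T)+
    finally show ?thesis .
  qed
  thus ?thesis
    by (intro rep_isoI[OF r(1,3) S(1) T(2), of "T * S" "S' * T'"])
      (simp_all only: inv[OF T(3) S(3) T(4) S(4) T(5) S(5)] inv[OF S(4) T(4) S(3) T(3) S(6) T(6)]
        mult_carrier_mat[OF T(3) S(3)] mult_carrier_mat[OF S(4) T(4)])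
qed

text \<open>The intertwiner is the permutation matrix of \<open>p\<close>, and its transpose is the
  inverse. This serves the two commutativity laws, whose sides differ only in the order of the
  basis.\<close>

lemma rep_iso_permI:
  assumes r: "is_rep K \<rho>" "is_rep K \<sigma>" "rep_degree K \<rho> = n" "rep_degree K \<sigma> = n"
    and p: "bij_betw p {0..<n} {0..<n}"
    and e: "\<And>g i j. g \<in> carrier K \<Longrightarrow> i < n \<Longrightarrow> j < n \<Longrightarrow> \<rho> g $$ (i, j) = \<sigma> g $$ (p i, p j)"
  shows "rep_iso K \<rho> \<sigma>"
proof -
  let ?S = "Matrix.mat n n (\<lambda>(i, j). if i = p j then 1 else 0) :: complex Matrix.mat"
  let ?S' = "Matrix.mat n n (\<lambda>(i, j). if j = p i then 1 else 0) :: complex Matrix.mat"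
  have p_lt: "p i < n" if "i < n" for i using p that by (auto simp: bij_betw_def)
  have p_inj: "p i = p j \<longleftrightarrow> i = j" if "i < n" "j < n" for i j
    using p that by (auto simp: bij_betw_def inj_on_def)
  have p_sum: "(\<Sum>k = 0..<n. f (p k)) = (\<Sum>k = 0..<n. f k)" for f :: "nat \<Rightarrow> complex"
    using sum.reindex_bij_betw[OF p] .
  have 1: "?S * ?S' = 1\<^sub>m n"
  proof (rule eq_matI)
    fix i j assume "i < dim_row (1\<^sub>m n :: complex Matrix.mat)" "j < dim_col (1\<^sub>m n :: complex Matrix.mat)"
    hence ij: "i < n" "j < n" by auto
    have "(?S * ?S') $$ (i, j) = (\<Sum>k = 0..<n. (if i = p k then 1 else 0) * (if j = p k then 1 else 0))"
      using ij by (simp add: scalar_prod_def)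
    also have "\<dots> = (\<Sum>k = 0..<n. (if i = k then 1 else 0) * (if j = k then 1 else 0))"
      by (rule p_sum)
    also have "\<dots> = (\<Sum>k = 0..<n. if i = k then (if j = k then 1 else 0) else 0)"
      by (rule sum.cong) auto
    finally show "(?S * ?S') $$ (i, j) = 1\<^sub>m n $$ (i, j)" using ij by simp
  qed auto
  have 2: "?S' * ?S = 1\<^sub>m n"
  proof (rule eq_matI)
    fix i j assume "i < dim_row (1\<^sub>m n :: complex Matrix.mat)" "j < dim_col (1\<^sub>m n :: complex Matrix.mat)"
    hence ij: "i < n" "j < n" by auto
    have "(?S' * ?S) $$ (i, j) = (\<Sum>k = 0..<n. (if k = p i then 1 else 0) * (if k = p j then 1 else 0))"
      using ij by (simp add: scalar_prod_def)
    also have "\<dots> = (\<Sum>k = 0..<n. if k = p i then (if p i = p j then 1 else 0) else 0)"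
      by (rule sum.cong) auto
    finally show "(?S' * ?S) $$ (i, j) = 1\<^sub>m n $$ (i, j)" using ij p_lt p_inj by simp
  qed auto
  show ?thesis
  proof (rule rep_isoI[OF r, of ?S ?S'])
    fix g assume g: "g \<in> carrier K"
    have c: "\<rho> g \<in> carrier_mat n n" "\<sigma> g \<in> carrier_mat n n"
      using is_repD(1)[OF r(1) g] is_repD(1)[OF r(2) g] r by auto
    show "?S * \<rho> g = \<sigma> g * ?S"
    proof (rule eq_matI)
      fix i j assume "i < dim_row (\<sigma> g * ?S)" "j < dim_col (\<sigma> g * ?S)"
      hence ij: "i < n" "j < n" using c by auto
      have "i \<in> p ` {0..<n}" using p ij(1) by (auto simp: bij_betw_def)
      then obtain i' where i': "i = p i'" "i' < n" by auto
      have "(?S * \<rho> g) $$ (i, j) = (\<Sum>k = 0..<n. (if i = p k then 1 else 0) * \<rho> g $$ (k, j))"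
        using ij c by (simp add: scalar_prod_def)
      also have "\<dots> = (\<Sum>k = 0..<n. (if i' = k then \<rho> g $$ (k, j) else 0))"
        by (rule sum.cong) (use i' p_inj in auto)
      also have "\<dots> = \<sigma> g $$ (i, p j)" using i' ij e[OF g] by simp
      also have "\<dots> = (\<sigma> g * ?S) $$ (i, j)"
      proof -
        have "(\<sigma> g * ?S) $$ (i, j) = (\<Sum>k = 0..<n. \<sigma> g $$ (i, k) * (if k = p j then 1 else 0))"
          using ij c by (simp add: scalar_prod_def)
        also have "\<dots> = (\<Sum>k = 0..<n. if k = p j then \<sigma> g $$ (i, k) else 0)"
          by (rule sum.cong) auto
        finally show ?thesis using p_lt[OF ij(2)] by simp
      qed
      finally show "(?S * \<rho> g) $$ (i, j) = (\<sigma> g * ?S) $$ (i, j)" .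
    qed (use c in auto)
  qed (simp_all only: 1 2 mat_carrier)
qed

lemma rep_sum_app:
  assumes "is_rep K \<rho>" "is_rep K \<sigma>" "g \<in> carrier K"
  shows "rep_sum \<rho> \<sigma> g =
    four_block_mat (\<rho> g) (0\<^sub>m (rep_degree K \<rho>) (rep_degree K \<sigma>)) (0\<^sub>m (rep_degree K \<sigma>) (rep_degree K \<rho>)) (\<sigma> g)"
  using is_repD(1)[OF assms(1,3)] is_repD(1)[OF assms(2,3)] unfolding rep_sum_def by auto

lemma block_diag_mult:
  assumes "A \<in> carrier_mat n n" "B \<in> carrier_mat n n" "C \<in> carrier_mat m m" "D \<in> carrier_mat m m"
  shows "four_block_mat A (0\<^sub>m n m) (0\<^sub>m m n) C * four_block_mat B (0\<^sub>m n m) (0\<^sub>m m n) D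
       = four_block_mat (A * B) (0\<^sub>m n m) (0\<^sub>m m n) (C * D)"
  using assms by (subst mult_four_block_mat[of _ n n _ m _ m _ _ n _ m]) auto

lemma rep_iso_sum:
  assumes r: "is_rep K \<rho>" "is_rep K \<rho>'" "is_rep K \<sigma>" "is_rep K \<sigma>'"
    and iso: "rep_iso K \<rho> \<rho>'" "rep_iso K \<sigma> \<sigma>'"
  shows "rep_iso K (rep_sum \<rho> \<sigma>) (rep_sum \<rho>' \<sigma>')"
proof -
  obtain n S S' where S: "rep_degree K \<rho> = n" "rep_degree K \<rho>' = n"
    "S \<in> carrier_mat n n" "S' \<in> carrier_mat n n" "S * S' = 1\<^sub>m n" "S' * S = 1\<^sub>m n"
    "\<And>g. g \<in> carrier K \<Longrightarrow> S * \<rho> g = \<rho>' g * S" using rep_isoE[OF iso(1)] by metis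
  obtain m T T' where T: "rep_degree K \<sigma> = m" "rep_degree K \<sigma>' = m"
    "T \<in> carrier_mat m m" "T' \<in> carrier_mat m m" "T * T' = 1\<^sub>m m" "T' * T = 1\<^sub>m m"
    "\<And>g. g \<in> carrier K \<Longrightarrow> T * \<sigma> g = \<sigma>' g * T" using rep_isoE[OF iso(2)] by metis
  let ?B = "\<lambda>A C. four_block_mat A (0\<^sub>m n m) (0\<^sub>m m n) C"
  show ?thesis
  proof (rule rep_isoI[OF rep_sum(1)[OF r(1,3)] rep_sum(1)[OF r(2,4)], of "n + m" "?B S T" "?B S' T'"])
    show "rep_degree K (rep_sum \<rho> \<sigma>) = n + m" "rep_degree K (rep_sum \<rho>' \<sigma>') = n + m"
      by (simp_all only: rep_sum[OF r(1,3)] rep_sum[OF r(2,4)] S T)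
    show "?B S T \<in> carrier_mat (n + m) (n + m)" "?B S' T' \<in> carrier_mat (n + m) (n + m)"
      using S T by auto
    show "?B S T * ?B S' T' = 1\<^sub>m (n + m)"
      unfolding block_diag_mult[OF S(3,4) T(3,4)] S(5) T(5) by simp
    show "?B S' T' * ?B S T = 1\<^sub>m (n + m)"
      unfolding block_diag_mult[OF S(4,3) T(4,3)] S(6) T(6) by simp
    fix g assume g: "g \<in> carrier K"
    note c = is_repD(1)[OF r(1) g, unfolded S(1)] is_repD(1)[OF r(2) g, unfolded S(2)]
      is_repD(1)[OF r(3) g, unfolded T(1)] is_repD(1)[OF r(4) g, unfolded T(2)]
    show "?B S T * rep_sum \<rho> \<sigma> g = rep_sum \<rho>' \<sigma>' g * ?B S T"
      unfolding rep_sum_app[OF r(1,3) g] rep_sum_app[OF r(2,4) g] S(1,2) T(1,2)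
        block_diag_mult[OF S(3) c(1) T(3) c(3)] block_diag_mult[OF c(2) S(3) c(4) T(3)]
        S(7)[OF g] T(7)[OF g] ..
  qed
qed

lemma rep_iso_tensor:
  assumes r: "is_rep K \<rho>" "is_rep K \<rho>'" "is_rep K \<sigma>" "is_rep K \<sigma>'"
    and iso: "rep_iso K \<rho> \<rho>'" "rep_iso K \<sigma> \<sigma>'"
  shows "rep_iso K (rep_tensor \<rho> \<sigma>) (rep_tensor \<rho>' \<sigma>')"
proof -
  obtain n S S' where S: "rep_degree K \<rho> = n" "rep_degree K \<rho>' = n"
    "S \<in> carrier_mat n n" "S' \<in> carrier_mat n n" "S * S' = 1\<^sub>m n" "S' * S = 1\<^sub>m n"
    "\<And>g. g \<in> carrier K \<Longrightarrow> S * \<rho> g = \<rho>' g * S" using rep_isoE[OF iso(1)] by metis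
  obtain m T T' where T: "rep_degree K \<sigma> = m" "rep_degree K \<sigma>' = m"
    "T \<in> carrier_mat m m" "T' \<in> carrier_mat m m" "T * T' = 1\<^sub>m m" "T' * T = 1\<^sub>m m"
    "\<And>g. g \<in> carrier K \<Longrightarrow> T * \<sigma> g = \<sigma>' g * T" using rep_isoE[OF iso(2)] by metis
  show ?thesis
  proof (rule rep_isoI[OF rep_tensor(1)[OF r(1,3)] rep_tensor(1)[OF r(2,4)], of "n * m" "kronecker S T" "kronecker S' T'"])
    show "rep_degree K (rep_tensor \<rho> \<sigma>) = n * m" "rep_degree K (rep_tensor \<rho>' \<sigma>') = n * m"
      by (simp_all only: rep_tensor[OF r(1,3)] rep_tensor[OF r(2,4)] S T)
    show "kronecker S T \<in> carrier_mat (n * m) (n * m)" "kronecker S' T' \<in> carrier_mat (n * m) (n * m)"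
      by (rule kronecker_carrier[OF S(3) T(3)] kronecker_carrier[OF S(4) T(4)])+
    show "kronecker S T * kronecker S' T' = 1\<^sub>m (n * m)"
      unfolding kronecker_mult[OF S(3) T(3) S(4) T(4)] S(5) T(5) by (rule kronecker_one)
    show "kronecker S' T' * kronecker S T = 1\<^sub>m (n * m)"
      unfolding kronecker_mult[OF S(4) T(4) S(3) T(3)] S(6) T(6) by (rule kronecker_one)
    fix g assume g: "g \<in> carrier K"
    note c = is_repD(1)[OF r(1) g, unfolded S(1)] is_repD(1)[OF r(2) g, unfolded S(2)]
      is_repD(1)[OF r(3) g, unfolded T(1)] is_repD(1)[OF r(4) g, unfolded T(2)]
    show "kronecker S T * rep_tensor \<rho> \<sigma> g = rep_tensor \<rho>' \<sigma>' g * kronecker S T"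
      unfolding rep_tensor_def kronecker_mult[OF S(3) T(3) c(1) c(3)]
        kronecker_mult[OF c(2) c(4) S(3) T(3)] S(7)[OF g] T(7)[OF g] ..
  qed
qed

lemma four_block_diag_assoc:
  assumes "A \<in> carrier_mat a a" "B \<in> carrier_mat b b" "C \<in> carrier_mat c c"
  shows "four_block_mat (four_block_mat A (0\<^sub>m a b) (0\<^sub>m b a) B) (0\<^sub>m (a + b) c) (0\<^sub>m c (a + b)) C
       = four_block_mat A (0\<^sub>m a (b + c)) (0\<^sub>m (b + c) a) (four_block_mat B (0\<^sub>m b c) (0\<^sub>m c b) C)"
    (is "?L = ?R")
proof (rule eq_matI)
  have d: "dim_row A = a" "dim_col A = a" "dim_row B = b" "dim_col B = b" "dim_row C = c" "dim_col C = c"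
    using assms by auto
  show "dim_row ?L = dim_row ?R" "dim_col ?L = dim_col ?R" using d by auto
  fix i j assume "i < dim_row ?R" "j < dim_col ?R"
  hence ij: "i < a + b + c" "j < a + b + c" using d by auto
  have lt: "k - a < b \<longleftrightarrow> k < a + b" if "\<not> k < a" for k using that by linarith
  show "?L $$ (i, j) = ?R $$ (i, j)"
    by (cases "i < a"; cases "j < a"; cases "i < a + b"; cases "j < a + b")
      (use ij d in \<open>simp_all add: diff_diff_left lt\<close>)
qed

lemma rep_sum_assoc:
  assumes "is_rep K \<rho>" "is_rep K \<sigma>" "is_rep K \<tau>" "g \<in> carrier K"
  shows "rep_sum (rep_sum \<rho> \<sigma>) \<tau> g = rep_sum \<rho> (rep_sum \<sigma> \<tau>) g"
  using four_block_diag_assoc[OF is_repD(1)[OF assms(1,4)] is_repD(1)[OF assms(2,4)] is_repD(1)[OF assms(3,4)]]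
  by (simp add: rep_sum_app[of K] rep_sum assms)

lemma rep_sum_zero_left: "rep_sum rep_zero \<rho> g = \<rho> g"
  unfolding rep_sum_def rep_zero_def by (rule eq_matI) auto

lemma rep_iso_sum_commute:
  assumes r: "is_rep K \<rho>" "is_rep K \<sigma>"
  shows "rep_iso K (rep_sum \<rho> \<sigma>) (rep_sum \<sigma> \<rho>)"
proof -
  define n m where "n = rep_degree K \<rho>" and "m = rep_degree K \<sigma>"
  \<comment> \<open>The first block of \<open>n\<close> indices moves behind the second block of
    \<open>m\<close> indices.\<close>
  define p where "p i = (if i < n then i + m else i - n)" for i
  show ?thesis
  proof (rule rep_iso_permI[of K _ _ "n + m" p])
    show "bij_betw p {0..<n + m} {0..<n + m}"
      by (rule bij_betw_byWitness[where f' = "\<lambda>i. if i < m then i + n else i - m"]) (auto simp: p_def)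
    fix g i j assume g: "g \<in> carrier K" and ij: "i < n + m" "j < n + m"
    have c: "dim_row (\<rho> g) = n" "dim_col (\<rho> g) = n" "dim_row (\<sigma> g) = m" "dim_col (\<sigma> g) = m"
      using is_repD(1)[OF r(1) g] is_repD(1)[OF r(2) g] by (auto simp: n_def m_def)
    show "rep_sum \<rho> \<sigma> g $$ (i, j) = rep_sum \<sigma> \<rho> g $$ (p i, p j)"
      unfolding rep_sum_def p_def by (cases "i < n"; cases "j < n") (use ij c in \<open>auto simp: less_diff_conv2\<close>)
  qed (use rep_sum[OF r] rep_sum[OF r(2,1)] in \<open>auto simp: n_def m_def\<close>)
qed

lemma rep_iso_tensor_commute:
  assumes r: "is_rep K \<rho>" "is_rep K \<sigma>"
  shows "rep_iso K (rep_tensor \<rho> \<sigma>) (rep_tensor \<sigma> \<rho>)"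
proof -
  define n m where "n = rep_degree K \<rho>" and "m = rep_degree K \<sigma>"
  \<comment> \<open>The two digits of an index are exchanged: \<open>a * m + b\<close> goes to
    \<open>b * n + a\<close>. The sizes are parameters because the inverse is the same map with
    \<open>n\<close> and \<open>m\<close> exchanged.\<close>
  define p where "p n m i = (i mod m) * n + i div m" for n m i :: nat
  have p: "p n m i div n = i mod m" "p n m i mod n = i div m" "p n m i < n * m" "p m n (p n m i) = i"
    if "i < n * m" for n m i
  proof -
    have n: "n > 0" using that by (auto intro!: Nat.gr0I)
    note i = less_mult_div_mod[OF that]
    show d: "p n m i div n = i mod m" "p n m i mod n = i div m" using n i by (auto simp: p_def)
    have "p n m i < (i mod m + 1) * n" using i by (simp add: p_def)
    also have "\<dots> \<le> m * n" using i by (intro mult_right_mono) auto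
    finally show "p n m i < n * m" by (simp add: mult.commute)
    show "p m n (p n m i) = i" unfolding p_def[of m n] d by simp
  qed
  show ?thesis
  proof (rule rep_iso_permI[of K _ _ "n * m" "p n m"])
    show "bij_betw (p n m) {0..<n * m} {0..<n * m}"
      by (rule bij_betw_byWitness[where f' = "p m n"]) (use p p[of _ m n] in \<open>auto simp: mult.commute[of m n]\<close>)
    fix g i j assume g: "g \<in> carrier K" and ij: "i < n * m" "j < n * m"
    have c: "dim_row (\<rho> g) = n" "dim_col (\<rho> g) = n" "dim_row (\<sigma> g) = m" "dim_col (\<sigma> g) = m"
      using is_repD(1)[OF r(1) g] is_repD(1)[OF r(2) g] by (auto simp: n_def m_def)
    show "rep_tensor \<rho> \<sigma> g $$ (i, j) = rep_tensor \<sigma> \<rho> g $$ (p n m i, p n m j)"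
      unfolding rep_tensor_def kronecker_def c using ij p by (simp add: mult.commute[of m n])
  qed (use rep_tensor[OF r] rep_tensor[OF r(2,1)] in \<open>auto simp: n_def m_def\<close>)
qed

lemma rep_tensor_sum_left:
  assumes r: "is_rep K \<rho>" "is_rep K \<sigma>" "is_rep K \<tau>" and g: "g \<in> carrier K"
  shows "rep_tensor (rep_sum \<rho> \<sigma>) \<tau> g = rep_sum (rep_tensor \<rho> \<tau>) (rep_tensor \<sigma> \<tau>) g"
  using kronecker_block_diag[OF is_repD(1)[OF r(1) g] is_repD(1)[OF r(2) g] is_repD(1)[OF r(3) g]]
  unfolding rep_sum_app[OF rep_tensor(1)[OF r(1,3)] rep_tensor(1)[OF r(2,3)] g]
    rep_tensor(2)[OF r(1,3)] rep_tensor(2)[OF r(2,3)]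
  by (simp add: rep_tensor_def rep_sum_app[OF r(1,2) g])

lemma rep_tensor_one_left: "rep_tensor rep_one \<rho> g = \<rho> g"
  unfolding rep_tensor_def rep_one_def by (rule kronecker_one_left)

lemma rep_tensor_zero_left: "rep_tensor rep_zero \<rho> g = rep_zero g"
  unfolding rep_tensor_def rep_zero_def by (rule eq_matI) (auto simp: kronecker_def)

section \<open>The commutative semiring of isomorphism classes\<close>

definition iso_class :: "('g, 'b) monoid_scheme \<Rightarrow> 'g rep \<Rightarrow> 'g rep set" where
  "iso_class K \<rho> = {\<sigma>. is_rep K \<sigma> \<and> rep_iso K \<rho> \<sigma>}"

text \<open>R(K) is the ring completion of this semiring. The operations are unions over all
  representatives, the encoding that \<open>rep_ring\<close> also uses.\<close>

definition rep_semiring :: "('g, 'b) monoid_scheme \<Rightarrow> 'g rep set ring" where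
  "rep_semiring K =
     \<lparr>carrier = iso_class K ` {\<rho>. is_rep K \<rho>},
      mult = (\<lambda>a b. \<Union>\<rho>\<in>a. \<Union>\<sigma>\<in>b. iso_class K (rep_tensor \<rho> \<sigma>)),
      one = iso_class K rep_one,
      zero = iso_class K rep_zero,
      add = (\<lambda>a b. \<Union>\<rho>\<in>a. \<Union>\<sigma>\<in>b. iso_class K (rep_sum \<rho> \<sigma>))\<rparr>"

lemma iso_class_eq_iff:
  assumes "is_rep K \<rho>" "is_rep K \<sigma>"
  shows "iso_class K \<rho> = iso_class K \<sigma> \<longleftrightarrow> rep_iso K \<rho> \<sigma>"
  using assms rep_iso_refl rep_iso_sym rep_iso_trans unfolding iso_class_def by blast

lemma UN_const_eq: "A \<noteq> {} \<Longrightarrow> (\<And>x. x \<in> A \<Longrightarrow> f x = c) \<Longrightarrow> (\<Union>x\<in>A. f x) = c"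
  by auto

lemma iso_class_nonempty: "is_rep K \<rho> \<Longrightarrow> iso_class K \<rho> \<noteq> {}"
  using rep_iso_refl unfolding iso_class_def by blast

text \<open>Replacing representatives by isomorphic ones does not change the class of the result, so
  each union runs over copies of one set.\<close>

lemma rep_semiring_simps:
  assumes r: "is_rep K \<rho>" "is_rep K \<sigma>"
  shows "iso_class K \<rho> \<oplus>\<^bsub>rep_semiring K\<^esub> iso_class K \<sigma> = iso_class K (rep_sum \<rho> \<sigma>)"
    and "iso_class K \<rho> \<otimes>\<^bsub>rep_semiring K\<^esub> iso_class K \<sigma> = iso_class K (rep_tensor \<rho> \<sigma>)"
proof -
  have "iso_class K (rep_sum \<rho>' \<sigma>') = iso_class K (rep_sum \<rho> \<sigma>)"
      "iso_class K (rep_tensor \<rho>' \<sigma>') = iso_class K (rep_tensor \<rho> \<sigma>)"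
    if "\<rho>' \<in> iso_class K \<rho>" "\<sigma>' \<in> iso_class K \<sigma>" for \<rho>' \<sigma>'
  proof -
    have h: "is_rep K \<rho>'" "is_rep K \<sigma>'" "rep_iso K \<rho>' \<rho>" "rep_iso K \<sigma>' \<sigma>"
      using that rep_iso_sym r unfolding iso_class_def by auto
    show "iso_class K (rep_sum \<rho>' \<sigma>') = iso_class K (rep_sum \<rho> \<sigma>)"
      using h r rep_sum(1) rep_iso_sum by (subst iso_class_eq_iff) auto
    show "iso_class K (rep_tensor \<rho>' \<sigma>') = iso_class K (rep_tensor \<rho> \<sigma>)"
      using h r rep_tensor(1) rep_iso_tensor by (subst iso_class_eq_iff) auto
  qed
  thus "iso_class K \<rho> \<oplus>\<^bsub>rep_semiring K\<^esub> iso_class K \<sigma> = iso_class K (rep_sum \<rho> \<sigma>)"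
    "iso_class K \<rho> \<otimes>\<^bsub>rep_semiring K\<^esub> iso_class K \<sigma> = iso_class K (rep_tensor \<rho> \<sigma>)"
    unfolding rep_semiring_def by (simp_all add: UN_const_eq iso_class_nonempty r)
qed

lemma rep_semiring_carrier: "is_rep K \<rho> \<Longrightarrow> iso_class K \<rho> \<in> carrier (rep_semiring K)"
  unfolding rep_semiring_def by auto

lemma rep_semiring_carrierE:
  assumes "x \<in> carrier (rep_semiring K)"
  obtains \<rho> where "is_rep K \<rho>" "x = iso_class K \<rho>"
  using assms unfolding rep_semiring_def by auto

lemma rep_semiring_const:
  "\<zero>\<^bsub>rep_semiring K\<^esub> = iso_class K rep_zero" "\<one>\<^bsub>rep_semiring K\<^esub> = iso_class K rep_one"
  unfolding rep_semiring_def by auto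

context monoid
begin

lemma iso_class_cong:
  assumes "is_rep G \<rho>" "is_rep G \<sigma>" "\<And>g. g \<in> carrier G \<Longrightarrow> \<rho> g = \<sigma> g"
  shows "iso_class G \<rho> = iso_class G \<sigma>"
  using rep_iso_eqI[OF assms] assms by (subst iso_class_eq_iff) auto

text \<open>Associativity, the left units and distributivity in the left factor hold as equalities
  of matrices on the carrier. Commutativity needs a change of basis, and the laws on the other side
  are derived from it.\<close>

lemma semiring_rep_semiring: "semiring (rep_semiring G)"
  and comm_monoid_rep_semiring: "comm_monoid (rep_semiring G)"
proof -
  let ?M = "rep_semiring G"
  note simps = rep_semiring_simps rep_sum(1) rep_tensor(1) rep_zero(1) rep_one(1) rep_semiring_const
    rep_semiring_carrier
  have acomm: "x \<oplus>\<^bsub>?M\<^esub> y = y \<oplus>\<^bsub>?M\<^esub> x" if "x \<in> carrier ?M" "y \<in> carrier ?M" for x y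
    using that by (elim rep_semiring_carrierE)
      (simp add: simps iso_class_eq_iff rep_iso_sum_commute)
  have mcomm: "x \<otimes>\<^bsub>?M\<^esub> y = y \<otimes>\<^bsub>?M\<^esub> x" if "x \<in> carrier ?M" "y \<in> carrier ?M" for x y
    using that by (elim rep_semiring_carrierE)
      (simp add: simps iso_class_eq_iff rep_iso_tensor_commute)
  have mcl: "x \<otimes>\<^bsub>?M\<^esub> y \<in> carrier ?M" and acl: "x \<oplus>\<^bsub>?M\<^esub> y \<in> carrier ?M"
    if "x \<in> carrier ?M" "y \<in> carrier ?M" for x y
    using that by (elim rep_semiring_carrierE; simp add: simps)+
  have distr: "(x \<oplus>\<^bsub>?M\<^esub> y) \<otimes>\<^bsub>?M\<^esub> z = x \<otimes>\<^bsub>?M\<^esub> z \<oplus>\<^bsub>?M\<^esub> y \<otimes>\<^bsub>?M\<^esub> z"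
    if "x \<in> carrier ?M" "y \<in> carrier ?M" "z \<in> carrier ?M" for x y z
    using that by (elim rep_semiring_carrierE)
      (simp add: simps, rule iso_class_cong, auto simp: simps rep_tensor_sum_left)
  have null: "\<zero>\<^bsub>?M\<^esub> \<otimes>\<^bsub>?M\<^esub> x = \<zero>\<^bsub>?M\<^esub>" if "x \<in> carrier ?M" for x
    using that by (elim rep_semiring_carrierE)
      (simp add: simps, rule iso_class_cong, auto simp: simps rep_tensor_zero_left)
  have zero: "\<zero>\<^bsub>?M\<^esub> \<in> carrier ?M" and one: "\<one>\<^bsub>?M\<^esub> \<in> carrier ?M" by (auto simp: simps)
  show cm: "comm_monoid ?M"
  proof (rule comm_monoidI[OF mcl one])
    fix x y z assume "x \<in> carrier ?M" "y \<in> carrier ?M" "z \<in> carrier ?M"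
    thus "x \<otimes>\<^bsub>?M\<^esub> y \<otimes>\<^bsub>?M\<^esub> z = x \<otimes>\<^bsub>?M\<^esub> (y \<otimes>\<^bsub>?M\<^esub> z)"
      by (elim rep_semiring_carrierE)
        (simp add: simps, rule iso_class_cong, auto simp: simps, auto simp: rep_tensor_def kronecker_assoc)
    show "\<one>\<^bsub>?M\<^esub> \<otimes>\<^bsub>?M\<^esub> x = x" using \<open>x \<in> carrier ?M\<close>
      by (elim rep_semiring_carrierE)
        (simp add: simps, rule iso_class_cong, auto simp: simps rep_tensor_one_left)
  qed (use mcomm in auto)
  have am: "abelian_monoid ?M"
  proof (rule abelian_monoidI[OF acl zero])
    fix x y z assume "x \<in> carrier ?M" "y \<in> carrier ?M" "z \<in> carrier ?M"
    thus "x \<oplus>\<^bsub>?M\<^esub> y \<oplus>\<^bsub>?M\<^esub> z = x \<oplus>\<^bsub>?M\<^esub> (y \<oplus>\<^bsub>?M\<^esub> z)"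
      by (elim rep_semiring_carrierE)
        (simp add: simps, rule iso_class_cong, auto simp: simps rep_sum_assoc)
    show "\<zero>\<^bsub>?M\<^esub> \<oplus>\<^bsub>?M\<^esub> x = x" using \<open>x \<in> carrier ?M\<close>
      by (elim rep_semiring_carrierE)
        (simp add: simps, rule iso_class_cong, auto simp: simps rep_sum_zero_left)
  qed (use acomm in auto)
  show "semiring ?M"
  proof (intro semiring.intro am comm_monoid.axioms(1)[OF cm] semiring_axioms.intro)
    fix x y z assume c: "x \<in> carrier ?M" "y \<in> carrier ?M" "z \<in> carrier ?M"
    show "z \<otimes>\<^bsub>?M\<^esub> (x \<oplus>\<^bsub>?M\<^esub> y) = z \<otimes>\<^bsub>?M\<^esub> x \<oplus>\<^bsub>?M\<^esub> z \<otimes>\<^bsub>?M\<^esub> y"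
      unfolding mcomm[OF c(3) acl[OF c(1,2)]] distr[OF c] mcomm[OF c(1,3)] mcomm[OF c(2,3)] ..
  next
    fix x assume c: "x \<in> carrier ?M"
    show "x \<otimes>\<^bsub>?M\<^esub> \<zero>\<^bsub>?M\<^esub> = \<zero>\<^bsub>?M\<^esub>" unfolding mcomm[OF c zero] by (rule null[OF c])
  qed (use distr null in auto)
qed

end

section \<open>The representation ring\<close>

context monoid
begin

interpretation M: semiring "rep_semiring G" by (rule semiring_rep_semiring)
interpretation M: comm_monoid "rep_semiring G" by (rule comm_monoid_rep_semiring)

lemma iso_class_sum:
  "is_rep G \<rho> \<Longrightarrow> is_rep G \<sigma> \<Longrightarrow>
    iso_class G (rep_sum \<rho> \<sigma>) = iso_class G \<rho> \<oplus>\<^bsub>rep_semiring G\<^esub> iso_class G \<sigma>"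
  by (simp add: rep_semiring_simps)

lemma iso_class_tensor:
  "is_rep G \<rho> \<Longrightarrow> is_rep G \<sigma> \<Longrightarrow>
    iso_class G (rep_tensor \<rho> \<sigma>) = iso_class G \<rho> \<otimes>\<^bsub>rep_semiring G\<^esub> iso_class G \<sigma>"
  by (simp add: rep_semiring_simps)

lemmas iso_class_simps = iso_class_sum iso_class_tensor rep_sum(1) rep_tensor(1) rep_zero(1) rep_one(1)
  rep_semiring_carrier rep_semiring_const[symmetric]

text \<open>The relation a - b = c - d in the group completion. The extra summand \<open>t\<close>
  makes it transitive without cancellation among isomorphism classes.\<close>

definition stably_eq ::
    "'a rep set \<Rightarrow> 'a rep set \<Rightarrow> 'a rep set \<Rightarrow> 'a rep set \<Rightarrow> bool" where
  "stably_eq a b c d \<longleftrightarrow> (\<exists>t \<in> carrier (rep_semiring G).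
     a \<oplus>\<^bsub>rep_semiring G\<^esub> d \<oplus>\<^bsub>rep_semiring G\<^esub> t = c \<oplus>\<^bsub>rep_semiring G\<^esub> b \<oplus>\<^bsub>rep_semiring G\<^esub> t)"

lemma mem_virtual_class_iff:
  assumes "is_rep G \<rho>" "is_rep G \<sigma>" "is_rep G \<rho>'" "is_rep G \<sigma>'"
  shows "(\<rho>', \<sigma>') \<in> virtual_class G \<rho> \<sigma> \<longleftrightarrow>
    stably_eq (iso_class G \<rho>) (iso_class G \<sigma>) (iso_class G \<rho>') (iso_class G \<sigma>')"
proof -
  have "rep_iso G (rep_sum (rep_sum \<rho> \<sigma>') \<tau>) (rep_sum (rep_sum \<rho>' \<sigma>) \<tau>) \<longleftrightarrow>
     iso_class G \<rho> \<oplus>\<^bsub>rep_semiring G\<^esub> iso_class G \<sigma>' \<oplus>\<^bsub>rep_semiring G\<^esub> iso_class G \<tau>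
     = iso_class G \<rho>' \<oplus>\<^bsub>rep_semiring G\<^esub> iso_class G \<sigma> \<oplus>\<^bsub>rep_semiring G\<^esub> iso_class G \<tau>" if "is_rep G \<tau>" for \<tau>
    using that assms by (subst iso_class_eq_iff[symmetric]) (simp_all add: iso_class_simps)
  thus ?thesis using assms unfolding stably_eq_def virtual_class_def
    by (auto elim!: rep_semiring_carrierE intro: rep_semiring_carrier)
qed

lemma stably_eq_refl: "stably_eq a b a b"
  unfolding stably_eq_def using M.zero_closed by blast

lemma stably_eq_sym: "stably_eq a b c d \<Longrightarrow> stably_eq c d a b"
  unfolding stably_eq_def by metis

lemma stably_eq_trans:
  assumes c: "a \<in> carrier (rep_semiring G)" "b \<in> carrier (rep_semiring G)"
    "c \<in> carrier (rep_semiring G)" "d \<in> carrier (rep_semiring G)"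
    "e \<in> carrier (rep_semiring G)" "f \<in> carrier (rep_semiring G)"
    and 1: "stably_eq a b c d" and 2: "stably_eq c d e f"
  shows "stably_eq a b e f"
proof -
  let ?p = "add (rep_semiring G)"
  obtain t where t: "t \<in> carrier (rep_semiring G)" "?p (?p a d) t = ?p (?p c b) t"
    using 1 unfolding stably_eq_def by auto
  obtain u where u: "u \<in> carrier (rep_semiring G)" "?p (?p c f) u = ?p (?p e d) u"
    using 2 unfolding stably_eq_def by auto
  \<comment> \<open>The common summand is \<open>d + t + u\<close>: together with \<open>d\<close>
    and \<open>t\<close> the first equation applies to \<open>a\<close>, and together with
    \<open>u\<close> the second one then applies to \<open>c\<close> and \<open>f\<close>.\<close>
  have "?p (?p a f) (?p (?p d t) u) = ?p (?p (?p a d) t) (?p f u)"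
    using c t(1) u(1) by (simp add: M.a_ac)
  also have "\<dots> = ?p (?p (?p c f) u) (?p b t)"
    unfolding t(2) using c t(1) u(1) by (simp add: M.a_ac)
  also have "\<dots> = ?p (?p e b) (?p (?p d t) u)"
    unfolding u(2) using c t(1) u(1) by (simp add: M.a_ac)
  finally show ?thesis unfolding stably_eq_def using c t(1) u(1) by blast
qed

lemma virtual_class_eq_iff:
  assumes r: "is_rep G \<rho>" "is_rep G \<sigma>" "is_rep G \<rho>'" "is_rep G \<sigma>'"
  shows "virtual_class G \<rho> \<sigma> = virtual_class G \<rho>' \<sigma>' \<longleftrightarrow>
    stably_eq (iso_class G \<rho>) (iso_class G \<sigma>) (iso_class G \<rho>') (iso_class G \<sigma>')" (is "?L \<longleftrightarrow> ?R")
proof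
  assume ?L
  moreover have "(\<rho>', \<sigma>') \<in> virtual_class G \<rho>' \<sigma>'"
    using r mem_virtual_class_iff stably_eq_refl by blast
  ultimately show ?R using mem_virtual_class_iff[OF r] by simp
next
  assume R: ?R
  have "x \<in> virtual_class G \<rho> \<sigma> \<longleftrightarrow> x \<in> virtual_class G \<rho>' \<sigma>'" for x
  proof (cases "is_rep G (fst x) \<and> is_rep G (snd x)")
    case True
    then obtain \<rho>'' \<sigma>'' where x: "x = (\<rho>'', \<sigma>'')" "is_rep G \<rho>''" "is_rep G \<sigma>''" by (cases x) auto
    note c = r[THEN rep_semiring_carrier] x(2,3)[THEN rep_semiring_carrier]
    show ?thesis unfolding x(1) mem_virtual_class_iff[OF r(1,2) x(2,3)] mem_virtual_class_iff[OF r(3,4) x(2,3)]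
      using stably_eq_trans[OF c(1-6) R] stably_eq_trans[OF c(3,4,1,2,5,6) stably_eq_sym[OF R]] by blast
  qed (auto simp: virtual_class_def)
  thus ?L by auto
qed

text \<open>The case in which the common summand is zero. It suffices for the ring laws of R(K),
  which come from identities of the semiring.\<close>

lemma virtual_class_eqI:
  assumes r: "is_rep G \<rho>" "is_rep G \<sigma>" "is_rep G \<rho>'" "is_rep G \<sigma>'"
    and "iso_class G \<rho> \<oplus>\<^bsub>rep_semiring G\<^esub> iso_class G \<sigma>' = iso_class G \<rho>' \<oplus>\<^bsub>rep_semiring G\<^esub> iso_class G \<sigma>"
  shows "virtual_class G \<rho> \<sigma> = virtual_class G \<rho>' \<sigma>'"
  unfolding virtual_class_eq_iff[OF r] stably_eq_def using assms(5) M.zero_closed by auto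

lemma mem_virtual_classD:
  assumes "(\<rho>', \<sigma>') \<in> virtual_class G \<rho> \<sigma>" "is_rep G \<rho>" "is_rep G \<sigma>"
  shows "is_rep G \<rho>'" "is_rep G \<sigma>'"
    "stably_eq (iso_class G \<rho>) (iso_class G \<sigma>) (iso_class G \<rho>') (iso_class G \<sigma>')"
proof -
  show r: "is_rep G \<rho>'" "is_rep G \<sigma>'" using assms unfolding virtual_class_def by auto
  show "stably_eq (iso_class G \<rho>) (iso_class G \<sigma>) (iso_class G \<rho>') (iso_class G \<sigma>')"
    using mem_virtual_class_iff[OF assms(2,3) r] assms by simp
qed

lemma mem_virtual_class_self:
  "is_rep G \<rho> \<Longrightarrow> is_rep G \<sigma> \<Longrightarrow> (\<rho>, \<sigma>) \<in> virtual_class G \<rho> \<sigma>"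
  by (simp add: mem_virtual_class_iff stably_eq_refl)

lemma rep_ring_add:
  assumes r: "is_rep G \<rho>" "is_rep G \<sigma>" "is_rep G \<rho>'" "is_rep G \<sigma>'"
  shows "virtual_class G \<rho> \<sigma> \<oplus>\<^bsub>rep_ring G\<^esub> virtual_class G \<rho>' \<sigma>'
       = virtual_class G (rep_sum \<rho> \<rho>') (rep_sum \<sigma> \<sigma>')"
proof -
  let ?p = "add (rep_semiring G)" and ?c = "iso_class G"
  have "virtual_class G (rep_sum \<alpha> \<alpha>') (rep_sum \<beta> \<beta>') = virtual_class G (rep_sum \<rho> \<rho>') (rep_sum \<sigma> \<sigma>')"
    if "(\<alpha>, \<beta>) \<in> virtual_class G \<rho> \<sigma>" "(\<alpha>', \<beta>') \<in> virtual_class G \<rho>' \<sigma>'" for \<alpha> \<beta> \<alpha>' \<beta>'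
  proof -
    note 1 = mem_virtual_classD[OF that(1) r(1,2)] and 2 = mem_virtual_classD[OF that(2) r(3,4)]
    note [simp] = r 1(1,2) 2(1,2)
    obtain t where t: "t \<in> carrier (rep_semiring G)" "?p (?p (?c \<rho>) (?c \<beta>)) t = ?p (?p (?c \<alpha>) (?c \<sigma>)) t"
      using 1(3) unfolding stably_eq_def by auto
    obtain u where u: "u \<in> carrier (rep_semiring G)" "?p (?p (?c \<rho>') (?c \<beta>')) u = ?p (?p (?c \<alpha>') (?c \<sigma>')) u"
      using 2(3) unfolding stably_eq_def by auto
    have "?p (?p (?p (?c \<alpha>) (?c \<alpha>')) (?p (?c \<sigma>) (?c \<sigma>'))) (?p t u)
        = ?p (?p (?p (?c \<alpha>) (?c \<sigma>)) t) (?p (?p (?c \<alpha>') (?c \<sigma>')) u)"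
      using t(1) u(1) by (simp add: M.a_ac iso_class_simps)
    also have "\<dots> = ?p (?p (?p (?c \<rho>) (?c \<rho>')) (?p (?c \<beta>) (?c \<beta>'))) (?p t u)"
      unfolding t(2)[symmetric] u(2)[symmetric] using t(1) u(1) by (simp add: M.a_ac iso_class_simps)
    finally show ?thesis
      using t(1) u(1) M.a_closed[OF t(1) u(1)]
      by (subst virtual_class_eq_iff) (auto simp: iso_class_simps stably_eq_def)
  qed
  moreover have "virtual_class G \<rho> \<sigma> \<noteq> {}" "virtual_class G \<rho>' \<sigma>' \<noteq> {}"
    using r mem_virtual_class_self by blast+
  ultimately show ?thesis
    unfolding rep_ring_def by (auto intro!: UN_const_eq simp: split_beta simp del: UN_simps)
qed

text \<open>Independence of the representatives is shown for one factor at a time. The product of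
  formal differences is symmetric, so a change in the second factor reduces to a change in the
  first.\<close>

lemma rep_ring_mult:
  assumes r: "is_rep G \<rho>" "is_rep G \<sigma>" "is_rep G \<rho>'" "is_rep G \<sigma>'"
  shows "virtual_class G \<rho> \<sigma> \<otimes>\<^bsub>rep_ring G\<^esub> virtual_class G \<rho>' \<sigma>'
       = virtual_class G (rep_sum (rep_tensor \<rho> \<rho>') (rep_tensor \<sigma> \<sigma>'))
                         (rep_sum (rep_tensor \<rho> \<sigma>') (rep_tensor \<sigma> \<rho>'))"
proof -
  let ?p = "add (rep_semiring G)" and ?m = "mult (rep_semiring G)" and ?c = "iso_class G"
  let ?V = "\<lambda>\<rho> \<sigma> \<rho>' \<sigma>'. virtual_class G (rep_sum (rep_tensor \<rho> \<rho>') (rep_tensor \<sigma> \<sigma>'))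
                         (rep_sum (rep_tensor \<rho> \<sigma>') (rep_tensor \<sigma> \<rho>'))"
  have left: "?V \<alpha> \<beta> \<rho>' \<sigma>' = ?V \<rho> \<sigma> \<rho>' \<sigma>'"
    if r: "is_rep G \<rho>" "is_rep G \<sigma>" "is_rep G \<rho>'" "is_rep G \<sigma>'" "(\<alpha>, \<beta>) \<in> virtual_class G \<rho> \<sigma>"
    for \<alpha> \<beta> \<rho> \<sigma> \<rho>' \<sigma>'
  proof -
    note 1 = mem_virtual_classD[OF r(5,1,2)]
    note [simp] = r 1(1,2)
    obtain t where t: "t \<in> carrier (rep_semiring G)" "?p (?p (?c \<rho>) (?c \<beta>)) t = ?p (?p (?c \<alpha>) (?c \<sigma>)) t"
      using 1(3) unfolding stably_eq_def by auto
    let ?a = "?c \<alpha>" and ?b = "?c \<beta>" and ?r = "?c \<rho>" and ?s = "?c \<sigma>" and ?x = "?c \<rho>'" and ?y = "?c \<sigma>'"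
    \<comment> \<open>Expanding \<open>(a + s + t) x + (r + b + t) y\<close> gives one side of the
      required equation plus \<open>t x + t y\<close>. Exchanging the two equal brackets gives the
      other side plus the same term.\<close>
    let ?T = "?p (?m t ?x) (?m t ?y)"
    have c: "?a \<in> carrier (rep_semiring G)" "?b \<in> carrier (rep_semiring G)" "?r \<in> carrier (rep_semiring G)"
      "?s \<in> carrier (rep_semiring G)" "?x \<in> carrier (rep_semiring G)" "?y \<in> carrier (rep_semiring G)"
      by (simp_all add: rep_semiring_carrier)
    have "?p (?p (?p (?m ?a ?x) (?m ?b ?y)) (?p (?m ?r ?y) (?m ?s ?x))) ?T
        = ?p (?m (?p (?p ?a ?s) t) ?x) (?m (?p (?p ?r ?b) t) ?y)"
      using c t(1) by (simp add: M.a_ac M.l_distr)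
    also have "\<dots> = ?p (?m (?p (?p ?r ?b) t) ?x) (?m (?p (?p ?a ?s) t) ?y)"
      unfolding t(2) ..
    also have "\<dots> = ?p (?p (?p (?m ?r ?x) (?m ?s ?y)) (?p (?m ?a ?y) (?m ?b ?x))) ?T"
      using c t(1) by (simp add: M.a_ac M.l_distr)
    finally show ?thesis
      using t(1) c by (subst virtual_class_eq_iff) (auto simp: iso_class_simps stably_eq_def intro!: bexI[of _ ?T])
  qed
  have swap: "?V \<rho> \<sigma> \<rho>' \<sigma>' = ?V \<rho>' \<sigma>' \<rho> \<sigma>"
    if "is_rep G \<rho>" "is_rep G \<sigma>" "is_rep G \<rho>'" "is_rep G \<sigma>'" for \<rho> \<sigma> \<rho>' \<sigma>'
    by (rule virtual_class_eqI) (use that in \<open>simp_all add: iso_class_simps M.a_ac M.m_comm\<close>)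
  have "?V \<alpha> \<beta> \<alpha>' \<beta>' = ?V \<rho> \<sigma> \<rho>' \<sigma>'"
    if "(\<alpha>, \<beta>) \<in> virtual_class G \<rho> \<sigma>" "(\<alpha>', \<beta>') \<in> virtual_class G \<rho>' \<sigma>'" for \<alpha> \<beta> \<alpha>' \<beta>'
  proof -
    note 1 = mem_virtual_classD[OF that(1) r(1,2)] and 2 = mem_virtual_classD[OF that(2) r(3,4)]
    have "?V \<alpha> \<beta> \<alpha>' \<beta>' = ?V \<alpha>' \<beta>' \<rho> \<sigma>"
      using left[OF r(1,2) 2(1,2) that(1)] swap[OF r(1,2) 2(1,2)] by simp
    also have "\<dots> = ?V \<rho> \<sigma> \<rho>' \<sigma>'"
      using left[OF r(3,4) r(1,2) that(2)] swap[OF r(3,4) r(1,2)] by simp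
    finally show ?thesis .
  qed
  moreover have "virtual_class G \<rho> \<sigma> \<noteq> {}" "virtual_class G \<rho>' \<sigma>' \<noteq> {}"
    using r mem_virtual_class_self by blast+
  ultimately show ?thesis
    unfolding rep_ring_def by (auto intro!: UN_const_eq simp: split_beta simp del: UN_simps)
qed

lemma rep_ring_carrierE:
  assumes "x \<in> carrier (rep_ring G)"
  obtains \<rho> \<sigma> where "is_rep G \<rho>" "is_rep G \<sigma>" "x = virtual_class G \<rho> \<sigma>"
  using assms unfolding rep_ring_def by auto

lemma virtual_class_closed: "is_rep G \<rho> \<Longrightarrow> is_rep G \<sigma> \<Longrightarrow> virtual_class G \<rho> \<sigma> \<in> carrier (rep_ring G)"
  unfolding rep_ring_def by auto

lemma rep_ring_const:
  "\<zero>\<^bsub>rep_ring G\<^esub> = virtual_class G rep_zero rep_zero" "\<one>\<^bsub>rep_ring G\<^esub> = virtual_class G rep_one rep_zero"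
  unfolding rep_ring_def rep_class_def by auto

lemmas rep_ring_simps = rep_ring_add rep_ring_mult rep_ring_const virtual_class_closed rep_sum(1) rep_tensor(1)
  rep_zero(1) rep_one(1)

lemma cring_rep_ring: "cring (rep_ring G)"
proof (rule cringI)
  let ?R = "rep_ring G"
  note alg = iso_class_simps M.a_ac M.m_ac M.l_distr M.r_distr
  show "abelian_group ?R"
  proof (rule abelian_groupI)
    fix x y z assume "x \<in> carrier ?R" "y \<in> carrier ?R" "z \<in> carrier ?R"
    then obtain a b c d e f where [simp]: "is_rep G a" "is_rep G b" "is_rep G c" "is_rep G d" "is_rep G e" "is_rep G f"
      and xyz: "x = virtual_class G a b" "y = virtual_class G c d" "z = virtual_class G e f"
      by (metis rep_ring_carrierE)
    show "x \<oplus>\<^bsub>?R\<^esub> y \<oplus>\<^bsub>?R\<^esub> z = x \<oplus>\<^bsub>?R\<^esub> (y \<oplus>\<^bsub>?R\<^esub> z)"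
      unfolding xyz by (simp add: rep_ring_simps, rule virtual_class_eqI) (simp_all add: alg)
    show "x \<oplus>\<^bsub>?R\<^esub> y = y \<oplus>\<^bsub>?R\<^esub> x"
      unfolding xyz by (simp add: rep_ring_simps, rule virtual_class_eqI) (simp_all add: alg)
  next
    fix x y assume "x \<in> carrier ?R" "y \<in> carrier ?R"
    thus "x \<oplus>\<^bsub>?R\<^esub> y \<in> carrier ?R"
      by (elim rep_ring_carrierE) (simp add: rep_ring_simps)
  next
    fix x assume "x \<in> carrier ?R"
    then obtain a b where [simp]: "is_rep G a" "is_rep G b" and x: "x = virtual_class G a b"
      by (metis rep_ring_carrierE)
    show "\<zero>\<^bsub>?R\<^esub> \<oplus>\<^bsub>?R\<^esub> x = x"
      unfolding x by (simp add: rep_ring_simps, rule virtual_class_eqI) (simp_all add: alg)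
    have "virtual_class G b a \<oplus>\<^bsub>?R\<^esub> x = \<zero>\<^bsub>?R\<^esub>"
      unfolding x by (simp add: rep_ring_simps, rule virtual_class_eqI) (simp_all add: alg)
    thus "\<exists>y\<in>carrier ?R. y \<oplus>\<^bsub>?R\<^esub> x = \<zero>\<^bsub>?R\<^esub>" by (rule bexI) (simp add: rep_ring_simps)
  qed (simp add: rep_ring_simps)
  show "comm_monoid ?R"
  proof (rule comm_monoidI)
    fix x y z assume "x \<in> carrier ?R" "y \<in> carrier ?R" "z \<in> carrier ?R"
    then obtain a b c d e f where [simp]: "is_rep G a" "is_rep G b" "is_rep G c" "is_rep G d" "is_rep G e" "is_rep G f"
      and xyz: "x = virtual_class G a b" "y = virtual_class G c d" "z = virtual_class G e f"
      by (metis rep_ring_carrierE)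
    show "x \<otimes>\<^bsub>?R\<^esub> y \<otimes>\<^bsub>?R\<^esub> z = x \<otimes>\<^bsub>?R\<^esub> (y \<otimes>\<^bsub>?R\<^esub> z)"
      unfolding xyz by (simp add: rep_ring_simps, rule virtual_class_eqI) (simp_all add: alg)
    show "x \<otimes>\<^bsub>?R\<^esub> y = y \<otimes>\<^bsub>?R\<^esub> x"
      unfolding xyz by (simp add: rep_ring_simps, rule virtual_class_eqI) (simp_all add: alg)
  next
    fix x y assume "x \<in> carrier ?R" "y \<in> carrier ?R"
    thus "x \<otimes>\<^bsub>?R\<^esub> y \<in> carrier ?R"
      by (elim rep_ring_carrierE) (simp add: rep_ring_simps)
  next
    fix x assume "x \<in> carrier ?R"
    then obtain a b where [simp]: "is_rep G a" "is_rep G b" and x: "x = virtual_class G a b"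
      by (metis rep_ring_carrierE)
    show "\<one>\<^bsub>?R\<^esub> \<otimes>\<^bsub>?R\<^esub> x = x"
      unfolding x by (simp add: rep_ring_simps, rule virtual_class_eqI) (simp_all add: alg)
  qed (simp add: rep_ring_simps)
  fix x y z assume "x \<in> carrier ?R" "y \<in> carrier ?R" "z \<in> carrier ?R"
  then obtain a b c d e f where [simp]: "is_rep G a" "is_rep G b" "is_rep G c" "is_rep G d" "is_rep G e" "is_rep G f"
    and xyz: "x = virtual_class G a b" "y = virtual_class G c d" "z = virtual_class G e f"
    by (metis rep_ring_carrierE)
  show "(x \<oplus>\<^bsub>?R\<^esub> y) \<otimes>\<^bsub>?R\<^esub> z = x \<otimes>\<^bsub>?R\<^esub> z \<oplus>\<^bsub>?R\<^esub> y \<otimes>\<^bsub>?R\<^esub> z"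
    unfolding xyz by (simp add: rep_ring_simps, rule virtual_class_eqI) (simp_all add: alg)
qed

lemma rep_class_closed: "is_rep G \<rho> \<Longrightarrow> rep_class G \<rho> \<in> carrier (rep_ring G)"
  unfolding rep_class_def by (simp add: virtual_class_closed rep_zero)

lemma rep_class_cong: "is_rep G \<rho> \<Longrightarrow> is_rep G \<sigma> \<Longrightarrow> rep_iso G \<rho> \<sigma> \<Longrightarrow> rep_class G \<rho> = rep_class G \<sigma>"
  unfolding rep_class_def by (rule virtual_class_eqI) (auto simp: rep_zero iso_class_eq_iff[symmetric])

lemma rep_class_sum:
  assumes [simp]: "is_rep G \<rho>" "is_rep G \<sigma>"
  shows "rep_class G \<rho> \<oplus>\<^bsub>rep_ring G\<^esub> rep_class G \<sigma> = rep_class G (rep_sum \<rho> \<sigma>)"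
  unfolding rep_class_def
  by (simp add: rep_ring_simps, rule virtual_class_eqI) (simp_all add: iso_class_simps)

lemma rep_class_tensor:
  assumes [simp]: "is_rep G \<rho>" "is_rep G \<sigma>"
  shows "rep_class G \<rho> \<otimes>\<^bsub>rep_ring G\<^esub> rep_class G \<sigma> = rep_class G (rep_tensor \<rho> \<sigma>)"
  unfolding rep_class_def
  by (simp add: rep_ring_simps, rule virtual_class_eqI) (simp_all add: iso_class_simps)

end

section \<open>Restriction to a subgroup\<close>

lemma (in group) is_rep_subgroup:
  assumes "subgroup H G" "is_rep G \<rho>"
  shows "is_rep (G\<lparr>carrier := H\<rparr>) \<rho>"
  by (rule is_repI[where n = "rep_degree G \<rho>"])
    (use is_repD[OF assms(2)] subgroup.mem_carrier[OF assms(1)] in auto)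

lemma (in group) rep_iso_subgroup:
  "subgroup H G \<Longrightarrow> rep_iso G \<rho> \<sigma> \<Longrightarrow> rep_iso (G\<lparr>carrier := H\<rparr>) \<rho> \<sigma>"
  using subgroup.mem_carrier[of H G] unfolding rep_iso_def rep_degree_def by auto

text \<open>A stable isomorphism over the group is also one over the subgroup, so all
  representatives of a class restrict into a single class.\<close>

lemma (in group) restrict_virtual_class:
  assumes H: "subgroup H G" and r: "is_rep G \<rho>" "is_rep G \<sigma>"
  shows "restrict_virtual (G\<lparr>carrier := H\<rparr>) (virtual_class G \<rho> \<sigma>) = virtual_class (G\<lparr>carrier := H\<rparr>) \<rho> \<sigma>"
proof -
  let ?H = "G\<lparr>carrier := H\<rparr>"
  interpret H: group ?H using H by (rule subgroup.subgroup_is_group) (rule group_axioms)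
  have "virtual_class ?H \<rho>' \<sigma>' = virtual_class ?H \<rho> \<sigma>" if m: "(\<rho>', \<sigma>') \<in> virtual_class G \<rho> \<sigma>" for \<rho>' \<sigma>'
  proof -
    note r' = mem_virtual_classD(1,2)[OF m r]
    have "(\<rho>', \<sigma>') \<in> virtual_class ?H \<rho> \<sigma>"
      using m rep_iso_subgroup[OF H] is_rep_subgroup[OF H] unfolding virtual_class_def by blast
    thus ?thesis
      using H.virtual_class_eq_iff H.mem_virtual_class_iff H.stably_eq_sym is_rep_subgroup[OF H] r r' by metis
  qed
  moreover have "virtual_class G \<rho> \<sigma> \<noteq> {}" using mem_virtual_class_self[OF r] by blast
  ultimately show ?thesis unfolding restrict_virtual_def by (auto intro!: UN_const_eq)
qed

lemma (in group) restrict_rep_class: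
  "subgroup H G \<Longrightarrow> is_rep G \<rho> \<Longrightarrow>
    restrict_virtual (G\<lparr>carrier := H\<rparr>) (rep_class G \<rho>) = rep_class (G\<lparr>carrier := H\<rparr>) \<rho>"
  unfolding rep_class_def by (rule restrict_virtual_class) (auto simp: rep_zero)

text \<open>A ring homomorphism commutes with evaluation at -1, and this carries the result on
  Poincare polynomials over to Euler characteristics.\<close>

lemma (in group) restrict_virtual_ring_hom:
  assumes H: "subgroup H G"
  shows "ring_hom_cring (rep_ring G) (rep_ring (G\<lparr>carrier := H\<rparr>)) (restrict_virtual (G\<lparr>carrier := H\<rparr>))"
proof -
  let ?H = "G\<lparr>carrier := H\<rparr>"
  interpret H: group ?H using H by (rule subgroup.subgroup_is_group) (rule group_axioms)
  note s = restrict_virtual_class[OF H] is_rep_subgroup[OF H]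
  show ?thesis
  proof (intro ring_hom_cring.intro ring_hom_cring_axioms.intro cring_rep_ring H.cring_rep_ring ring_hom_memI)
    show "restrict_virtual ?H \<one>\<^bsub>rep_ring G\<^esub> = \<one>\<^bsub>rep_ring ?H\<^esub>"
      by (simp add: rep_ring_const H.rep_ring_const s rep_one rep_zero)
  next
    fix x assume "x \<in> carrier (rep_ring G)"
    thus "restrict_virtual ?H x \<in> carrier (rep_ring ?H)"
      by (elim rep_ring_carrierE) (simp add: s H.virtual_class_closed)
  next
    fix x y assume "x \<in> carrier (rep_ring G)" "y \<in> carrier (rep_ring G)"
    then obtain a b c d where [simp]: "is_rep G a" "is_rep G b" "is_rep G c" "is_rep G d"
      and xy: "x = virtual_class G a b" "y = virtual_class G c d" by (metis rep_ring_carrierE)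
    show "restrict_virtual ?H (x \<oplus>\<^bsub>rep_ring G\<^esub> y)
        = restrict_virtual ?H x \<oplus>\<^bsub>rep_ring ?H\<^esub> restrict_virtual ?H y"
      "restrict_virtual ?H (x \<otimes>\<^bsub>rep_ring G\<^esub> y)
        = restrict_virtual ?H x \<otimes>\<^bsub>rep_ring ?H\<^esub> restrict_virtual ?H y"
      unfolding xy by (simp_all add: rep_ring_simps H.rep_ring_simps s)
  qed
qed

section \<open>Square roots of matrices of finite order\<close>

text \<open>Horner evaluation of \<open>p\<close> at \<open>Z\<close>. The size \<open>n\<close> is
  a parameter because it determines the zero matrix with which the scheme starts.\<close>

definition mat_poly :: "nat \<Rightarrow> 'a::comm_ring_1 Matrix.mat \<Rightarrow> 'a poly \<Rightarrow> 'a Matrix.mat" where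
  "mat_poly n Z p = fold_coeffs (\<lambda>a M. a \<cdot>\<^sub>m 1\<^sub>m n + Z * M) p (0\<^sub>m n n)"

context
  fixes n :: nat and Z :: "'a::comm_ring_1 Matrix.mat"
  assumes Z: "Z \<in> carrier_mat n n"
begin

lemma mat_poly_0: "mat_poly n Z 0 = 0\<^sub>m n n"
  unfolding mat_poly_def by simp

lemma mat_poly_pCons: "mat_poly n Z (pCons a p) = a \<cdot>\<^sub>m 1\<^sub>m n + Z * mat_poly n Z p"
\<comment> \<open>\<open>pCons 0 0\<close> is the zero polynomial, on which the fold makes no step.
  The Horner formula has the same value there.\<close>
proof (cases "a = 0 \<and> p = 0")
  case True
  thus ?thesis using Z by (auto simp: mat_poly_0 intro!: eq_matI)
next
  case False
  thus ?thesis unfolding mat_poly_def by auto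
qed

lemma mat_poly_closed: "mat_poly n Z p \<in> carrier_mat n n"
  by (induction p) (use Z in \<open>auto simp: mat_poly_0 mat_poly_pCons\<close>)

text \<open>This is the reason to look for the square root among the polynomials in
  \<open>Z\<close>: whatever commutes with \<open>Z\<close> commutes with the root.\<close>

lemma mat_poly_commute:
  assumes A: "A \<in> carrier_mat n n" and c: "A * Z = Z * A"
  shows "A * mat_poly n Z p = mat_poly n Z p * A"
proof (induction p)
  case 0
  thus ?case using A by (simp add: mat_poly_0)
next
  case (pCons a p)
  let ?P = "mat_poly n Z p"
  note P = mat_poly_closed[of p]
  have "A * (a \<cdot>\<^sub>m 1\<^sub>m n + Z * ?P) = A * (a \<cdot>\<^sub>m 1\<^sub>m n) + A * (Z * ?P)"
    using A Z P by (intro mult_add_distrib_mat[of _ n n _ n]) auto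
  also have "A * (a \<cdot>\<^sub>m 1\<^sub>m n) = a \<cdot>\<^sub>m A"
    using mult_smult_distrib[of A n n "1\<^sub>m n" n a] A by simp
  also have "A * (Z * ?P) = (Z * A) * ?P" using assoc_mult_mat[OF A Z P] c by simp
  also have "\<dots> = Z * ?P * A" using assoc_mult_mat[OF Z A P] assoc_mult_mat[OF Z P A] pCons by simp
  also have "a \<cdot>\<^sub>m A + Z * ?P * A = (a \<cdot>\<^sub>m 1\<^sub>m n + Z * ?P) * A"
  proof -
    have "(a \<cdot>\<^sub>m 1\<^sub>m n + Z * ?P) * A = a \<cdot>\<^sub>m 1\<^sub>m n * A + Z * ?P * A"
      using A Z P by (intro add_mult_distrib_mat[of _ n n]) auto
    also have "a \<cdot>\<^sub>m 1\<^sub>m n * A = a \<cdot>\<^sub>m A"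
      using mult_smult_assoc_mat[of "1\<^sub>m n" n n A n a] A by simp
    finally show ?thesis by simp
  qed
  finally show ?case by (simp add: mat_poly_pCons)
qed

lemma mat_poly_add: "mat_poly n Z (p + q) = mat_poly n Z p + mat_poly n Z q"
proof (induction p q rule: poly_induct2)
  case 0
  show ?case by (simp add: mat_poly_0)
next
  case (pCons a p b q)
  let ?P = "mat_poly n Z p" and ?Q = "mat_poly n Z q"
  note P = mat_poly_closed[of p] and Q = mat_poly_closed[of q]
  have "Z * (?P + ?Q) = Z * ?P + Z * ?Q" by (rule mult_add_distrib_mat[OF Z P Q])
  thus ?case unfolding add_pCons mat_poly_pCons pCons using Z P Q
    by (intro eq_matI) (auto simp: algebra_simps)
qed

lemma mat_poly_smult: "mat_poly n Z (Polynomial.smult c p) = c \<cdot>\<^sub>m mat_poly n Z p"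
proof (induction p)
  case (pCons a p)
  note P = mat_poly_closed[of p]
  have "Z * (c \<cdot>\<^sub>m mat_poly n Z p) = c \<cdot>\<^sub>m (Z * mat_poly n Z p)"
    by (rule mult_smult_distrib[OF Z P])
  thus ?case unfolding smult_pCons mat_poly_pCons pCons using Z P
    by (intro eq_matI) (auto simp: algebra_simps)
qed (auto simp: mat_poly_0)

lemma mat_poly_mult: "mat_poly n Z (p * q) = mat_poly n Z p * mat_poly n Z q"
proof (induction p)
  case 0
  show ?case using mat_poly_closed[of q] by (simp add: mat_poly_0)
next
  case (pCons a p)
  let ?P = "mat_poly n Z p" and ?Q = "mat_poly n Z q"
  note P = mat_poly_closed[of p] and Q = mat_poly_closed[of q]
  have "(a \<cdot>\<^sub>m 1\<^sub>m n + Z * ?P) * ?Q = a \<cdot>\<^sub>m 1\<^sub>m n * ?Q + Z * ?P * ?Q"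
    using Z P Q by (intro add_mult_distrib_mat[of _ n n]) auto
  also have "a \<cdot>\<^sub>m 1\<^sub>m n * ?Q = a \<cdot>\<^sub>m ?Q"
    using mult_smult_assoc_mat[of "1\<^sub>m n" n n ?Q n a] Q by simp
  also have "Z * ?P * ?Q = Z * (?P * ?Q)" by (rule assoc_mult_mat[OF Z P Q])
  also have "a \<cdot>\<^sub>m ?Q + Z * (?P * ?Q) = a \<cdot>\<^sub>m ?Q + (0 \<cdot>\<^sub>m 1\<^sub>m n + Z * (?P * ?Q))"
    using Z P Q by (intro eq_matI) auto
  finally show ?case
    by (simp add: mult_pCons_left mat_poly_add mat_poly_smult mat_poly_pCons pCons)
qed

lemma mat_poly_X: "mat_poly n Z [:0, 1:] = Z"
proof -
  have "1 \<cdot>\<^sub>m 1\<^sub>m n + Z * 0\<^sub>m n n = 1\<^sub>m n" using Z by (intro eq_matI) auto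
  thus ?thesis using Z by (auto simp: mat_poly_pCons mat_poly_0 intro!: eq_matI)
qed

lemma mat_poly_const: "mat_poly n Z [:c:] = c \<cdot>\<^sub>m 1\<^sub>m n"
  using Z by (auto simp: mat_poly_pCons mat_poly_0 intro!: eq_matI)

lemma mat_poly_monom: "mat_poly n Z (Polynomial.monom 1 N) = Z ^\<^sub>m N"
proof (induction N)
  case 0
  show ?case using Z mat_poly_const[of 1] by (auto simp: monom_0 intro!: eq_matI)
next
  case (Suc N)
  have "mat_poly n Z (Polynomial.monom 1 N * [:0, 1:]) = Z ^\<^sub>m N * Z"
    by (simp only: mat_poly_mult mat_poly_X Suc)
  moreover have "Polynomial.monom 1 N * [:0, 1:] = (Polynomial.monom 1 (Suc N) :: 'a poly)"
    by (simp add: monom_Suc)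
  ultimately show ?case by simp
qed

end

text \<open>After the factors for \<open>A\<close> have been split off, the cofactor must still
  vanish at a new root \<open>a\<close>, because the product over \<open>A\<close> does not.\<close>

lemma linear_factors_dvd:
  fixes p :: "'a::field poly"
  assumes "finite A" "\<And>a. a \<in> A \<Longrightarrow> poly p a = 0"
  shows "(\<Prod>a\<in>A. [:-a, 1:]) dvd p"
  using assms
proof (induction A)
  case (insert a A)
  then obtain r where r: "p = (\<Prod>a\<in>A. [:-a, 1:]) * r" by (auto simp: dvd_def)
  have "poly (\<Prod>a\<in>A. [:-a, 1:]) a \<noteq> 0" using insert(1,2) by (simp add: poly_prod)
  hence "poly r a = 0" using insert.prems[of a] by (simp add: r)
  hence "[:-a, 1:] dvd r" by (simp add: poly_eq_0_iff_dvd)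
  hence "[:-a, 1:] * (\<Prod>a\<in>A. [:-a, 1:]) dvd r * (\<Prod>a\<in>A. [:-a, 1:])"
    by (rule mult_dvd_mono) simp
  thus ?case unfolding prod.insert[OF insert(1,2)] r mult.commute[of _ r] .
qed simp

text \<open>Newton interpolation: a value at a new node is corrected by a multiple of a polynomial
  that vanishes at all earlier nodes.\<close>

lemma poly_interpolation:
  fixes f :: "'a::field \<Rightarrow> 'a"
  assumes "finite A" shows "\<exists>q. \<forall>a\<in>A. poly q a = f a"
  using assms
proof (induction A)
  case (insert a A)
  then obtain q where q: "\<forall>a\<in>A. poly q a = f a" by auto
  define D where "D = (\<Prod>b\<in>A. [:-b, 1:])"
  have D: "poly D a \<noteq> 0" "\<And>b. b \<in> A \<Longrightarrow> poly D b = 0" using insert(1,2) by (auto simp: D_def poly_prod)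
  define c where "c = (f a - poly q a) / poly D a"
  have "\<forall>b\<in>insert a A. poly (q + Polynomial.smult c D) b = f b" using q D by (auto simp: c_def)
  thus ?case by blast
qed simp

text \<open>
  Since \<open>X ^ N - 1\<close> is separable, a polynomial that interpolates a square root on its roots
  squares to \<open>X\<close> modulo \<open>X ^ N - 1\<close>.
\<close>

lemma poly_sqrt_mod:
  assumes N: "N > 0"
  shows "\<exists>q r. q * q = [:0, 1:] + (Polynomial.monom 1 N + [:-1:]) * (r :: complex poly)"
proof -
  let ?p = "Polynomial.monom 1 N + [:-1:] :: complex poly"
  have ev: "poly ?p a = a ^ N - 1" for a by (simp add: poly_monom)
  have "rsquarefree ?p" unfolding rsquarefree_roots
  proof (intro allI notI, elim conjE)
    fix a assume a: "poly ?p a = 0" and "poly (pderiv ?p) a = 0"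
    hence "of_nat N * a ^ (N - 1) = 0" by (simp add: pderiv_add pderiv_monom poly_monom pderiv_pCons)
    hence "a = 0" using N by auto
    thus False using a N by (simp only: ev) (simp add: power_0_left)
  qed
  hence dec: "Polynomial.smult (Polynomial.lead_coeff ?p) (\<Prod>z | poly ?p z = 0. [:-z, 1:]) = ?p"
    by (rule complex_poly_decompose_rsquarefree)
  have p0: "?p \<noteq> 0"
  proof
    assume "?p = 0" hence "poly ?p 0 = 0" by simp
    thus False using N by (simp only: ev) (simp add: power_0_left)
  qed
  have fin: "finite {z. poly ?p z = 0}" by (rule poly_roots_finite[OF p0])
  \<comment> \<open>Any choice of a square root at each root of unity would serve; all that is used
    is that its square is \<open>a\<close>.\<close>
  obtain q where q: "\<forall>a\<in>{z. poly ?p z = 0}. poly q a = csqrt a" using poly_interpolation[OF fin] by blast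
  have "(\<Prod>z | poly ?p z = 0. [:-z, 1:]) dvd q * q - [:0, 1:]"
  proof (rule linear_factors_dvd[OF fin])
    fix a assume "a \<in> {z. poly ?p z = 0}"
    hence "poly q a = csqrt a" using q by blast
    thus "poly (q * q - [:0, 1:]) a = 0" using power2_csqrt[of a] by (simp add: power2_eq_square)
  qed
  hence "Polynomial.smult (Polynomial.lead_coeff ?p) (\<Prod>z | poly ?p z = 0. [:-z, 1:]) dvd q * q - [:0, 1:]"
    by (rule Polynomial.smult_dvd) (rule leading_coeff_neq_0[OF p0])
  hence "?p dvd q * q - [:0, 1:]" unfolding dec .
  then obtain r where "q * q - [:0, 1:] = ?p * r" by (auto simp: dvd_def)
  thus ?thesis by (intro exI[of _ q] exI[of _ r]) (simp add: algebra_simps)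
qed

text \<open>Evaluate the congruence for \<open>q * q\<close> modulo \<open>X ^ N - 1\<close> at
  \<open>Z\<close>. The modulus becomes zero, which leaves \<open>q(Z) * q(Z) = Z\<close>, and no
  diagonalisation of \<open>Z\<close> is involved.\<close>

lemma mat_sqrt_exists:
  fixes Z :: "complex Matrix.mat"
  assumes Z: "Z \<in> carrier_mat n n" and N: "N > 0" "Z ^\<^sub>m N = 1\<^sub>m n"
  obtains S where "S \<in> carrier_mat n n" "S * S = Z"
    "\<And>A. A \<in> carrier_mat n n \<Longrightarrow> A * Z = Z * A \<Longrightarrow> A * S = S * A"
proof -
  obtain q r where q: "q * q = [:0, 1:] + (Polynomial.monom 1 N + [:-1:]) * (r :: complex poly)"
    using poly_sqrt_mod[OF N(1)] by blast
  note c = mat_poly_closed[OF Z]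
  have "mat_poly n Z (Polynomial.monom 1 N + [:-1:]) = 1\<^sub>m n + (-1) \<cdot>\<^sub>m 1\<^sub>m n"
    by (simp only: mat_poly_add[OF Z] mat_poly_monom[OF Z] mat_poly_const[OF Z] N)
  also have "\<dots> = 0\<^sub>m n n" by (intro eq_matI) auto
  finally have "mat_poly n Z (q * q) = Z + 0\<^sub>m n n * mat_poly n Z r"
    by (simp only: q mat_poly_add[OF Z, of "[:0, 1:]"] mat_poly_X[OF Z] mat_poly_mult[OF Z])
  hence "mat_poly n Z q * mat_poly n Z q = Z"
    using Z c[of r] by (simp add: mat_poly_mult[OF Z])
  thus thesis using that c mat_poly_commute[OF Z] by blast
qed

section \<open>Matrix forms of representations on vector spaces\<close>

abbreviation cvec :: "nat \<Rightarrow> (complex, complex Matrix.vec) module" where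
  "cvec n \<equiv> module_vec TYPE(complex) n"

lemma linear_mapI:
  assumes "vectorspace class_ring V" "vectorspace class_ring W"
    and "\<And>v. v \<in> carrier V \<Longrightarrow> f v \<in> carrier W"
    and "\<And>v w. v \<in> carrier V \<Longrightarrow> w \<in> carrier V \<Longrightarrow> f (v \<oplus>\<^bsub>V\<^esub> w) = f v \<oplus>\<^bsub>W\<^esub> f w"
    and "\<And>c v. v \<in> carrier V \<Longrightarrow> f (c \<odot>\<^bsub>V\<^esub> v) = c \<odot>\<^bsub>W\<^esub> f v"
  shows "linear_map (class_ring :: complex ring) V W f"
proof -
  have "f \<in> module_hom class_ring V W"
    using assms(3-5) by (auto simp: module_hom_def)
  thus ?thesis using assms(1,2)
    by (simp add: linear_map_def mod_hom_def mod_hom_axioms_def vectorspace_def)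
qed

lemma linear_mapD:
  assumes "linear_map (class_ring :: complex ring) V W f"
  shows "vectorspace class_ring V" "vectorspace class_ring W"
    and "\<And>v. v \<in> carrier V \<Longrightarrow> f v \<in> carrier W"
    and "\<And>v w. v \<in> carrier V \<Longrightarrow> w \<in> carrier V \<Longrightarrow> f (v \<oplus>\<^bsub>V\<^esub> w) = f v \<oplus>\<^bsub>W\<^esub> f w"
    and "\<And>c v. v \<in> carrier V \<Longrightarrow> f (c \<odot>\<^bsub>V\<^esub> v) = c \<odot>\<^bsub>W\<^esub> f v"
proof -
  interpret linear_map class_ring V W f by fact
  show "vectorspace class_ring V" "vectorspace class_ring W" by unfold_locales
  show "\<And>v. v \<in> carrier V \<Longrightarrow> f v \<in> carrier W" by simp
  show "\<And>v w. v \<in> carrier V \<Longrightarrow> w \<in> carrier V \<Longrightarrow> f (v \<oplus>\<^bsub>V\<^esub> w) = f v \<oplus>\<^bsub>W\<^esub> f w" by simp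
  show "\<And>c v. v \<in> carrier V \<Longrightarrow> f (c \<odot>\<^bsub>V\<^esub> v) = c \<odot>\<^bsub>W\<^esub> f v" by (simp add: class_ring_simps)
qed

lemma vectorspace_closed:
  assumes "vectorspace (class_ring :: complex ring) V"
  shows "v \<in> carrier V \<Longrightarrow> w \<in> carrier V \<Longrightarrow> v \<oplus>\<^bsub>V\<^esub> w \<in> carrier V"
    and "v \<in> carrier V \<Longrightarrow> c \<odot>\<^bsub>V\<^esub> v \<in> carrier V"
proof -
  interpret vectorspace class_ring V by fact
  show "v \<in> carrier V \<Longrightarrow> w \<in> carrier V \<Longrightarrow> v \<oplus>\<^bsub>V\<^esub> w \<in> carrier V" by simp
  show "v \<in> carrier V \<Longrightarrow> c \<odot>\<^bsub>V\<^esub> v \<in> carrier V" by (simp add: class_ring_simps)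
qed

lemma linear_map_compose:
  assumes f: "linear_map (class_ring :: complex ring) U V f" and g: "linear_map class_ring V W g"
  shows "linear_map class_ring U W (\<lambda>v. g (f v))"
  by (rule linear_mapI[OF linear_mapD(1)[OF f] linear_mapD(2)[OF g]])
    (simp_all add: linear_mapD[OF f] linear_mapD[OF g])

lemma linear_map_inv_into:
  assumes f: "linear_map (class_ring :: complex ring) V W f" and b: "bij_betw f (carrier V) (carrier W)"
  shows "linear_map class_ring W V (inv_into (carrier V) f)"
proof -
  let ?g = "inv_into (carrier V) f"
  note D = linear_mapD[OF f]
  have g: "?g w \<in> carrier V" "f (?g w) = w" if "w \<in> carrier W" for w
    using b that by (auto simp: bij_betw_def f_inv_into_f intro: inv_into_into)
  have inj: "?g (f v) = v" if "v \<in> carrier V" for v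
    using b that by (simp add: bij_betw_def)
  show ?thesis
  proof (rule linear_mapI[OF D(2,1)])
    fix v w assume "v \<in> carrier W" "w \<in> carrier W"
    thus "?g (v \<oplus>\<^bsub>W\<^esub> w) = ?g v \<oplus>\<^bsub>V\<^esub> ?g w"
      using inj[of "?g v \<oplus>\<^bsub>V\<^esub> ?g w"] g D(4) vectorspace_closed[OF D(1)] by simp
  next
    fix c v assume "v \<in> carrier W"
    thus "?g (c \<odot>\<^bsub>W\<^esub> v) = c \<odot>\<^bsub>V\<^esub> ?g v"
      using inj[of "c \<odot>\<^bsub>V\<^esub> ?g v"] g D(5) vectorspace_closed[OF D(1)] by simp
  qed (use g in auto)
qed

lemma fin_dim_surj:
  assumes "linear_map (class_ring :: complex ring) V W f" "f ` carrier V = carrier W"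
    "vectorspace.fin_dim class_ring V"
  shows "vectorspace.fin_dim class_ring W"
proof -
  interpret linear_map class_ring V W f by fact
  show ?thesis using surj_fin_dim assms by simp
qed

lemma vec_fin_dim: "vectorspace.fin_dim class_ring (cvec n)"
proof -
  interpret vec_space "TYPE(complex)" n .
  show ?thesis by (rule fin_dim)
qed

lemma fin_dim_of_bij:
  assumes f: "linear_map (class_ring :: complex ring) V (cvec n) f"
    and b: "bij_betw f (carrier V) (carrier_vec n)"
  shows "vectorspace.fin_dim class_ring V"
proof -
  have b': "bij_betw f (carrier V) (carrier (cvec n))"
    using b by (simp add: module_vec_simps)
  have "inv_into (carrier V) f ` carrier (cvec n) = carrier V"
    using bij_betw_inv_into[OF b'] by (simp add: bij_betw_def)
  thus ?thesis using fin_dim_surj[OF linear_map_inv_into[OF f b'] _ vec_fin_dim] by simp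
qed

lemma linear_bij_vec_dim:
  assumes f: "linear_map class_ring (cvec n) (cvec m) f"
    and b: "bij_betw f (carrier_vec n) (carrier_vec m)"
  shows "n = m"
proof -
  interpret linear_map class_ring "cvec n" "cvec m" f by fact
  have "vectorspace.dim class_ring (cvec n) = vectorspace.dim class_ring (cvec m)"
    using dim_eq[OF vec_fin_dim] b by (simp add: module_vec_simps bij_betw_def)
  thus ?thesis by (simp add: vec_space.dim_is_n)
qed

text \<open>The map \<open>h\<close> from coordinate vectors to linear combinations of a basis is a
  linear bijection; coordinates are its inverse.\<close>

lemma coordinates_exist:
  assumes V: "vectorspace (class_ring :: complex ring) V" and fd: "vectorspace.fin_dim class_ring V"
  obtains n f where "linear_map class_ring V (cvec n) f"
    "bij_betw f (carrier V) (carrier_vec n)"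
proof -
  interpret vectorspace "class_ring :: complex ring" V by fact
  obtain B where B: "finite B" "basis B" using finite_basis_exists fd by blast
  hence BV: "B \<subseteq> carrier V" by (simp add: basis_def)
  have ex1: "\<exists>!a. a \<in> B \<rightarrow>\<^sub>E UNIV \<and> lincomb a B = v" if "v \<in> carrier V" for v
    using basis_criterion[OF B(1) BV] B(2) that by (simp add: class_ring_simps)
  obtain i where i: "bij_betw i B {0..<card B}" using ex_bij_betw_finite_nat[OF B(1)] by blast
  define n where "n = card B"
  have i_lt: "i b < n" if "b \<in> B" for b using i that by (auto simp: bij_betw_def n_def)
  define h where "h x = lincomb (\<lambda>b. x $ i b) B" for x
  have h_closed: "h x \<in> carrier V" for x
    unfolding h_def by (rule lincomb_closed[OF BV]) (simp add: class_ring_simps)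
  \<comment> \<open>Coefficients are unique only among functions that are undefined off
    \<open>B\<close>, so \<open>h\<close> is rewritten with restricted coefficients.\<close>
  have h_restrict: "h x = lincomb (\<lambda>b\<in>B. x $ i b) B" for x
    unfolding h_def by (rule lincomb_cong[OF refl BV]) (auto simp: class_ring_simps)
  have lin: "linear_map class_ring (cvec n) V h"
  proof (rule linear_mapI[OF vec_vs V h_closed])
    fix v w :: "complex Matrix.vec"
    assume "v \<in> carrier (cvec n)" "w \<in> carrier (cvec n)"
    hence vw: "v \<in> carrier_vec n" "w \<in> carrier_vec n" by (auto simp: module_vec_simps)
    have "h (v + w) = lincomb (\<lambda>b. v $ i b \<oplus>\<^bsub>class_ring\<^esub> w $ i b) B"
      unfolding h_def by (rule lincomb_cong[OF refl BV]) (use vw i_lt in \<open>auto simp: class_ring_simps\<close>)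
    also have "\<dots> = h v \<oplus>\<^bsub>V\<^esub> h w"
      unfolding h_def by (rule lincomb_sum[OF B(1) BV]) (auto simp: class_ring_simps)
    finally show "h (v \<oplus>\<^bsub>cvec n\<^esub> w) = h v \<oplus>\<^bsub>V\<^esub> h w" by (simp add: module_vec_simps)
  next
    fix c and v :: "complex Matrix.vec"
    assume "v \<in> carrier (cvec n)"
    hence v: "v \<in> carrier_vec n" by (auto simp: module_vec_simps)
    have "h (c \<cdot>\<^sub>v v) = lincomb (\<lambda>b. c \<otimes>\<^bsub>class_ring\<^esub> v $ i b) B"
      unfolding h_def by (rule lincomb_cong[OF refl BV]) (use v i_lt in \<open>auto simp: class_ring_simps\<close>)
    also have "\<dots> = c \<odot>\<^bsub>V\<^esub> h v"
      unfolding h_def by (rule lincomb_smult[OF BV]) (auto simp: class_ring_simps)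
    finally show "h (c \<odot>\<^bsub>cvec n\<^esub> v) = c \<odot>\<^bsub>V\<^esub> h v" by (simp add: module_vec_simps)
  qed
  have "bij_betw h (carrier_vec n) (carrier V)"
  proof (rule bij_betw_imageI)
    show "inj_on h (carrier_vec n)"
    proof (rule inj_onI)
      fix x y assume xy: "x \<in> carrier_vec n" "y \<in> carrier_vec n" "h x = h y"
      have "(\<lambda>b\<in>B. x $ i b) = (\<lambda>b\<in>B. y $ i b)"
        using ex1[OF h_closed[of x]] xy(3) h_restrict by (metis UNIV_I restrict_PiE_iff)
      hence e: "x $ i b = y $ i b" if "b \<in> B" for b using that by (metis restrict_apply')
      show "x = y"
      proof (rule eq_vecI)
        fix j assume "j < dim_vec y"
        hence "j \<in> i ` B" using xy i by (auto simp: bij_betw_def n_def)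
        thus "x $ j = y $ j" using e by auto
      qed (use xy in auto)
    qed
    show "h ` carrier_vec n = carrier V"
    proof (intro equalityI subsetI)
      fix v assume "v \<in> carrier V"
      then obtain a where a: "lincomb a B = v" using ex1 by blast
      let ?x = "Matrix.vec n (\<lambda>j. a (inv_into B i j))"
      have "h ?x = lincomb a B"
        unfolding h_def by (rule lincomb_cong[OF refl BV])
          (use i_lt i in \<open>auto simp: class_ring_simps bij_betw_def\<close>)
      thus "v \<in> h ` carrier_vec n" using a by (auto intro!: image_eqI[of _ _ ?x])
    qed (use h_closed in auto)
  qed
  hence b: "bij_betw h (carrier (cvec n)) (carrier V)" by (simp add: module_vec_simps)
  show thesis
    using that[OF linear_map_inv_into[OF lin b]] bij_betw_inv_into[OF b] by (simp add: module_vec_simps)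
qed

definition matrix_of :: "nat \<Rightarrow> nat \<Rightarrow> (complex Matrix.vec \<Rightarrow> complex Matrix.vec) \<Rightarrow> complex Matrix.mat" where
  "matrix_of m n f = Matrix.mat m n (\<lambda>(i, j). f (unit_vec n j) $ i)"

lemma matrix_of_carrier: "matrix_of m n f \<in> carrier_mat m n"
  unfolding matrix_of_def by simp

lemma matrix_of_mult_vec:
  assumes f: "linear_map class_ring (cvec n) (cvec m) f"
    and x: "x \<in> carrier_vec n"
  shows "matrix_of m n f *\<^sub>v x = f x"
proof -
  note D = linear_mapD(3-5)[OF f, unfolded module_vec_simps]
  \<comment> \<open>Truncation of \<open>x\<close> after \<open>k\<close> coordinates. Linearity
    then has to be applied to only one unit vector in each step of the induction.\<close>
  let ?x = "\<lambda>k. Matrix.vec n (\<lambda>i. if i < k then x $ i else 0)"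
  have "f (?x k) = Matrix.vec m (\<lambda>i. \<Sum>j<k. f (unit_vec n j) $ i * x $ j)" if "k \<le> n" for k
    using that
  proof (induction k)
    case 0
    have "?x 0 = 0 \<cdot>\<^sub>v 0\<^sub>v n" by auto
    hence "f (?x 0) = 0 \<cdot>\<^sub>v f (0\<^sub>v n)" by (simp only: D(3)[OF zero_carrier_vec])
    thus ?case using D(1)[OF zero_carrier_vec[of n]] by (intro eq_vecI) auto
  next
    case (Suc k)
    have u: "unit_vec n k \<in> carrier_vec n" and v: "?x k \<in> carrier_vec n" by auto
    have "?x (Suc k) = ?x k + x $ k \<cdot>\<^sub>v unit_vec n k"
      using Suc.prems by (intro eq_vecI) (auto simp: less_Suc_eq)
    hence "f (?x (Suc k)) = f (?x k) + x $ k \<cdot>\<^sub>v f (unit_vec n k)"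
      using D(2)[OF v, of "x $ k \<cdot>\<^sub>v unit_vec n k"] D(3)[OF u] by simp
    thus ?case using Suc D(1)[OF u] by (intro eq_vecI) (auto simp: mult.commute)
  qed
  from this[of n] have "f (?x n) = Matrix.vec m (\<lambda>i. \<Sum>j<n. f (unit_vec n j) $ i * x $ j)" by simp
  moreover have "?x n = x" using x by (intro eq_vecI) auto
  moreover have "matrix_of m n f *\<^sub>v x = Matrix.vec m (\<lambda>i. \<Sum>j<n. f (unit_vec n j) $ i * x $ j)"
    using x by (intro eq_vecI) (auto simp: matrix_of_def scalar_prod_def lessThan_atLeast0)
  ultimately show ?thesis by simp
qed

lemma mat_eq_by_vec:
  assumes A: "A \<in> carrier_mat m n" and B: "B \<in> carrier_mat m n"
    and e: "\<And>x. x \<in> carrier_vec n \<Longrightarrow> A *\<^sub>v x = B *\<^sub>v (x :: complex Matrix.vec)"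
  shows "A = B"
proof (rule eq_matI)
  fix i j assume "i < dim_row B" "j < dim_col B"
  hence ij: "i < m" "j < n" using B by auto
  have "C $$ (i, j) = (C *\<^sub>v unit_vec n j) $ i" if "C \<in> carrier_mat m n" for C :: "complex Matrix.mat"
    using that ij by simp
  thus "A $$ (i, j) = B $$ (i, j)" using A B e[OF unit_vec_carrier] by simp
qed (use A B in auto)

text \<open>Transport of the operators along coordinates. It ensures that the choice operator in
  \<open>class_of_module\<close> has something to choose.\<close>

lemma matrix_form_exists:
  assumes K: "monoid K" and V: "vectorspace class_ring V" and fd: "vectorspace.fin_dim class_ring V"
    and lin: "\<And>g. g \<in> carrier K \<Longrightarrow> linear_map class_ring V V (T g)"
    and one: "\<And>v. v \<in> carrier V \<Longrightarrow> T \<one>\<^bsub>K\<^esub> v = v"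
    and mult: "\<And>g h v. g \<in> carrier K \<Longrightarrow> h \<in> carrier K \<Longrightarrow> v \<in> carrier V \<Longrightarrow>
      T (g \<otimes>\<^bsub>K\<^esub> h) v = T g (T h v)"
  obtains \<rho> where "matrix_form K V T \<rho>"
proof -
  interpret K: monoid K by fact
  obtain n f where f: "linear_map class_ring V (cvec n) f"
    and b: "bij_betw f (carrier V) (carrier_vec n)" using coordinates_exist[OF V fd] .
  have b': "bij_betw f (carrier V) (carrier (cvec n))"
    using b by (simp add: module_vec_simps)
  let ?i = "inv_into (carrier V) f"
  have i: "?i x \<in> carrier V" "f (?i x) = x" if "x \<in> carrier_vec n" for x
    using b that by (auto simp: bij_betw_def f_inv_into_f intro: inv_into_into)
  have fi: "?i (f v) = v" if "v \<in> carrier V" for v using b that by (simp add: bij_betw_def)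
  have fc: "f v \<in> carrier_vec n" if "v \<in> carrier V" for v using b that by (auto simp: bij_betw_def)
  define \<rho> where "\<rho> g = matrix_of n n (\<lambda>x. f (T g (?i x)))" for g
  have c: "\<rho> g \<in> carrier_mat n n" for g unfolding \<rho>_def by (rule matrix_of_carrier)
  have ap: "\<rho> g *\<^sub>v x = f (T g (?i x))" if "g \<in> carrier K" "x \<in> carrier_vec n" for g x
    unfolding \<rho>_def
    by (rule matrix_of_mult_vec[OF linear_map_compose[OF linear_map_compose[OF linear_map_inv_into[OF f b'] lin[OF that(1)]] f] that(2)])
  have Tc: "T g v \<in> carrier V" if "g \<in> carrier K" "v \<in> carrier V" for g v
    using linear_mapD(3)[OF lin[OF that(1)] that(2)] .
  have \<rho>_mult: "\<rho> (g \<otimes>\<^bsub>K\<^esub> h) = \<rho> g * \<rho> h" if g: "g \<in> carrier K" "h \<in> carrier K" for g h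
    proof (rule mat_eq_by_vec[OF c mult_carrier_mat[OF c c]])
      fix x :: "complex Matrix.vec" assume x: "x \<in> carrier_vec n"
      have "(\<rho> g * \<rho> h) *\<^sub>v x = \<rho> g *\<^sub>v (\<rho> h *\<^sub>v x)" by (rule assoc_mult_mat_vec[OF c c x])
      thus "\<rho> (g \<otimes>\<^bsub>K\<^esub> h) *\<^sub>v x = (\<rho> g * \<rho> h) *\<^sub>v x"
        using g x by (simp add: ap i fi Tc fc mult)
    qed
  have \<rho>_one: "\<rho> \<one>\<^bsub>K\<^esub> = 1\<^sub>m n"
    by (rule mat_eq_by_vec[OF c one_carrier_mat]) (simp add: ap i one)
  note r = is_repI[of K \<rho> n, OF c \<rho>_mult \<rho>_one]
  have "matrix_form K V T \<rho>" unfolding matrix_form_def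
    using r(1) f b by (auto simp: r(2) ap fc fi intro!: exI[of _ f])
  thus thesis by (rule that)
qed

text \<open>The change of coordinates, from one matrix form to the other through \<open>V\<close>,
  is the intertwiner. Invariance of dimension makes the degrees equal.\<close>

lemma matrix_form_unique:
  assumes "matrix_form K V T \<rho>" "matrix_form K V T \<sigma>"
    and Tc: "\<And>g v. g \<in> carrier K \<Longrightarrow> v \<in> carrier V \<Longrightarrow> T g v \<in> carrier V"
  shows "rep_iso K \<rho> \<sigma>"
proof -
  define n m where "n = rep_degree K \<rho>" and m: "m = rep_degree K \<sigma>"
  obtain f where r: "is_rep K \<rho>" and f: "linear_map class_ring V (cvec n) f"
    and b: "bij_betw f (carrier V) (carrier_vec n)"
    and e: "\<And>g v. g \<in> carrier K \<Longrightarrow> v \<in> carrier V \<Longrightarrow> f (T g v) = \<rho> g *\<^sub>v f v"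
    using assms(1) unfolding matrix_form_def n_def by auto
  obtain f' where r': "is_rep K \<sigma>" and f': "linear_map class_ring V (cvec m) f'"
    and b': "bij_betw f' (carrier V) (carrier_vec m)"
    and e': "\<And>g v. g \<in> carrier K \<Longrightarrow> v \<in> carrier V \<Longrightarrow> f' (T g v) = \<sigma> g *\<^sub>v f' v"
    using assms(2) unfolding matrix_form_def m by auto
  have l: "linear_map class_ring (cvec n) V (inv_into (carrier V) f)"
    "linear_map class_ring (cvec m) V (inv_into (carrier V) f')"
    by (rule linear_map_inv_into, fact f f', use b b' in \<open>simp add: module_vec_simps\<close>)+
  let ?h = "\<lambda>x. f' (inv_into (carrier V) f x)" and ?h' = "\<lambda>x. f (inv_into (carrier V) f' x)"
  have h: "linear_map class_ring (cvec n) (cvec m) ?h"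
    "linear_map class_ring (cvec m) (cvec n) ?h'"
    by (rule linear_map_compose[OF l(1) f'] linear_map_compose[OF l(2) f])+
  have "bij_betw ?h (carrier_vec n) (carrier_vec m)"
    using bij_betw_trans[OF bij_betw_inv_into[OF b] b'] by (simp add: comp_def)
  hence "n = m" by (rule linear_bij_vec_dim[OF h(1)])
  hence m: "rep_degree K \<sigma> = n" using m by simp
  note h = h[folded \<open>n = m\<close>] and b' = b'[folded \<open>n = m\<close>]
  have i: "inv_into (carrier V) f x \<in> carrier V" "f (inv_into (carrier V) f x) = x" 
    "inv_into (carrier V) f' x \<in> carrier V" "f' (inv_into (carrier V) f' x) = x" if "x \<in> carrier_vec n" for x
    using b b' that by (auto simp: bij_betw_def f_inv_into_f intro: inv_into_into)
  have fi: "inv_into (carrier V) f (f v) = v" "inv_into (carrier V) f' (f' v) = v" if "v \<in> carrier V" for v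
    using b b' that by (simp_all add: bij_betw_def)
  have fc: "f v \<in> carrier_vec n" "f' v \<in> carrier_vec n" if "v \<in> carrier V" for v
    using b b' that by (auto simp: bij_betw_def)
  let ?S = "matrix_of n n ?h" and ?S' = "matrix_of n n ?h'"
  note Sc = matrix_of_carrier[of n n ?h] matrix_of_carrier[of n n ?h']
  note S = matrix_of_mult_vec[OF h(1)] matrix_of_mult_vec[OF h(2)]
  show ?thesis
  proof (rule rep_isoI[OF r r' n_def[symmetric] m Sc])
    show "?S * ?S' = 1\<^sub>m n"
      by (rule mat_eq_by_vec[OF mult_carrier_mat[OF Sc] one_carrier_mat])
        (simp add: assoc_mult_mat_vec[OF Sc] S fc i fi)
    show "?S' * ?S = 1\<^sub>m n"
      by (rule mat_eq_by_vec[OF mult_carrier_mat[OF Sc(2,1)] one_carrier_mat])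
        (simp add: assoc_mult_mat_vec[OF Sc(2,1)] S fc i fi)
    fix g assume g: "g \<in> carrier K"
    have c: "\<rho> g \<in> carrier_mat n n" "\<sigma> g \<in> carrier_mat n n"
      using is_repD(1)[OF r g] is_repD(1)[OF r' g] m n_def by auto
    show "?S * \<rho> g = \<sigma> g * ?S"
    proof (rule mat_eq_by_vec[OF mult_carrier_mat[OF Sc(1) c(1)] mult_carrier_mat[OF c(2) Sc(1)]])
      fix x :: "complex Matrix.vec" assume x: "x \<in> carrier_vec n"
      define v where "v = inv_into (carrier V) f x"
      have v: "v \<in> carrier V" "x = f v" using i x by (auto simp: v_def)
      have "?S * \<rho> g *\<^sub>v x = ?S *\<^sub>v (\<rho> g *\<^sub>v f v)" using assoc_mult_mat_vec[OF Sc(1) c(1) x] v by simp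
      also have "\<dots> = f' (T g v)" unfolding e[OF g v(1), symmetric] using v g by (simp add: S fc Tc fi)
      also have "\<dots> = \<sigma> g *\<^sub>v (?S *\<^sub>v x)" unfolding e'[OF g v(1)] using v by (simp add: S fc fi)
      also have "\<dots> = \<sigma> g * ?S *\<^sub>v x" using assoc_mult_mat_vec[OF c(2) Sc(1) x] by simp
      finally show "?S * \<rho> g *\<^sub>v x = \<sigma> g * ?S *\<^sub>v x" .
    qed
  qed
qed

lemma matrix_form_is_rep: "matrix_form K V T \<rho> \<Longrightarrow> is_rep K \<rho>"
  by (simp add: matrix_form_def)

lemma class_of_module_eq:
  assumes K: "monoid K" and \<rho>: "matrix_form K V T \<rho>"
    and Tc: "\<And>g v. g \<in> carrier K \<Longrightarrow> v \<in> carrier V \<Longrightarrow> T g v \<in> carrier V"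
  shows "class_of_module K V T = rep_class K \<rho>"
proof -
  have s: "matrix_form K V T (SOME \<rho>. matrix_form K V T \<rho>)" using \<rho> by (rule someI[of "matrix_form K V T"])
  show ?thesis unfolding class_of_module_def
    by (rule monoid.rep_class_cong[OF K matrix_form_is_rep[OF s] matrix_form_is_rep[OF \<rho>]
        matrix_form_unique[OF s \<rho> Tc]])
qed

text \<open>In positive degree the zero vector and a unit vector would have to coincide. The lemma
  serves to show that the lifted classes vanish in high cohomological degrees and hence form a
  polynomial.\<close>

lemma matrix_form_degree_zero:
  assumes "matrix_form K V T \<rho>" "carrier V = {z}"
  shows "rep_degree K \<rho> = 0"
proof (rule ccontr)
  assume n: "rep_degree K \<rho> \<noteq> 0"
  obtain f where b: "bij_betw f (carrier V) (carrier_vec (rep_degree K \<rho>) :: complex Matrix.vec set)"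
    using assms(1) unfolding matrix_form_def by auto
  hence "(carrier_vec (rep_degree K \<rho>) :: complex Matrix.vec set) = {f z}"
    using assms(2) by (auto simp: bij_betw_def)
  hence "0\<^sub>v (rep_degree K \<rho>) = (unit_vec (rep_degree K \<rho>) 0 :: complex Matrix.vec)"
    using zero_carrier_vec[of "rep_degree K \<rho>"] unit_vec_carrier[of "rep_degree K \<rho>" 0] by (metis singletonD)
  thus False using n by (metis unit_vec_nonzero gr0I)
qed

lemma (in monoid) rep_class_degree_zero:
  assumes "is_rep G \<rho>" "rep_degree G \<rho> = 0"
  shows "rep_class G \<rho> = \<zero>\<^bsub>rep_ring G\<^esub>"
proof -
  have "rep_iso G \<rho> rep_zero"
  proof (rule rep_iso_eqI[OF assms(1) rep_zero(1) _ one_closed])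
    fix g assume "g \<in> carrier G"
    hence "\<rho> g \<in> carrier_mat 0 0" using is_repD(1)[OF assms(1)] assms(2) by simp
    thus "\<rho> g = rep_zero g" unfolding rep_zero_def by (intro eq_matI) auto
  qed
  thus ?thesis using rep_class_cong[OF assms(1) rep_zero(1)] by (simp add: rep_ring_def)
qed

section \<open>Singular cohomology of a disjoint union\<close>

lemma cochains_add: "c \<in> cochains p X \<Longrightarrow> d \<in> cochains p X \<Longrightarrow> (\<lambda>s. c s + d s) \<in> cochains p X"
  and cochains_scale: "c \<in> cochains p X \<Longrightarrow> (\<lambda>s. z * c s) \<in> cochains p X"
  unfolding cochains_def by auto

lemma coboundary_add:
  "coboundary p X (\<lambda>s. c s + d s) = (\<lambda>s. coboundary p X c s + coboundary p X d s)"
  unfolding coboundary_def by (auto simp: distrib_left sum.distrib simp del: sum.atMost_Suc)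

lemma coboundary_scale: "coboundary p X (\<lambda>s. z * c s) = (\<lambda>s. z * coboundary p X c s)"
  unfolding coboundary_def
  by (rule ext) (simp only: sum_distrib_left mult.left_commute[of _ z] if_distrib[of "(*) z"] mult_zero_right)

lemma cocycles_zero: "(\<lambda>s. 0) \<in> cocycles p X"
  unfolding cocycles_def cochains_def coboundary_def by auto

lemma cocycles_add: "c \<in> cocycles p X \<Longrightarrow> d \<in> cocycles p X \<Longrightarrow> (\<lambda>s. c s + d s) \<in> cocycles p X"
  unfolding cocycles_def by (auto simp: cochains_add coboundary_add)

lemma cocycles_scale: "c \<in> cocycles p X \<Longrightarrow> (\<lambda>s. z * c s) \<in> cocycles p X"
  unfolding cocycles_def by (auto simp: cochains_scale coboundary_scale)

lemma coboundaries_scale: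
  assumes "b \<in> coboundaries p X" shows "(\<lambda>s. z * b s) \<in> coboundaries p X"
proof (cases p)
  case (Suc q)
  then obtain c where "c \<in> cochains q X" "b = coboundary q X c" using assms by (auto simp: coboundaries_def)
  thus ?thesis using Suc
    by (auto simp: coboundaries_def coboundary_scale[symmetric] intro!: imageI cochains_scale)
qed (use assms in \<open>auto simp: coboundaries_def\<close>)

lemma coboundaries_zero: "(\<lambda>s. 0) \<in> coboundaries p X"
proof (cases p)
  case (Suc q)
  have "(\<lambda>s. 0) = coboundary q X (\<lambda>s. 0)" "(\<lambda>s. 0) \<in> cochains q X"
    by (auto simp: coboundary_def cochains_def)
  thus ?thesis unfolding Suc coboundaries_def nat.case by (rule image_eqI)
qed (auto simp: coboundaries_def)

lemma coboundaries_add: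
  assumes "b \<in> coboundaries p X" "c \<in> coboundaries p X"
  shows "(\<lambda>s. b s + c s) \<in> coboundaries p X"
proof (cases p)
  case (Suc q)
  then obtain b' c' where "b' \<in> cochains q X" "b = coboundary q X b'" "c' \<in> cochains q X" "c = coboundary q X c'"
    using assms by (auto simp: coboundaries_def)
  thus ?thesis using Suc
    by (auto simp: coboundaries_def coboundary_add[symmetric] intro!: imageI cochains_add)
qed (use assms in \<open>auto simp: coboundaries_def\<close>)

lemma mem_cohom_class_iff: "c \<in> cohom_class p X d \<longleftrightarrow> (\<lambda>s. c s - d s) \<in> coboundaries p X"
proof
  assume "(\<lambda>s. c s - d s) \<in> coboundaries p X"
  thus "c \<in> cohom_class p X d"
    unfolding cohom_class_def by (auto intro!: exI[of _ "\<lambda>s. c s - d s"])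
qed (auto simp: cohom_class_def)

lemma cohom_class_self: "c \<in> cohom_class p X c"
  by (simp add: mem_cohom_class_iff coboundaries_zero)

lemma coboundaries_diff:
  assumes "b \<in> coboundaries p X" "c \<in> coboundaries p X"
  shows "(\<lambda>s. b s - c s) \<in> coboundaries p X"
  using coboundaries_add[OF assms(1) coboundaries_scale[OF assms(2), of "-1"]] by simp

lemma cohom_class_eqI:
  assumes "(\<lambda>s. c s - d s) \<in> coboundaries p X"
  shows "cohom_class p X c = cohom_class p X d"
proof -
  have "(\<lambda>s. e s - d s) \<in> coboundaries p X" if "(\<lambda>s. e s - c s) \<in> coboundaries p X" for e
    using coboundaries_add[OF that assms] by simp
  moreover have "(\<lambda>s. e s - c s) \<in> coboundaries p X" if "(\<lambda>s. e s - d s) \<in> coboundaries p X" for e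
    using coboundaries_diff[OF that assms] by simp
  ultimately have "e \<in> cohom_class p X c \<longleftrightarrow> e \<in> cohom_class p X d" for e
    unfolding mem_cohom_class_iff by blast
  thus ?thesis by auto
qed

lemma cohom_class_eq_iff:
  "cohom_class p X c = cohom_class p X d \<longleftrightarrow> (\<lambda>s. c s - d s) \<in> coboundaries p X"
proof
  assume "cohom_class p X c = cohom_class p X d"
  hence "c \<in> cohom_class p X d" using cohom_class_self[of c p X] by simp
  thus "(\<lambda>s. c s - d s) \<in> coboundaries p X" by (simp only: mem_cohom_class_iff)
qed (rule cohom_class_eqI)

lemma cohom_class_UN:
  assumes "\<And>c'. c' \<in> cohom_class p X c \<Longrightarrow> f c' = f c"
  shows "(\<Union>c'\<in>cohom_class p X c. f c') = f c"
  using assms cohom_class_self[of c p X] by blast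

text \<open>Changing representatives by coboundaries changes the result by a coboundary, so the
  unions in the definition of the operations collapse to one class.\<close>

lemma cohomology_simps:
  "carrier (cohomology p X) = cohom_class p X ` cocycles p X"
  "\<zero>\<^bsub>cohomology p X\<^esub> = cohom_class p X (\<lambda>s. 0)"
  "cohom_class p X c \<oplus>\<^bsub>cohomology p X\<^esub> cohom_class p X d = cohom_class p X (\<lambda>s. c s + d s)"
  "z \<odot>\<^bsub>cohomology p X\<^esub> cohom_class p X c = cohom_class p X (\<lambda>s. z * c s)"
proof -
  have "cohom_class p X (\<lambda>s. c' s + d' s) = cohom_class p X (\<lambda>s. c s + d s)"
    if "c' \<in> cohom_class p X c" "d' \<in> cohom_class p X d" for c' d'
    using coboundaries_add[OF that[unfolded mem_cohom_class_iff]]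
    by (intro cohom_class_eqI) (simp add: add_diff_add)
  hence "(\<Union>c'\<in>cohom_class p X c. \<Union>d'\<in>cohom_class p X d. cohom_class p X (\<lambda>s. c' s + d' s))
      = cohom_class p X (\<lambda>s. c s + d s)"
    using cohom_class_self[of c p X] cohom_class_self[of d p X] by blast
  thus "cohom_class p X c \<oplus>\<^bsub>cohomology p X\<^esub> cohom_class p X d = cohom_class p X (\<lambda>s. c s + d s)"
    unfolding cohomology_def by simp
  have "cohom_class p X (\<lambda>s. z * c' s) = cohom_class p X (\<lambda>s. z * c s)" if "c' \<in> cohom_class p X c" for c'
    using coboundaries_scale[OF that[unfolded mem_cohom_class_iff], of z]
    by (intro cohom_class_eqI) (simp add: right_diff_distrib)
  thus "z \<odot>\<^bsub>cohomology p X\<^esub> cohom_class p X c = cohom_class p X (\<lambda>s. z * c s)"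
    unfolding cohomology_def module.simps
    by (rule cohom_class_UN[where f = "\<lambda>c. cohom_class p X (\<lambda>s. z * c s)"])
qed (simp_all only: cohomology_def partial_object.simps ring.simps)

lemma vectorspace_cohomology: "vectorspace class_ring (cohomology p X)"
proof (rule vs_criteria[OF class_field])
  let ?V = "cohomology p X"
  show "\<forall>v\<in>carrier ?V. \<exists>w\<in>carrier ?V. v \<oplus>\<^bsub>?V\<^esub> w = \<zero>\<^bsub>?V\<^esub>"
  proof
    fix v assume "v \<in> carrier ?V"
    then obtain c where c: "c \<in> cocycles p X" "v = cohom_class p X c" by (auto simp: cohomology_simps)
    thus "\<exists>w\<in>carrier ?V. v \<oplus>\<^bsub>?V\<^esub> w = \<zero>\<^bsub>?V\<^esub>"
      using cocycles_scale[OF c(1), of "-1"]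
      by (intro bexI[of _ "cohom_class p X (\<lambda>s. -1 * c s)"]) (auto simp: cohomology_simps)
  qed
qed (auto simp: cohomology_simps class_ring_simps cocycles_zero cocycles_add cocycles_scale
    add_ac distrib_left distrib_right mult.assoc)

section \<open>Functoriality of the pullback on cohomology\<close>

definition cochain_pullback :: "nat \<Rightarrow> 'a topology \<Rightarrow> ('a \<Rightarrow> 'b) \<Rightarrow> 'b cochain \<Rightarrow> 'a cochain" where
  "cochain_pullback p X f c = (\<lambda>s. if singular_simplex p X s then c (simplex_map p f s) else 0)"

lemma cochain_pullback_cochains: "cochain_pullback p X f c \<in> cochains p X"
  unfolding cochain_pullback_def cochains_def by auto

lemma singular_face_simplex_map':
  "k \<le> Suc p \<Longrightarrow> singular_face (Suc p) k (simplex_map (Suc p) f s) = simplex_map p f (singular_face (Suc p) k s)"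
  by (subst singular_face_simplex_map) (auto simp: simplex_map_def singular_face_def restrict_def fun_eq_iff)

lemma coboundary_pullback:
  assumes f: "continuous_map X Y f"
  shows "coboundary p X (cochain_pullback p X f c) = cochain_pullback (Suc p) X f (coboundary p Y c)"
proof
  fix s
  show "coboundary p X (cochain_pullback p X f c) s = cochain_pullback (Suc p) X f (coboundary p Y c) s"
  proof (cases "singular_simplex (Suc p) X s")
    case True
    have "singular_simplex (Suc p) Y (simplex_map (Suc p) f s)"
      by (rule singular_simplex_simplex_map[OF True f])
    moreover have "singular_simplex p X (singular_face (Suc p) k s)" if "k \<le> Suc p" for k
      using singular_simplex_singular_face[OF True, of k] that by simp
    ultimately show ?thesis using True
      unfolding coboundary_def cochain_pullback_def
      by (simp add: singular_face_simplex_map' del: sum.atMost_Suc)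
  qed (auto simp: coboundary_def cochain_pullback_def)
qed

lemma cochain_pullback_linear:
  "cochain_pullback p X f (\<lambda>s. c s + d s) = (\<lambda>s. cochain_pullback p X f c s + cochain_pullback p X f d s)"
  "cochain_pullback p X f (\<lambda>s. c s - d s) = (\<lambda>s. cochain_pullback p X f c s - cochain_pullback p X f d s)"
  "cochain_pullback p X f (\<lambda>s. z * c s) = (\<lambda>s. z * cochain_pullback p X f c s)"
  unfolding cochain_pullback_def by auto

lemma cochain_pullback_cocycles:
  assumes "continuous_map X Y f" "c \<in> cocycles p Y"
  shows "cochain_pullback p X f c \<in> cocycles p X"
proof -
  have "cochain_pullback (Suc p) X f (coboundary p Y c) = (\<lambda>s. 0)"
    using assms(2) by (auto simp: cocycles_def cochain_pullback_def)
  thus ?thesis using coboundary_pullback[OF assms(1), of p c]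
    by (simp add: cocycles_def cochain_pullback_cochains)
qed

lemma cochain_pullback_coboundaries:
  assumes f: "continuous_map X Y f" and "b \<in> coboundaries p Y"
  shows "cochain_pullback p X f b \<in> coboundaries p X"
proof (cases p)
  case 0
  thus ?thesis using assms by (auto simp: coboundaries_def cochain_pullback_def)
next
  case (Suc q)
  then obtain c where "b = coboundary q Y c" using assms by (auto simp: coboundaries_def)
  thus ?thesis unfolding Suc coboundaries_def
    by (auto simp: coboundary_pullback[OF f, symmetric] intro!: imageI cochain_pullback_cochains)
qed

lemma cohom_pullback_class:
  assumes f: "continuous_map X Y f"
  shows "cohom_pullback p X f (cohom_class p Y c) = cohom_class p X (cochain_pullback p X f c)"
proof -
  have "cohom_class p X (cochain_pullback p X f c') = cohom_class p X (cochain_pullback p X f c)"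
    if "c' \<in> cohom_class p Y c" for c'
    using cochain_pullback_coboundaries[OF f that[unfolded mem_cohom_class_iff]]
    by (intro cohom_class_eqI) (simp add: cochain_pullback_linear)
  thus ?thesis unfolding cohom_pullback_def cochain_pullback_def[symmetric]
    by (rule cohom_class_UN[where f = "\<lambda>c. cohom_class p X (cochain_pullback p X f c)"])
qed

lemma linear_map_cohom_pullback:
  assumes f: "continuous_map X Y f"
  shows "linear_map class_ring (cohomology p Y) (cohomology p X) (cohom_pullback p X f)"
  by (rule linear_mapI[OF vectorspace_cohomology vectorspace_cohomology])
    (auto simp: cohomology_simps cohom_pullback_class[OF f] cochain_pullback_linear
      cochain_pullback_cocycles[OF f])

lemma cohom_pullback_compose:
  assumes f: "continuous_map X Y f" and g: "continuous_map Y Z g" and h: "continuous_map X Z h"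
    and a: "a \<in> carrier (cohomology p Z)" and e: "\<And>x. x \<in> topspace X \<Longrightarrow> h x = g (f x)"
  shows "cohom_pullback p X f (cohom_pullback p Y g a) = cohom_pullback p X h a"
proof -
  obtain c where a: "a = cohom_class p Z c" using a by (auto simp: cohomology_simps)
  have "cochain_pullback p X f (cochain_pullback p Y g c) = cochain_pullback p X h c"
  proof
    fix s
    have "simplex_map p h s = simplex_map p g (simplex_map p f s)" if "singular_simplex p X s"
      using simplex_map_eq[OF that, of h "g \<circ> f"] e by (simp add: simplex_map_compose)
    thus "cochain_pullback p X f (cochain_pullback p Y g c) s = cochain_pullback p X h c s"
      using singular_simplex_simplex_map[OF _ f] by (auto simp: cochain_pullback_def)
  qed
  thus ?thesis unfolding a by (simp add: cohom_pullback_class[OF f] cohom_pullback_class[OF g] cohom_pullback_class[OF h])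
qed

lemma cohom_pullback_ident:
  assumes f: "continuous_map X X f" and a: "a \<in> carrier (cohomology p X)" and e: "\<And>x. x \<in> topspace X \<Longrightarrow> f x = x"
  shows "cohom_pullback p X f a = a"
proof -
  obtain c where c: "a = cohom_class p X c" "c \<in> cocycles p X" using a by (auto simp: cohomology_simps)
  have "cochain_pullback p X f c = c"
    using c(2) simplex_map_id_gen[OF _ e] by (auto simp: cochain_pullback_def cocycles_def cochains_def)
  thus ?thesis unfolding c(1) by (simp add: cohom_pullback_class[OF f])
qed

text \<open>Stated for simplices instead of points, because cochains see nothing else: each singular
  simplex of \<open>X\<close> lies in exactly one of the two pieces.\<close>

locale split_space =
  fixes X X0 X1 :: "'a topology"
  assumes simplex_iff: "singular_simplex p X s \<longleftrightarrow> singular_simplex p X0 s \<or> singular_simplex p X1 s"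
    and simplex_disjoint: "\<not> (singular_simplex p X0 s \<and> singular_simplex p X1 s)"
    and incl: "continuous_map X0 X id" "continuous_map X1 X id"
begin

lemma cochains_plus:
  assumes "c0 \<in> cochains p X0" "c1 \<in> cochains p X1"
  shows "(\<lambda>s. c0 s + c1 s) \<in> cochains p X"
  using assms simplex_iff unfolding cochains_def by auto

text \<open>The faces of a simplex in one piece stay in that piece, where the cochain of the other
  piece vanishes.\<close>

lemma coboundary_plus:
  assumes c: "c0 \<in> cochains p X0" "c1 \<in> cochains p X1"
  shows "coboundary p X (\<lambda>s. c0 s + c1 s) = (\<lambda>s. coboundary p X0 c0 s + coboundary p X1 c1 s)"
proof
  fix s :: "(nat \<Rightarrow> real) \<Rightarrow> 'a"
  have z: "singular_simplex p X1 t \<Longrightarrow> c0 t = 0" "singular_simplex p X0 t \<Longrightarrow> c1 t = 0" for t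
    using c simplex_disjoint unfolding cochains_def by auto
  have f: "singular_simplex (Suc p) Y s \<Longrightarrow> k \<le> Suc p \<Longrightarrow> singular_simplex p Y (singular_face (Suc p) k s)"
    for k and Y :: "'a topology"
    using singular_simplex_singular_face[of "Suc p" Y s k] by simp
  consider "singular_simplex (Suc p) X0 s" "\<not> singular_simplex (Suc p) X1 s" "singular_simplex (Suc p) X s"
    | "singular_simplex (Suc p) X1 s" "\<not> singular_simplex (Suc p) X0 s" "singular_simplex (Suc p) X s"
    | "\<not> singular_simplex (Suc p) X s" "\<not> singular_simplex (Suc p) X0 s" "\<not> singular_simplex (Suc p) X1 s"
    using simplex_iff simplex_disjoint by blast
  thus "coboundary p X (\<lambda>s. c0 s + c1 s) s = coboundary p X0 c0 s + coboundary p X1 c1 s"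
  proof cases
    case 1
    thus ?thesis unfolding coboundary_def by (simp add: z f[OF 1(1)] del: sum.atMost_Suc)
  next
    case 2
    thus ?thesis unfolding coboundary_def by (simp add: z f[OF 2(1)] del: sum.atMost_Suc)
  qed (auto simp: coboundary_def)
qed

lemma coboundaries_plus:
  assumes "b0 \<in> coboundaries p X0" "b1 \<in> coboundaries p X1"
  shows "(\<lambda>s. b0 s + b1 s) \<in> coboundaries p X"
proof (cases p)
  case (Suc q)
  then obtain c0 c1 where "c0 \<in> cochains q X0" "b0 = coboundary q X0 c0" "c1 \<in> cochains q X1" "b1 = coboundary q X1 c1"
    using assms by (auto simp: coboundaries_def)
  thus ?thesis using Suc
    by (auto simp: coboundaries_def coboundary_plus[symmetric] intro!: imageI cochains_plus)
qed (use assms in \<open>auto simp: coboundaries_def\<close>)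

lemma pullback_id: "Y = X0 \<or> Y = X1 \<Longrightarrow> cochain_pullback p Y id c = (\<lambda>s. if singular_simplex p Y s then c s else 0)"
  unfolding cochain_pullback_def using simplex_map_id_gen[of p Y _ id] by (auto simp del: simplex_map_id)

lemma pullback_plus:
  assumes "c0 \<in> cochains p X0" "c1 \<in> cochains p X1"
  shows "cochain_pullback p X0 id (\<lambda>s. c0 s + c1 s) = c0"
    and "cochain_pullback p X1 id (\<lambda>s. c0 s + c1 s) = c1"
  using assms simplex_disjoint unfolding cochains_def by (auto simp: pullback_id fun_eq_iff)

lemma plus_pullback:
  assumes "c \<in> cochains p X"
  shows "(\<lambda>s. cochain_pullback p X0 id c s + cochain_pullback p X1 id c s) = c"
  using assms simplex_disjoint simplex_iff unfolding cochains_def by (auto simp: pullback_id fun_eq_iff)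

text \<open>A cochain on \<open>X\<close> is the sum of its restrictions extended by zero,
  compatibly with coboundaries. For injectivity, the difference of two cocycles is written as such a
  sum, and both of its terms are coboundaries on their pieces.\<close>

lemma restriction_bij:
  "bij_betw (\<lambda>a. (cohom_pullback p X0 id a, cohom_pullback p X1 id a)) (carrier (cohomology p X))
     (carrier (cohomology p X0) \<times> carrier (cohomology p X1))"
  (is "bij_betw ?f _ _")
proof (rule bij_betw_imageI)
  note r = cohom_pullback_class[OF incl(1)] cohom_pullback_class[OF incl(2)]
  show "inj_on ?f (carrier (cohomology p X))"
  proof (rule inj_onI)
    fix a a' assume "a \<in> carrier (cohomology p X)" "a' \<in> carrier (cohomology p X)" and e: "?f a = ?f a'"
    then obtain c c' where c: "c \<in> cocycles p X" "a = cohom_class p X c" "c' \<in> cocycles p X" "a' = cohom_class p X c'"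
      by (auto simp: cohomology_simps)
    have "(\<lambda>s. c s - c' s) = (\<lambda>s. cochain_pullback p X0 id (\<lambda>s. c s - c' s) s + cochain_pullback p X1 id (\<lambda>s. c s - c' s) s)"
      by (rule plus_pullback[symmetric]) (use c in \<open>auto simp: cocycles_def cochains_def\<close>)
    also have "\<dots> \<in> coboundaries p X"
      by (rule coboundaries_plus) (use e in \<open>auto simp: c r cohom_class_eq_iff cochain_pullback_linear\<close>)
    finally show "a = a'" unfolding c cohom_class_eq_iff .
  qed
  show "?f ` carrier (cohomology p X) = carrier (cohomology p X0) \<times> carrier (cohomology p X1)"
  proof (intro equalityI subsetI)
    fix y assume "y \<in> ?f ` carrier (cohomology p X)"
    thus "y \<in> carrier (cohomology p X0) \<times> carrier (cohomology p X1)"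
      by (auto simp: cohomology_simps r cochain_pullback_cocycles[OF incl(1)] cochain_pullback_cocycles[OF incl(2)])
  next
    fix y assume "y \<in> carrier (cohomology p X0) \<times> carrier (cohomology p X1)"
    then obtain c0 c1 where c: "c0 \<in> cocycles p X0" "c1 \<in> cocycles p X1" "y = (cohom_class p X0 c0, cohom_class p X1 c1)"
      by (auto simp: cohomology_simps)
    let ?c = "\<lambda>s. c0 s + c1 s"
    have h: "c0 \<in> cochains p X0" "c1 \<in> cochains p X1" using c by (auto simp: cocycles_def)
    have "?c \<in> cocycles p X" using c cochains_plus[OF h] coboundary_plus[OF h] by (auto simp: cocycles_def)
    moreover have "?f (cohom_class p X ?c) = y" by (simp add: r c pullback_plus[OF h])
    ultimately show "y \<in> ?f ` carrier (cohomology p X)" by (force simp: cohomology_simps)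
  qed
qed

end

text \<open>The standard simplex is connected, so its image cannot meet both a clopen set and its
  complement. It is nonempty, so its image cannot lie in both.\<close>

lemma split_space_clopen:
  assumes "openin (top_of_set S) T" "closedin (top_of_set S) T"
  shows "split_space (top_of_set S) (top_of_set T) (top_of_set (S - T))"
proof
  have TS: "T \<subseteq> S" using assms(1) openin_subset by fastforce
  fix p and s :: "(nat \<Rightarrow> real) \<Rightarrow> 'a"
  show "singular_simplex p (top_of_set S) s \<longleftrightarrow>
      singular_simplex p (top_of_set T) s \<or> singular_simplex p (top_of_set (S - T)) s"
  proof
    assume s: "singular_simplex p (top_of_set S) s"
    hence "connectedin (top_of_set S) (s ` standard_simplex p)"
      unfolding singular_simplex_def using connectedin_standard_simplex
      by (intro connectedin_continuous_map_image) (auto simp: connectedin_subtopology)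
    hence "s ` standard_simplex p \<subseteq> T \<or> disjnt (s ` standard_simplex p) T"
      using assms connectedin_clopen_cases by blast
    thus "singular_simplex p (top_of_set T) s \<or> singular_simplex p (top_of_set (S - T)) s"
      using s by (auto simp: singular_simplex_subtopology disjnt_def)
  qed (use TS in \<open>auto simp: singular_simplex_subtopology\<close>)
  show "\<not> (singular_simplex p (top_of_set T) s \<and> singular_simplex p (top_of_set (S - T)) s)"
    using nonempty_standard_simplex[of p] by (auto simp: singular_simplex_subtopology)
  show "continuous_map (top_of_set T) (top_of_set S) id" "continuous_map (top_of_set (S - T)) (top_of_set S) id"
    using TS by auto
qed

section \<open>Two pieces swapped by a central element\<close>

lemma linear_map_append:
  assumes f: "linear_map class_ring V (cvec n) f"
    and g: "linear_map class_ring V (cvec m) g"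
  shows "linear_map class_ring V (cvec (n + m)) (\<lambda>v. f v @\<^sub>v g v)"
proof (rule linear_mapI[OF linear_mapD(1)[OF f] vec_vs])
  note F = linear_mapD(3-5)[OF f, unfolded module_vec_simps] and G = linear_mapD(3-5)[OF g, unfolded module_vec_simps]
  fix v w assume v: "v \<in> carrier V" and w: "w \<in> carrier V"
  show "f (v \<oplus>\<^bsub>V\<^esub> w) @\<^sub>v g (v \<oplus>\<^bsub>V\<^esub> w)
      = (f v @\<^sub>v g v) \<oplus>\<^bsub>cvec (n + m)\<^esub> (f w @\<^sub>v g w)"
    using F(1)[OF v] F(1)[OF w] G(1)[OF v] G(1)[OF w]
    by (simp add: module_vec_simps F(2)[OF v w] G(2)[OF v w] append_vec_add[of _ n _ _ m])
next
  note F = linear_mapD(3-5)[OF f, unfolded module_vec_simps] and G = linear_mapD(3-5)[OF g, unfolded module_vec_simps]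
  fix v assume v: "v \<in> carrier V"
  show "f v @\<^sub>v g v \<in> carrier (cvec (n + m))"
    using F(1)[OF v] G(1)[OF v] by (simp add: module_vec_simps)
  show "f (c \<odot>\<^bsub>V\<^esub> v) @\<^sub>v g (c \<odot>\<^bsub>V\<^esub> v) = c \<odot>\<^bsub>cvec (n + m)\<^esub> (f v @\<^sub>v g v)" for c
    using F(1)[OF v] G(1)[OF v]
    by (intro eq_vecI) (auto simp: module_vec_simps F(3)[OF v] G(3)[OF v])
qed

lemma bij_betw_append:
  "bij_betw (\<lambda>(x, y). x @\<^sub>v y) (carrier_vec n \<times> carrier_vec m) (carrier_vec (n + m))"
  by (rule bij_betw_byWitness[where f' = "\<lambda>v. (vec_first v n, vec_last v m)"])
    (auto simp: vec_first_def vec_last_def intro!: eq_vecI)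

text \<open>\<open>act_T\<close> expresses in one equivalence that \<open>k\<close> preserves
  \<open>T\<close> and its complement if the sign is 1 and exchanges them otherwise. The exponent
  \<open>N\<close> gives the operator of \<open>s\<close> squared finite order, as the square root
  requires.\<close>

locale swapped_cover = group G for G :: "('k, 'm) monoid_scheme" (structure) +
  fixes act :: "'k \<Rightarrow> 'a::topological_space \<Rightarrow> 'a" and S T :: "'a set" and \<theta> :: "'k \<Rightarrow> complex"
    and s :: 'k and N :: nat
  assumes cont: "k \<in> carrier G \<Longrightarrow> continuous_on S (act k)"
    and act_mem: "k \<in> carrier G \<Longrightarrow> v \<in> S \<Longrightarrow> act k v \<in> S"
    and act_one: "v \<in> S \<Longrightarrow> act \<one> v = v"
    and act_mult: "k \<in> carrier G \<Longrightarrow> k' \<in> carrier G \<Longrightarrow> v \<in> S \<Longrightarrow> act (k \<otimes> k') v = act k (act k' v)"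
    and \<theta>_cases: "k \<in> carrier G \<Longrightarrow> \<theta> k = 1 \<or> \<theta> k = -1"
    and \<theta>_mult: "k \<in> carrier G \<Longrightarrow> k' \<in> carrier G \<Longrightarrow> \<theta> (k \<otimes> k') = \<theta> k * \<theta> k'"
    and act_T: "k \<in> carrier G \<Longrightarrow> v \<in> S \<Longrightarrow> act k v \<in> T \<longleftrightarrow> (v \<in> T \<longleftrightarrow> \<theta> k = 1)"
    and T_open: "openin (top_of_set S) T" and T_closed: "closedin (top_of_set S) T"
    and s: "s \<in> carrier G" "\<theta> s = -1"
    and s_central: "k \<in> carrier G \<Longrightarrow> s \<otimes> k = k \<otimes> s"
    and s_order: "N > 0" "s [^] N = \<one>"
begin

definition H where "H = {k \<in> carrier G. \<theta> k = 1}"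

abbreviation "K0 \<equiv> G\<lparr>carrier := H\<rparr>"
abbreviation "X \<equiv> top_of_set S"
abbreviation "X0 \<equiv> top_of_set T"
abbreviation "X1 \<equiv> top_of_set (S - T)"
abbreviation "A \<equiv> cohom_action G act X"
abbreviation "A0 \<equiv> cohom_action K0 act X0"
abbreviation "res \<equiv> \<lambda>p. cohom_pullback p X0 id"

lemma TS: "T \<subseteq> S" using T_open openin_subset by fastforce

lemma \<theta>_one: "\<theta> \<one> = 1"
  using \<theta>_mult[of \<one> \<one>] \<theta>_cases[of \<one>] by auto

lemma \<theta>_inv: "k \<in> carrier G \<Longrightarrow> \<theta> (inv k) = \<theta> k"
  using \<theta>_mult[of "inv k" k] \<theta>_cases[of k] \<theta>_cases[of "inv k"] \<theta>_one by auto

lemma subgroup_H: "subgroup H G"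
  by (rule subgroupI) (auto simp: H_def \<theta>_one \<theta>_inv \<theta>_mult)

lemma group_K0: "group K0"
  using subgroup.subgroup_is_group[OF subgroup_H] group_axioms by blast

lemma H_mem: "k \<in> H \<Longrightarrow> k \<in> carrier G" "k \<in> H \<Longrightarrow> inv k \<in> H" "k \<in> H \<Longrightarrow> \<theta> k = 1"
  by (auto simp: H_def \<theta>_inv)

lemma inv_K0: "k \<in> H \<Longrightarrow> inv\<^bsub>K0\<^esub> k = inv k"
  using m_inv_consistent[OF subgroup_H] by simp

lemma ss_H: "s \<otimes> s \<in> H" using s by (simp add: H_def \<theta>_mult)

lemma cont_X: "k \<in> carrier G \<Longrightarrow> continuous_map X X (act k)"
  using cont act_mem by auto

lemma cont_X0_X: "k \<in> carrier G \<Longrightarrow> continuous_map X0 X (act k)"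
  using cont act_mem TS by (auto intro: continuous_on_subset)

lemma cont_X0: "k \<in> H \<Longrightarrow> continuous_map X0 X0 (act k)"
  using cont[of k] act_T[of k] TS H_mem by (auto intro: continuous_on_subset)

lemma cont_swap: "continuous_map X0 X1 (act (inv s))" "continuous_map X1 X0 (act s)"
  using cont[of s] cont[of "inv s"] act_T[of s] act_T[of "inv s"] act_mem[of "inv s"] TS s
  by (auto simp: \<theta>_inv intro: continuous_on_subset)

lemma cont_id: "continuous_map X0 X id" "continuous_map X1 X id"
  using TS by auto

sublocale split: split_space X X0 X1 by (rule split_space_clopen[OF T_open T_closed])

lemma A_linear: "k \<in> carrier G \<Longrightarrow> linear_map class_ring (cohomology p X) (cohomology p X) (A p k)"
  unfolding cohom_action_def by (rule linear_map_cohom_pullback[OF cont_X]) simp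

lemma A_closed: "k \<in> carrier G \<Longrightarrow> a \<in> carrier (cohomology p X) \<Longrightarrow> A p k a \<in> carrier (cohomology p X)"
  by (rule linear_mapD(3)[OF A_linear])

lemma A_mult:
  assumes "k \<in> carrier G" "k' \<in> carrier G" "a \<in> carrier (cohomology p X)"
  shows "A p (k \<otimes> k') a = A p k (A p k' a)"
  unfolding cohom_action_def using assms
  by (intro cohom_pullback_compose[symmetric, where Y = X and Z = X])
    (auto simp: inv_mult_group act_mult simp del: continuous_map_subtopology_eu intro: cont_X)

lemma A0_linear: "k \<in> H \<Longrightarrow> linear_map class_ring (cohomology p X0) (cohomology p X0) (A0 p k)"
  unfolding cohom_action_def by (rule linear_map_cohom_pullback[OF cont_X0]) (simp add: inv_K0 H_mem)

lemma A0_closed: "k \<in> H \<Longrightarrow> a \<in> carrier (cohomology p X0) \<Longrightarrow> A0 p k a \<in> carrier (cohomology p X0)"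
  by (rule linear_mapD(3)[OF A0_linear])

lemma A0_mult:
  assumes "k \<in> H" "k' \<in> H" "a \<in> carrier (cohomology p X0)"
  shows "A0 p (k \<otimes> k') a = A0 p k (A0 p k' a)"
proof -
  have "k \<otimes> k' \<in> H" using assms subgroup.m_closed[OF subgroup_H] by blast
  hence "inv\<^bsub>K0\<^esub> (k \<otimes> k') = inv k' \<otimes> inv k" using assms by (simp add: inv_K0 inv_mult_group H_mem)
  moreover have "act (inv k' \<otimes> inv k) x = act (inv k') (act (inv k) x)" if "x \<in> T" for x
    using that TS assms by (intro act_mult) (auto simp: H_mem)
  moreover have "continuous_map X0 X0 (act (inv k' \<otimes> inv k))"
    using assms H_mem by (intro cont_X0 subgroup.m_closed[OF subgroup_H]) auto
  ultimately show ?thesis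
    unfolding cohom_action_def using assms
    by (intro cohom_pullback_compose[symmetric, where Y = X0 and Z = X0])
      (auto simp: inv_K0 H_mem simp del: continuous_map_subtopology_eu intro: cont_X0)
qed

lemma A0_one: "a \<in> carrier (cohomology p X0) \<Longrightarrow> A0 p \<one> a = a"
  unfolding cohom_action_def using subgroup.one_closed[OF subgroup_H] TS
  by (intro cohom_pullback_ident)
    (auto simp: inv_K0 act_one simp del: continuous_map_subtopology_eu intro: cont_X0)

lemma res_linear: "linear_map class_ring (cohomology p X) (cohomology p X0) (res p)"
  by (rule linear_map_cohom_pullback[OF cont_id(1)])

lemma res_closed: "a \<in> carrier (cohomology p X) \<Longrightarrow> res p a \<in> carrier (cohomology p X0)"
  by (rule linear_mapD(3)[OF res_linear])

text \<open>Both sides are the pullback to \<open>T\<close> along the action of the inverse of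
  \<open>k\<close>, which maps \<open>T\<close> to itself.\<close>

lemma res_A:
  assumes k: "k \<in> H" and a: "a \<in> carrier (cohomology p X)"
  shows "res p (A p k a) = A0 p k (res p a)"
proof -
  have "res p (A p k a) = cohom_pullback p X0 (act (inv k)) a"
    unfolding cohom_action_def using k
    by (intro cohom_pullback_compose[OF cont_id(1) cont_X cont_X0_X a]) (auto simp: H_mem)
  also have "\<dots> = A0 p k (res p a)"
    unfolding cohom_action_def using k
    by (intro cohom_pullback_compose[OF _ cont_id(1) cont_X0_X a, symmetric])
      (auto simp: H_mem inv_K0 simp del: continuous_map_subtopology_eu intro: cont_X0)
  finally show ?thesis .
qed

text \<open>Since \<open>s\<close> is central, the second coordinate in \<open>res_pair_bij\<close>
  carries the same action of \<open>H\<close> as the first, not a conjugate of it.\<close>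

lemma res_As_A:
  assumes k: "k \<in> H" and a: "a \<in> carrier (cohomology p X)"
  shows "res p (A p s (A p k a)) = A0 p k (res p (A p s a))"
proof -
  have "A p s (A p k a) = A p k (A p s a)"
    using A_mult[OF s(1) H_mem(1)[OF k] a] A_mult[OF H_mem(1)[OF k] s(1) a] s_central[OF H_mem(1)[OF k]] by simp
  thus ?thesis using res_A[OF k A_closed[OF s(1) a]] by simp
qed

lemma res_As_As:
  "a \<in> carrier (cohomology p X) \<Longrightarrow> res p (A p s (A p s a)) = A0 p (s \<otimes> s) (res p a)"
  using A_mult[OF s(1) s(1)] res_A[OF ss_H] by simp

text \<open>\<open>A p s\<close> pulls back along the inverse of \<open>s\<close>, which takes
  \<open>T\<close> to \<open>S - T\<close>. The second coordinate is thus the restriction to the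
  other piece, transported to \<open>T\<close>, and the bijection of \<open>restriction_bij\<close>
  applies.\<close>

lemma res_pair_bij:
  "bij_betw (\<lambda>a. (res p a, res p (A p s a))) (carrier (cohomology p X))
     (carrier (cohomology p X0) \<times> carrier (cohomology p X0))"
proof -
  let ?q = "cohom_pullback p X0 (act (inv s))" and ?q' = "cohom_pullback p X1 (act s)"
  note qc = linear_mapD(3)[OF linear_map_cohom_pullback[OF cont_swap(1)]]
    linear_mapD(3)[OF linear_map_cohom_pullback[OF cont_swap(2)]]
  have inv1: "act s (act (inv s) x) = x" and inv2: "act (inv s) (act s x) = x" if "x \<in> S" for x
    using that s act_mult[of s "inv s" x] act_mult[of "inv s" s x] act_one by auto
  have "bij_betw ?q (carrier (cohomology p X1)) (carrier (cohomology p X0))"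
  proof (rule bij_betw_byWitness[where f' = ?q'])
    show "\<forall>a\<in>carrier (cohomology p X1). ?q' (?q a) = a"
    proof
      fix a assume a: "a \<in> carrier (cohomology p X1)"
      have "?q' (?q a) = cohom_pullback p X1 id a"
        by (rule cohom_pullback_compose[OF cont_swap(2,1) _ a]) (use inv2 in auto)
      thus "?q' (?q a) = a" using cohom_pullback_ident[OF _ a, of id] by simp
    qed
    show "\<forall>a\<in>carrier (cohomology p X0). ?q (?q' a) = a"
    proof
      fix a assume a: "a \<in> carrier (cohomology p X0)"
      have "?q (?q' a) = cohom_pullback p X0 id a"
        by (rule cohom_pullback_compose[OF cont_swap(1,2) _ a]) (use inv1 TS in auto)
      thus "?q (?q' a) = a" using cohom_pullback_ident[OF _ a, of id] by simp
    qed
  qed (use qc in auto)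
  hence "bij_betw (map_prod id ?q) (carrier (cohomology p X0) \<times> carrier (cohomology p X1))
      (carrier (cohomology p X0) \<times> carrier (cohomology p X0))"
    by (intro bij_betw_map_prod) auto
  from bij_betw_trans[OF split.restriction_bij this]
  have "bij_betw (\<lambda>a. (res p a, ?q (cohom_pullback p X1 id a))) (carrier (cohomology p X))
      (carrier (cohomology p X0) \<times> carrier (cohomology p X0))"
    by (simp add: comp_def)
  moreover have "?q (cohom_pullback p X1 id a) = res p (A p s a)" if a: "a \<in> carrier (cohomology p X)" for a
  proof -
    have "?q (cohom_pullback p X1 id a) = cohom_pullback p X0 (act (inv s)) a"
      by (rule cohom_pullback_compose[OF cont_swap(1) cont_id(2) cont_X0_X a]) (use s in auto)
    also have "\<dots> = res p (A p s a)"
      unfolding cohom_action_def using s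
      by (intro cohom_pullback_compose[OF cont_id(1) cont_X cont_X0_X a, symmetric]) auto
    finally show ?thesis .
  qed
  ultimately show ?thesis by (simp cong: bij_betw_cong)
qed

lemma res_surj: "res p ` carrier (cohomology p X) = carrier (cohomology p X0)"
proof -
  \<comment> \<open>The projection of the product to its first factor is onto because the second
    factor contains the zero class.\<close>
  have "fst ` ((\<lambda>a. (res p a, res p (A p s a))) ` carrier (cohomology p X)) = carrier (cohomology p X0)"
    using res_pair_bij[of p] cocycles_zero[of p X0] by (auto simp: bij_betw_def cohomology_simps)
  thus ?thesis by (simp add: image_image)
qed

text \<open>One direction is surjectivity of the restriction. For the other, coordinates on the
  cohomology of \<open>T\<close> give twice as many coordinates on that of \<open>S\<close> through
  \<open>res_pair_bij\<close>.\<close>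

lemma fin_dim_iff:
  "vectorspace.fin_dim class_ring (cohomology p X) \<longleftrightarrow> vectorspace.fin_dim class_ring (cohomology p X0)"
proof
  assume "vectorspace.fin_dim class_ring (cohomology p X)"
  thus "vectorspace.fin_dim class_ring (cohomology p X0)" by (rule fin_dim_surj[OF res_linear res_surj])
next
  assume "vectorspace.fin_dim class_ring (cohomology p X0)"
  then obtain n f where f: "linear_map class_ring (cohomology p X0) (cvec n) f"
    and b: "bij_betw f (carrier (cohomology p X0)) (carrier_vec n)"
    using coordinates_exist[OF vectorspace_cohomology] by metis
  have "linear_map class_ring (cohomology p X) (cvec (n + n)) (\<lambda>a. f (res p a) @\<^sub>v f (res p (A p s a)))"
    by (intro linear_map_append linear_map_compose[OF _ f] linear_map_compose[OF A_linear res_linear] res_linear s)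
  moreover have "bij_betw (\<lambda>a. f (res p a) @\<^sub>v f (res p (A p s a))) (carrier (cohomology p X)) (carrier_vec (n + n))"
    using bij_betw_trans[OF bij_betw_trans[OF res_pair_bij bij_betw_map_prod[OF b b]] bij_betw_append]
    by (simp add: comp_def)
  ultimately show "vectorspace.fin_dim class_ring (cohomology p X)" by (rule fin_dim_of_bij)
qed

lemma trivial_iff:
  "carrier (cohomology p X) = {\<zero>\<^bsub>cohomology p X\<^esub>} \<longleftrightarrow> carrier (cohomology p X0) = {\<zero>\<^bsub>cohomology p X0\<^esub>}"
proof
  assume "carrier (cohomology p X) = {\<zero>\<^bsub>cohomology p X\<^esub>}"
  hence "carrier (cohomology p X0) = {res p \<zero>\<^bsub>cohomology p X\<^esub>}" using res_surj[of p] by auto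
  moreover have "\<zero>\<^bsub>cohomology p X0\<^esub> \<in> carrier (cohomology p X0)" by (auto simp: cohomology_simps cocycles_zero)
  ultimately show "carrier (cohomology p X0) = {\<zero>\<^bsub>cohomology p X0\<^esub>}" by auto
next
  assume 0: "carrier (cohomology p X0) = {\<zero>\<^bsub>cohomology p X0\<^esub>}"
  have z: "\<zero>\<^bsub>cohomology p X\<^esub> \<in> carrier (cohomology p X)" by (auto simp: cohomology_simps cocycles_zero)
  have "a = \<zero>\<^bsub>cohomology p X\<^esub>" if a: "a \<in> carrier (cohomology p X)" for a
  proof -
    have eq0: "res p b = \<zero>\<^bsub>cohomology p X0\<^esub>" if "b \<in> carrier (cohomology p X)" for b
      using res_closed[OF that] 0 by blast
    show ?thesis
      by (rule inj_onD[OF bij_betw_imp_inj_on[OF res_pair_bij] _ a z])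
        (simp only: eq0[OF a] eq0[OF z] eq0[OF A_closed[OF s(1) a]] eq0[OF A_closed[OF s(1) z]])
  qed
  thus "carrier (cohomology p X) = {\<zero>\<^bsub>cohomology p X\<^esub>}" using z by blast
qed

lemma finite_total_iff: "finite_total_cohomology X \<longleftrightarrow> finite_total_cohomology X0"
  unfolding finite_total_cohomology_def by (simp add: fin_dim_iff trivial_iff)

end

lemma linear_map_mat_comb:
  assumes f: "linear_map class_ring V (cvec n) f"
    and g: "linear_map class_ring V (cvec n) g" and S: "S \<in> carrier_mat n n"
  shows "linear_map class_ring V (cvec n) (\<lambda>v. S *\<^sub>v f v + c \<cdot>\<^sub>v g v)"
proof (rule linear_mapI[OF linear_mapD(1)[OF f] vec_vs])
  note F = linear_mapD(3-5)[OF f, unfolded module_vec_simps] and G = linear_mapD(3-5)[OF g, unfolded module_vec_simps]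
  fix v w assume v: "v \<in> carrier V" and w: "w \<in> carrier V"
  show "S *\<^sub>v f v + c \<cdot>\<^sub>v g v \<in> carrier (cvec n)"
    using F(1)[OF v] G(1)[OF v] S by (simp add: module_vec_simps)
  show "S *\<^sub>v f (v \<oplus>\<^bsub>V\<^esub> w) + c \<cdot>\<^sub>v g (v \<oplus>\<^bsub>V\<^esub> w)
      = (S *\<^sub>v f v + c \<cdot>\<^sub>v g v) \<oplus>\<^bsub>cvec n\<^esub> (S *\<^sub>v f w + c \<cdot>\<^sub>v g w)"
    unfolding F(2)[OF v w] G(2)[OF v w] mult_add_distrib_mat_vec[OF S F(1)[OF v] F(1)[OF w]]
    using F(1)[OF v] F(1)[OF w] G(1)[OF v] G(1)[OF w] S
    by (intro eq_vecI) (auto simp: module_vec_simps distrib_left)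
next
  note F = linear_mapD(3-5)[OF f, unfolded module_vec_simps] and G = linear_mapD(3-5)[OF g, unfolded module_vec_simps]
  fix d v assume v: "v \<in> carrier V"
  show "S *\<^sub>v f (d \<odot>\<^bsub>V\<^esub> v) + c \<cdot>\<^sub>v g (d \<odot>\<^bsub>V\<^esub> v)
      = d \<odot>\<^bsub>cvec n\<^esub> (S *\<^sub>v f v + c \<cdot>\<^sub>v g v)"
    unfolding F(3)[OF v] G(3)[OF v] mult_mat_vec[OF S F(1)[OF v]]
    using F(1)[OF v] G(1)[OF v] S
    by (intro eq_vecI) (auto simp: module_vec_simps distrib_left mult.left_commute)
qed

lemma bij_betw_mult_mat_vec:
  assumes "S \<in> carrier_mat n n" "S' \<in> carrier_mat n n" "S * S' = 1\<^sub>m n" "S' * S = (1\<^sub>m n :: complex Matrix.mat)"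
  shows "bij_betw (\<lambda>x. S *\<^sub>v x) (carrier_vec n) (carrier_vec n)"
  by (rule bij_betw_byWitness[where f' = "\<lambda>x. S' *\<^sub>v x"])
    (use assms in \<open>auto simp: assoc_mult_mat_vec[symmetric] simp del: assoc_mult_mat_vec\<close>)

text \<open>The passage to the two eigenspaces of the swap; it is invertible because 2 is.\<close>

lemma bij_betw_sum_diff:
  "bij_betw (\<lambda>(x, y). (x + y, x + (-1) \<cdot>\<^sub>v y)) (carrier_vec n \<times> carrier_vec n)
     (carrier_vec n \<times> (carrier_vec n :: complex Matrix.vec set))"
  by (rule bij_betw_byWitness[where f' = "\<lambda>(u, w). ((1 / 2) \<cdot>\<^sub>v (u + w), (1 / 2) \<cdot>\<^sub>v (u + (-1) \<cdot>\<^sub>v w))"])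
    (auto intro!: eq_vecI simp: field_simps)

lemma smult_mat_mult_vec:
  "A \<in> carrier_mat n m \<Longrightarrow> x \<in> carrier_vec m \<Longrightarrow> (c \<cdot>\<^sub>m A) *\<^sub>v x = c \<cdot>\<^sub>v (A *\<^sub>v (x :: complex Matrix.vec))"
  by (intro eq_vecI) auto

lemma kronecker_scalar: "kronecker (c \<cdot>\<^sub>m 1\<^sub>m 1) A = c \<cdot>\<^sub>m A"
  by (rule eq_matI) (auto simp: kronecker_def)

section \<open>Evaluation of polynomials over a commutative ring\<close>

lemma UP_carrier_iff:
  "p \<in> carrier (UP R) \<longleftrightarrow> (\<forall>i. p i \<in> carrier R) \<and> (\<exists>n. bound \<zero>\<^bsub>R\<^esub> n p)"
  unfolding UP_def up_def by auto

lemma UP_coeff: "p \<in> carrier (UP R) \<Longrightarrow> coeff (UP R) p i = p i"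
  unfolding UP_def by auto

lemma (in cring) UP_const_mult:
  assumes "u \<in> carrier R" "p \<in> carrier (UP R)"
  shows "up_ring.monom (UP R) u 0 \<otimes>\<^bsub>UP R\<^esub> p = (\<lambda>i. u \<otimes> p i)"
proof -
  interpret UP_cring R "UP R" by unfold_locales simp
  show ?thesis using monom_mult_is_smult[OF assms] assms by (simp add: UP_def)
qed

lemma (in cring) eval_const_mult:
  assumes "u \<in> carrier R" "p \<in> carrier (UP R)" "t \<in> carrier R"
  shows "eval R R id t (up_ring.monom (UP R) u 0 \<otimes>\<^bsub>UP R\<^esub> p) = u \<otimes> eval R R id t p"
    and "eval R R id t p \<in> carrier R"
proof -
  have "UP_pre_univ_prop R R id" by (rule UP_pre_univ_propI) (auto simp: is_cring intro: ring_hom_memI)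
  then interpret UP_pre_univ_prop R R id "UP R" by simp_all
  note h = eval_ring_hom[OF assms(3)]
  show "eval R R id t p \<in> carrier R" by (rule ring_hom_closed[OF h assms(2)])
  show "eval R R id t (up_ring.monom (UP R) u 0 \<otimes>\<^bsub>UP R\<^esub> p) = u \<otimes> eval R R id t p"
    using ring_hom_mult[OF h monom_closed[OF assms(1)] assms(2)] eval_const[OF assms(3,1)] by simp
qed

text \<open>The sum runs to an arbitrary bound instead of the degree. A homomorphism may lower the
  degree, while a bound remains a bound.\<close>

lemma (in cring) eval_upto:
  assumes p: "p \<in> carrier (UP R)" and N: "bound \<zero> N p" and t: "t \<in> carrier R"
  shows "eval R R id t p = (\<Oplus>i\<in>{..N}. p i \<otimes> t [^] i)"
proof -
  note extend = add.finprod_mono_neutral_cong_left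
  interpret UP_cring R "UP R" by unfold_locales simp
  have c: "p i \<in> carrier R" for i using p by (simp add: UP_carrier_iff)
  have z: "p i = \<zero>" if "i > N" for i using N that by (auto dest: bound.bound)
  have "deg R p \<le> N" by (rule deg_aboveI) (use p z in \<open>auto simp: UP_coeff\<close>)
  have "eval R R id t p = (\<Oplus>i\<in>{..deg R p}. p i \<otimes> t [^] i)"
    using eval_on_carrier[OF p, of R id t] by (simp add: UP_coeff[OF p])
  also have "\<dots> = (\<Oplus>i\<in>{..N}. p i \<otimes> t [^] i)"
  proof (rule extend)
    fix i assume "i \<in> {..N} - {..deg R p}"
    hence "p i = \<zero>" using deg_aboveD[of p i] p by (simp add: UP_coeff)
    thus "p i \<otimes> t [^] i = \<zero>" using t by simp
  qed (use \<open>deg R p \<le> N\<close> c t in auto)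
  finally show ?thesis .
qed

lemma (in ring_hom_cring) hom_eval:
  assumes p: "p \<in> carrier (UP R)" and t: "t \<in> carrier R"
  shows "h (eval R R id t p) = eval S S id (h t) (\<lambda>i. h (p i))"
proof -
  obtain N where N: "bound \<zero> N p" using p by (auto simp: UP_carrier_iff)
  have c: "p i \<in> carrier R" for i using p by (simp add: UP_carrier_iff)
  have N': "bound \<zero>\<^bsub>S\<^esub> N (\<lambda>i. h (p i))" using N by (auto intro!: bound.intro dest: bound.bound)
  hence p': "(\<lambda>i. h (p i)) \<in> carrier (UP S)" using c by (auto simp: UP_carrier_iff)
  have "h (eval R R id t p) = (\<Oplus>\<^bsub>S\<^esub>i\<in>{..N}. h (p i \<otimes> t [^] i))"
    unfolding R.eval_upto[OF p N t] using c t by (subst hom_finsum) (auto simp: comp_def)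
  also have "\<dots> = (\<Oplus>\<^bsub>S\<^esub>i\<in>{..N}. h (p i) \<otimes>\<^bsub>S\<^esub> h t [^]\<^bsub>S\<^esub> i)"
    using c t by (intro S.finsum_cong') auto
  finally show ?thesis unfolding S.eval_upto[OF p' N' hom_closed[OF t]] .
qed

section \<open>Extension of the representation from the subgroup to the whole group\<close>

context swapped_cover
begin

definition sign_rep :: "'k rep" where "sign_rep k = \<theta> k \<cdot>\<^sub>m 1\<^sub>m 1"

lemma sign_rep: "is_rep G sign_rep"
  by (rule is_repI[where n = 1]) (auto simp: sign_rep_def \<theta>_mult \<theta>_one intro!: eq_matI)

lemma H_cases:
  assumes "k \<in> carrier G"
  obtains "k \<in> H" | h where "h \<in> H" "k = h \<otimes> s"
proof (cases "\<theta> k = 1")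
  case True
  thus ?thesis using that assms by (auto simp: H_def)
next
  case False
  hence "\<theta> k = -1" using \<theta>_cases assms by auto
  hence "k \<otimes> inv s \<in> H" "k = k \<otimes> inv s \<otimes> s"
    using assms s by (auto simp: H_def \<theta>_mult \<theta>_inv m_assoc)
  thus ?thesis using that by blast
qed

text \<open>\<open>Q\<close> will be the value of the extension at \<open>s\<close>. It commutes
  with the image of \<open>H\<close> because \<open>s \<otimes> s\<close> is central.\<close>

lemma sqrt_exists:
  assumes r: "is_rep K0 \<rho>" and n: "rep_degree K0 \<rho> = n"
  obtains Q Q' where "Q \<in> carrier_mat n n" "Q' \<in> carrier_mat n n" "Q * Q = \<rho> (s \<otimes> s)"
    "Q * Q' = 1\<^sub>m n" "Q' * Q = 1\<^sub>m n" "\<And>k. k \<in> H \<Longrightarrow> \<rho> k * Q = Q * \<rho> k"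
proof -
  interpret K0: group K0 by (rule group_K0)
  note R = is_repD[OF r, unfolded n, simplified]
  let ?Z = "\<rho> (s \<otimes> s)" and ?Z' = "\<rho> (inv (s \<otimes> s))"
  note Z = R(1)[OF ss_H] and Z' = R(1)[OF H_mem(2)[OF ss_H]]
  have pow: "?Z ^\<^sub>m j = \<rho> ((s \<otimes> s) [^] j)" and mem: "(s \<otimes> s) [^] j \<in> H" for j :: nat
  proof (induction j)
    case 0
    { case 1 show ?case using Z R(3) by simp }
    { case 2 show ?case using subgroup.one_closed[OF subgroup_H] by simp }
  next
    case (Suc j)
    { case 1 show ?case using Suc R(2)[OF _ ss_H] by simp }
    { case 2 show ?case using Suc subgroup.m_closed[OF subgroup_H _ ss_H] by simp }
  qed
  have "(s \<otimes> s) [^] N = \<one>" using pow_mult_distrib[of s s N] s s_order by simp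
  hence ZN: "?Z ^\<^sub>m N = 1\<^sub>m n" using pow[of N] R(3) by simp
  obtain Q where Q: "Q \<in> carrier_mat n n" "Q * Q = ?Z"
    and Qc: "\<And>A. A \<in> carrier_mat n n \<Longrightarrow> A * ?Z = ?Z * A \<Longrightarrow> A * Q = Q * A"
    using mat_sqrt_exists[OF Z s_order(1) ZN] by metis
  have comm: "\<rho> k * Q = Q * \<rho> k" if k: "k \<in> H" for k
  proof (rule Qc[OF R(1)[OF k]])
    have "k \<otimes> (s \<otimes> s) = (s \<otimes> s) \<otimes> k"
      using s_central[OF H_mem(1)[OF k]] s(1) H_mem(1)[OF k] by (metis m_assoc)
    thus "\<rho> k * ?Z = ?Z * \<rho> k" using R(2)[OF k ss_H] R(2)[OF ss_H k] by simp
  qed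
  have ZZ': "?Z * ?Z' = 1\<^sub>m n" "?Z' * ?Z = 1\<^sub>m n"
    using R(2)[OF ss_H H_mem(2)[OF ss_H]] R(2)[OF H_mem(2)[OF ss_H] ss_H] R(3) s(1) by simp_all
  \<comment> \<open>\<open>Q * ?Z'\<close> inverts \<open>Q\<close> on the right since
    \<open>Q * Q = ?Z\<close>, and on the left since \<open>Q\<close> commutes with
    \<open>?Z'\<close>.\<close>
  have "Q * (Q * ?Z') = 1\<^sub>m n"
    using assoc_mult_mat[OF Q(1) Q(1) Z'] Q(2) ZZ' by simp
  moreover have "Q * ?Z' * Q = 1\<^sub>m n"
    using assoc_mult_mat[OF Q(1) Z' Q(1)] comm[OF H_mem(2)[OF ss_H]] assoc_mult_mat[OF Q(1) Q(1) Z'] Q(2) ZZ'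
    by simp
  ultimately show thesis using that[OF Q(1) mult_carrier_mat[OF Q(1) Z'] Q(2)] comm by blast
qed

text \<open>With \<open>Q\<close> as the value at \<open>s\<close>, the values on the other coset of
  \<open>H\<close> are forced. The representation on the cohomology of \<open>S\<close> is
  recognised through the pairs of \<open>res_pair_bij\<close>: \<open>H\<close> acts on both entries
  alike, and \<open>s\<close> exchanges them up to \<open>Q * Q\<close>.\<close>

lemma extension_exists:
  assumes \<rho>0: "matrix_form K0 (cohomology p X0) (A0 p) \<rho>\<^sub>0"
  obtains \<rho> where "is_rep G \<rho>" "\<And>k. k \<in> H \<Longrightarrow> \<rho> k = \<rho>\<^sub>0 k"
    "matrix_form G (cohomology p X) (A p) (rep_sum \<rho> (rep_tensor sign_rep \<rho>))"
proof -
  define n where "n = rep_degree K0 \<rho>\<^sub>0"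
  obtain f where r0: "is_rep K0 \<rho>\<^sub>0"
    and f: "linear_map class_ring (cohomology p X0) (cvec n) f"
    and b: "bij_betw f (carrier (cohomology p X0)) (carrier_vec n)"
    and e: "\<And>k a. k \<in> H \<Longrightarrow> a \<in> carrier (cohomology p X0) \<Longrightarrow> f (A0 p k a) = \<rho>\<^sub>0 k *\<^sub>v f a"
    using \<rho>0 unfolding matrix_form_def n_def by auto
  obtain Q Q' where Q: "Q \<in> carrier_mat n n" "Q' \<in> carrier_mat n n" "Q * Q = \<rho>\<^sub>0 (s \<otimes> s)"
    "Q * Q' = 1\<^sub>m n" "Q' * Q = 1\<^sub>m n" "\<And>k. k \<in> H \<Longrightarrow> \<rho>\<^sub>0 k * Q = Q * \<rho>\<^sub>0 k"
    using sqrt_exists[OF r0 n_def[symmetric]] by metis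
  note R = is_repD[OF r0, folded n_def, simplified]
  define \<rho> where "\<rho> k = (if \<theta> k = 1 then \<rho>\<^sub>0 k else \<rho>\<^sub>0 (k \<otimes> inv s) * Q)" for k
  have \<rho>_H: "\<rho> k = \<rho>\<^sub>0 k" if "k \<in> H" for k using that by (simp add: \<rho>_def H_mem)
  have \<rho>_s: "\<rho> (h \<otimes> s) = \<rho>\<^sub>0 h * Q" if "h \<in> H" for h
    using that s by (simp add: \<rho>_def H_mem \<theta>_mult m_assoc)
  note Hm = subgroup.m_closed[OF subgroup_H]
  have \<rho>_c: "\<rho> k \<in> carrier_mat n n" if k: "k \<in> carrier G" for k
    using k by (cases rule: H_cases) (auto simp: \<rho>_H \<rho>_s intro: mult_carrier_mat R(1) Q(1))
  have \<rho>_mult: "\<rho> (k \<otimes> k') = \<rho> k * \<rho> k'" if k: "k \<in> carrier G" and k': "k' \<in> carrier G" for k k'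
    using k
  proof (cases rule: H_cases)
    case 1
    note h = this
    show ?thesis using k'
    proof (cases rule: H_cases)
      case 1
      thus ?thesis using h R(2) Hm by (simp add: \<rho>_H)
    next
      case (2 h')
      have "k \<otimes> k' = (k \<otimes> h') \<otimes> s" using h 2 s by (simp add: H_mem m_assoc)
      thus ?thesis using h 2 R(2)[OF h 2(1)] Hm[OF h 2(1)] assoc_mult_mat[OF R(1)[OF h] R(1)[OF 2(1)] Q(1)]
        by (simp add: \<rho>_H \<rho>_s)
    qed
  next
    case (2 h)
    note h = this
    show ?thesis using k'
    proof (cases rule: H_cases)
      case 1
      have "k \<otimes> k' = (h \<otimes> k') \<otimes> s" using h 1 s s_central[of k'] by (simp add: H_mem m_assoc)
      hence "\<rho> (k \<otimes> k') = \<rho>\<^sub>0 h * \<rho>\<^sub>0 k' * Q" using h 1 R(2)[OF h(1) 1] Hm[OF h(1) 1] by (simp add: \<rho>_s)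
      also have "\<dots> = \<rho>\<^sub>0 h * (Q * \<rho>\<^sub>0 k')"
        using assoc_mult_mat[OF R(1)[OF h(1)] R(1)[OF 1] Q(1)] Q(6)[OF 1] by simp
      also have "\<dots> = \<rho> k * \<rho> k'"
        using assoc_mult_mat[OF R(1)[OF h(1)] Q(1) R(1)[OF 1]] h 1 by (simp add: \<rho>_H \<rho>_s)
      finally show ?thesis .
    next
      case (2 h')
      \<comment> \<open>The only case in which two factors \<open>s\<close> meet, and so the only
        one that uses the square of \<open>Q\<close>.\<close>
      have "k \<otimes> k' = (h \<otimes> h') \<otimes> (s \<otimes> s)"
        using h 2 s s_central[of h'] by (simp add: H_mem m_assoc[symmetric]) (simp add: H_mem m_assoc)
      hence "\<rho> (k \<otimes> k') = \<rho>\<^sub>0 h * \<rho>\<^sub>0 h' * (Q * Q)"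
        using R(2)[OF Hm[OF h(1) 2(1)] ss_H] R(2)[OF h(1) 2(1)] Hm[OF Hm[OF h(1) 2(1)] ss_H] Q(3)
        by (simp add: \<rho>_H)
      also have "\<dots> = \<rho>\<^sub>0 h * (\<rho>\<^sub>0 h' * Q * Q)"
        using assoc_mult_mat[OF R(1)[OF h(1)] R(1)[OF 2(1)] mult_carrier_mat[OF Q(1) Q(1)]]
          assoc_mult_mat[OF R(1)[OF 2(1)] Q(1) Q(1)] by simp
      also have "\<dots> = \<rho>\<^sub>0 h * (Q * (\<rho>\<^sub>0 h' * Q))"
        using Q(6)[OF 2(1)] assoc_mult_mat[OF Q(1) R(1)[OF 2(1)] Q(1)] by simp
      also have "\<dots> = \<rho> k * \<rho> k'"
        using assoc_mult_mat[OF R(1)[OF h(1)] Q(1) mult_carrier_mat[OF R(1)[OF 2(1)] Q(1)]] h 2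
        by (simp add: \<rho>_s)
      finally show ?thesis .
    qed
  qed
  have \<rho>_one: "\<rho> \<one> = 1\<^sub>m n" using \<rho>_H[of \<one>] R(3) subgroup.one_closed[OF subgroup_H] by simp
  note \<rho> = is_repI[of G \<rho> n, OF \<rho>_c \<rho>_mult \<rho>_one]
  have sr: "rep_tensor sign_rep \<rho> k = \<theta> k \<cdot>\<^sub>m \<rho> k" for k
    unfolding rep_tensor_def sign_rep_def by (rule kronecker_scalar)
  note \<rho>' = rep_tensor[OF sign_rep \<rho>(1)]
  have deg': "rep_degree G (rep_tensor sign_rep \<rho>) = n"
    using \<rho>(2) unfolding rep_degree_def by (simp add: sr)
  have deg: "rep_degree G (rep_sum \<rho> (rep_tensor sign_rep \<rho>)) = n + n"
    using rep_sum(2)[OF \<rho>(1) \<rho>'(1)] \<rho>(2) deg' by simp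
  define x where "x a = f (res p a)" for a
  define y where "y a = f (res p (A p s a))" for a
  (* s maps (x, y) to (y, Q^2 x), hence acts as Q on Q x + y and as -Q on Q x - y. *)
  define v where "v c a = Q *\<^sub>v x a + c \<cdot>\<^sub>v y a" for c a
  have xc: "x a \<in> carrier_vec n" and yc: "y a \<in> carrier_vec n" if a: "a \<in> carrier (cohomology p X)" for a
    using linear_mapD(3)[OF f] res_closed a A_closed[OF s(1) a] by (auto simp: x_def y_def module_vec_simps)
  have vc: "v c a \<in> carrier_vec n" if "a \<in> carrier (cohomology p X)" for c a
    using xc[OF that] yc[OF that] Q(1) by (simp add: v_def)
  have v_H: "v c (A p h a) = \<rho>\<^sub>0 h *\<^sub>v v c a" if h: "h \<in> H" and a: "a \<in> carrier (cohomology p X)" for c h a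
  proof -
    have 1: "x (A p h a) = \<rho>\<^sub>0 h *\<^sub>v x a" "y (A p h a) = \<rho>\<^sub>0 h *\<^sub>v y a"
      unfolding x_def y_def res_A[OF h a] res_As_A[OF h a]
      using e[OF h] res_closed a A_closed[OF s(1) a] by auto
    have 2: "Q *\<^sub>v (\<rho>\<^sub>0 h *\<^sub>v x a) = \<rho>\<^sub>0 h *\<^sub>v (Q *\<^sub>v x a)"
      using assoc_mult_mat_vec[OF Q(1) R(1)[OF h] xc[OF a]] assoc_mult_mat_vec[OF R(1)[OF h] Q(1) xc[OF a]]
        Q(6)[OF h] by simp
    have "\<rho>\<^sub>0 h *\<^sub>v (Q *\<^sub>v x a + c \<cdot>\<^sub>v y a) = \<rho>\<^sub>0 h *\<^sub>v (Q *\<^sub>v x a) + \<rho>\<^sub>0 h *\<^sub>v (c \<cdot>\<^sub>v y a)"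
      using R(1)[OF h] Q(1) xc[OF a] yc[OF a] by (intro mult_add_distrib_mat_vec[of _ n n]) auto
    also have "\<rho>\<^sub>0 h *\<^sub>v (c \<cdot>\<^sub>v y a) = c \<cdot>\<^sub>v (\<rho>\<^sub>0 h *\<^sub>v y a)" by (rule mult_mat_vec[OF R(1)[OF h] yc[OF a]])
    finally show ?thesis unfolding v_def 1 2 by simp
  qed
  \<comment> \<open>Both signs \<open>c\<close> at once. The pair \<open>(x, y)\<close> becomes
    \<open>(y, Q (Q x))\<close>, and \<open>Q y + c Q (Q x) = c Q (Q x + c y)\<close> because
    \<open>c * c = 1\<close>.\<close>
  have v_s: "v c (A p s a) = c \<cdot>\<^sub>v (Q *\<^sub>v v c a)" if c: "c * c = 1" and a: "a \<in> carrier (cohomology p X)" for c a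
  proof -
    have 1: "x (A p s a) = y a" "y (A p s a) = Q *\<^sub>v (Q *\<^sub>v x a)"
      using assoc_mult_mat_vec[OF Q(1) Q(1) xc[OF a]] e[OF ss_H res_closed[OF a]]
      unfolding Q(3) by (simp_all add: x_def y_def res_As_As[OF a])
    have "Q *\<^sub>v (Q *\<^sub>v x a + c \<cdot>\<^sub>v y a) = Q *\<^sub>v (Q *\<^sub>v x a) + Q *\<^sub>v (c \<cdot>\<^sub>v y a)"
      using Q(1) xc[OF a] yc[OF a] by (intro mult_add_distrib_mat_vec[of _ n n]) auto
    also have "Q *\<^sub>v (c \<cdot>\<^sub>v y a) = c \<cdot>\<^sub>v (Q *\<^sub>v y a)" by (rule mult_mat_vec[OF Q(1) yc[OF a]])
    finally have 2: "Q *\<^sub>v v c a = Q *\<^sub>v (Q *\<^sub>v x a) + c \<cdot>\<^sub>v (Q *\<^sub>v y a)" by (simp add: v_def)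
    show ?thesis unfolding 2 unfolding v_def 1
    proof (rule eq_vecI)
      fix i assume "i < dim_vec (c \<cdot>\<^sub>v (Q *\<^sub>v (Q *\<^sub>v x a) + c \<cdot>\<^sub>v (Q *\<^sub>v y a)))"
      hence i: "i < n" using Q(1) by simp
      define P1 P2 where "P1 = Q *\<^sub>v (Q *\<^sub>v x a)" and "P2 = Q *\<^sub>v y a"
      have d: "dim_vec P1 = n" "dim_vec P2 = n" using Q(1) by (auto simp: P1_def P2_def)
      have "c * (c * P2 $ i) = P2 $ i" using c by (simp add: mult.assoc[symmetric])
      thus "(Q *\<^sub>v y a + c \<cdot>\<^sub>v (Q *\<^sub>v (Q *\<^sub>v x a))) $ i
          = (c \<cdot>\<^sub>v (Q *\<^sub>v (Q *\<^sub>v x a) + c \<cdot>\<^sub>v (Q *\<^sub>v y a))) $ i"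
        unfolding P1_def[symmetric] P2_def[symmetric] using i d by (simp add: distrib_left)
    qed (use Q(1) in simp)
  qed
  \<comment> \<open>For \<open>c = 1\<close> the factor is always 1, and for \<open>c = -1\<close>
    it is the sign of \<open>k\<close>. So \<open>v 1\<close> follows \<open>\<rho>\<close>, and
    \<open>v (-1)\<close> follows its twist by the sign.\<close>
  have v_A: "v c (A p k a) = (if \<theta> k = 1 then 1 else c) \<cdot>\<^sub>v (\<rho> k *\<^sub>v v c a)"
    if c: "c * c = 1" and k: "k \<in> carrier G" and a: "a \<in> carrier (cohomology p X)" for c k a
    using k
  proof (cases rule: H_cases)
    case 1
    thus ?thesis by (simp add: v_H[OF 1 a] \<rho>_H H_mem)
  next
    case (2 h)
    have "v c (A p k a) = \<rho>\<^sub>0 h *\<^sub>v (c \<cdot>\<^sub>v (Q *\<^sub>v v c a))"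
      unfolding 2(2) A_mult[OF H_mem(1)[OF 2(1)] s(1) a] v_H[OF 2(1) A_closed[OF s(1) a]] v_s[OF c a] ..
    also have "\<dots> = c \<cdot>\<^sub>v (\<rho>\<^sub>0 h *\<^sub>v (Q *\<^sub>v v c a))"
      by (rule mult_mat_vec[OF R(1)[OF 2(1)] mult_mat_vec_carrier[OF Q(1) vc[OF a]]])
    also have "\<dots> = c \<cdot>\<^sub>v (\<rho> k *\<^sub>v v c a)"
      using assoc_mult_mat_vec[OF R(1)[OF 2(1)] Q(1) vc[OF a]] by (simp add: 2 \<rho>_s)
    finally show ?thesis using 2 s by (simp add: \<theta>_mult H_mem)
  qed
  let ?F = "\<lambda>a. v 1 a @\<^sub>v v (-1) a"
  have linF: "linear_map class_ring (cohomology p X) (cvec (n + n)) ?F"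
    unfolding v_def x_def y_def
    by (intro linear_map_append linear_map_mat_comb Q(1) linear_map_compose[OF _ f]
        linear_map_compose[OF A_linear res_linear] res_linear s)
  have bijF: "bij_betw ?F (carrier (cohomology p X)) (carrier_vec (n + n))"
  proof -
    have "bij_betw (\<lambda>z. (Q *\<^sub>v fst z, snd z)) (carrier_vec n \<times> carrier_vec n) (carrier_vec n \<times> carrier_vec n)"
      using bij_betw_map_prod[OF bij_betw_mult_mat_vec[OF Q(1,2,4,5)], of id "carrier_vec n" "carrier_vec n"]
      by (simp add: map_prod_def split_def)
    \<comment> \<open>The chain of bijections: restriction to pairs, coordinates on both entries,
      \<open>Q\<close> on the first entry, sum and difference, concatenation. Invertibility of
      \<open>Q\<close> enters in the third.\<close>
    from bij_betw_trans[OF bij_betw_trans[OF bij_betw_trans[OF bij_betw_trans[OF res_pair_bij[of p] bij_betw_map_prod[OF b b]] this] bij_betw_sum_diff] bij_betw_append]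
    have "bij_betw (\<lambda>a. (Q *\<^sub>v x a + y a) @\<^sub>v (Q *\<^sub>v x a + (-1) \<cdot>\<^sub>v y a)) (carrier (cohomology p X)) (carrier_vec (n + n))"
      by (simp add: comp_def x_def y_def)
    moreover have "1 \<cdot>\<^sub>v y a = y a" for a by (intro eq_vecI) auto
    ultimately show ?thesis by (simp add: v_def)
  qed
  have "?F (A p k a) = rep_sum \<rho> (rep_tensor sign_rep \<rho>) k *\<^sub>v ?F a"
    if k: "k \<in> carrier G" and a: "a \<in> carrier (cohomology p X)" for k a
  proof -
    have one: "1 \<cdot>\<^sub>v z = z" for z :: "complex Matrix.vec" by (intro eq_vecI) auto
    have th: "(if \<theta> k = 1 then 1 else -1) = \<theta> k" using \<theta>_cases[OF k] by auto
    have rs: "rep_sum \<rho> (rep_tensor sign_rep \<rho>) k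
        = four_block_mat (\<rho> k) (0\<^sub>m n n) (0\<^sub>m n n) (\<theta> k \<cdot>\<^sub>m \<rho> k)"
      using rep_sum_app[OF \<rho>(1) \<rho>'(1) k] by (simp only: \<rho>(2) deg' sr)
    have "rep_sum \<rho> (rep_tensor sign_rep \<rho>) k *\<^sub>v ?F a = (\<rho> k *\<^sub>v v 1 a) @\<^sub>v ((\<theta> k \<cdot>\<^sub>m \<rho> k) *\<^sub>v v (-1) a)"
      unfolding rs
      by (rule mult_mat_vec_split[OF \<rho>_c[OF k] smult_carrier_mat[OF \<rho>_c[OF k]] vc[OF a] vc[OF a]])
    also have "\<dots> = ?F (A p k a)"
      using v_A[of 1, OF _ k a] v_A[of "-1", OF _ k a] smult_mat_mult_vec[OF \<rho>_c[OF k] vc[OF a]]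
      by (simp add: th one)
    finally show ?thesis by simp
  qed
  hence "matrix_form G (cohomology p X) (A p) (rep_sum \<rho> (rep_tensor sign_rep \<rho>))"
    unfolding matrix_form_def deg by (intro conjI exI[of _ ?F] ballI rep_sum(1)[OF \<rho>(1) \<rho>'(1)] linF bijF)
  thus thesis using that[OF \<rho>(1) \<rho>_H] by blast
qed

text \<open>The extension in the form needed for coefficients in R(K). The last conjunct makes the
  lifted class vanish along with the cohomology of \<open>T\<close>; it holds because the extension
  has the same degree as the representation that it extends.\<close>

lemma class_extension_exists:
  assumes fd: "vectorspace.fin_dim class_ring (cohomology p X0)"
  shows "\<exists>\<rho>. is_rep G \<rho> \<and>
    class_of_module G (cohomology p X) (A p) =
      (rep_class G rep_one \<oplus>\<^bsub>rep_ring G\<^esub> rep_class G sign_rep) \<otimes>\<^bsub>rep_ring G\<^esub> rep_class G \<rho> \<and>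
    restrict_virtual K0 (rep_class G \<rho>) = class_of_module K0 (cohomology p X0) (A0 p) \<and>
    (carrier (cohomology p X0) = {\<zero>\<^bsub>cohomology p X0\<^esub>} \<longrightarrow> rep_class G \<rho> = \<zero>\<^bsub>rep_ring G\<^esub>)"
proof -
  interpret K0: group K0 by (rule group_K0)
  interpret R: cring "rep_ring G" by (rule cring_rep_ring)
  obtain \<rho>\<^sub>0 where \<rho>0: "matrix_form K0 (cohomology p X0) (A0 p) \<rho>\<^sub>0"
    by (rule matrix_form_exists[OF K0.monoid_axioms vectorspace_cohomology fd, of "A0 p"])
      (simp_all add: A0_linear A0_one A0_mult)
  obtain \<rho> where \<rho>: "is_rep G \<rho>" "\<And>k. k \<in> H \<Longrightarrow> \<rho> k = \<rho>\<^sub>0 k"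
    "matrix_form G (cohomology p X) (A p) (rep_sum \<rho> (rep_tensor sign_rep \<rho>))"
    using extension_exists[OF \<rho>0] by metis
  have "rep_tensor rep_one \<rho> = \<rho>" by (rule ext) (rule rep_tensor_one_left)
  hence u: "(rep_class G rep_one \<oplus>\<^bsub>rep_ring G\<^esub> rep_class G sign_rep) \<otimes>\<^bsub>rep_ring G\<^esub> rep_class G \<rho>
      = rep_class G (rep_sum \<rho> (rep_tensor sign_rep \<rho>))"
    by (subst R.l_distr)
      (simp_all add: rep_class_closed rep_class_tensor rep_class_sum rep_tensor(1) \<rho>(1) sign_rep rep_one(1))
  have 1: "class_of_module G (cohomology p X) (A p) = rep_class G (rep_sum \<rho> (rep_tensor sign_rep \<rho>))"
    by (rule class_of_module_eq[OF monoid_axioms \<rho>(3) A_closed])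
  have "rep_class K0 \<rho> = rep_class K0 \<rho>\<^sub>0"
    by (rule K0.rep_class_cong[OF is_rep_subgroup[OF subgroup_H \<rho>(1)] matrix_form_is_rep[OF \<rho>0]
          rep_iso_eqI[OF is_rep_subgroup[OF subgroup_H \<rho>(1)] matrix_form_is_rep[OF \<rho>0]]])
      (use \<rho>(2) K0.one_closed in auto)
  hence 2: "restrict_virtual K0 (rep_class G \<rho>) = class_of_module K0 (cohomology p X0) (A0 p)"
    unfolding restrict_rep_class[OF subgroup_H \<rho>(1)]
    using class_of_module_eq[OF K0.monoid_axioms \<rho>0] A0_closed by simp
  have 3: "rep_class G \<rho> = \<zero>\<^bsub>rep_ring G\<^esub>"
    if "carrier (cohomology p X0) = {\<zero>\<^bsub>cohomology p X0\<^esub>}"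
  proof (rule rep_class_degree_zero[OF \<rho>(1)])
    have "rep_degree K0 \<rho>\<^sub>0 = 0" by (rule matrix_form_degree_zero[OF \<rho>0 that])
    moreover have "\<rho> \<one> = \<rho>\<^sub>0 \<one>" using \<rho>(2) subgroup.one_closed[OF subgroup_H] by blast
    ultimately show "rep_degree G \<rho> = 0" by (simp add: rep_degree_def)
  qed
  show ?thesis using \<rho>(1) 1 u 2 3 by (intro exI[of _ \<rho>] conjI impI) simp_all
qed

text \<open>The extensions in different cohomological degrees are independent, so one is chosen for
  each degree. Multiplication by the constant polynomial \<open>u\<close> acts on each coefficient
  separately.\<close>

theorem poincare_poly_factorization:
  defines "R \<equiv> rep_ring G"
    and "u \<equiv> rep_class G rep_one \<oplus>\<^bsub>rep_ring G\<^esub> rep_class G sign_rep"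
  shows "\<exists>P\<^sub>0 \<in> rep_poly_pos G.
      poincare_poly G act S = up_ring.monom (UP R) u 0 \<otimes>\<^bsub>UP R\<^esub> P\<^sub>0 \<and>
      restrict_poly K0 P\<^sub>0 = poincare_poly K0 act T"
proof -
  interpret K0: group K0 by (rule group_K0)
  interpret R: cring R unfolding R_def by (rule cring_rep_ring)
  interpret h: ring_hom_cring R "rep_ring K0" "restrict_virtual K0"
    unfolding R_def by (rule restrict_virtual_ring_hom[OF subgroup_H])
  have u: "u \<in> carrier R"
    unfolding u_def R_def by (rule R.a_closed[unfolded R_def]) (simp_all add: rep_class_closed rep_one sign_rep)
  show ?thesis
  proof (cases "finite_total_cohomology X0")
    case True
    hence fd: "vectorspace.fin_dim class_ring (cohomology i X0)" for i
      by (simp add: finite_total_cohomology_def)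
    have "\<exists>\<rho>. is_rep G \<rho> \<and>
      class_of_module G (cohomology i X) (A i) = u \<otimes>\<^bsub>R\<^esub> rep_class G \<rho> \<and>
      restrict_virtual K0 (rep_class G \<rho>) = class_of_module K0 (cohomology i X0) (A0 i) \<and>
      (carrier (cohomology i X0) = {\<zero>\<^bsub>cohomology i X0\<^esub>} \<longrightarrow> rep_class G \<rho> = \<zero>\<^bsub>R\<^esub>)" for i
      unfolding u_def R_def by (rule class_extension_exists[OF fd])
    hence "\<forall>i. \<exists>\<rho>. is_rep G \<rho> \<and>
      class_of_module G (cohomology i X) (A i) = u \<otimes>\<^bsub>R\<^esub> rep_class G \<rho> \<and>
      restrict_virtual K0 (rep_class G \<rho>) = class_of_module K0 (cohomology i X0) (A0 i) \<and>
      (carrier (cohomology i X0) = {\<zero>\<^bsub>cohomology i X0\<^esub>} \<longrightarrow> rep_class G \<rho> = \<zero>\<^bsub>R\<^esub>)" ..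
    from choice[OF this] obtain \<rho> where "\<forall>i. is_rep G (\<rho> i) \<and>
      class_of_module G (cohomology i X) (A i) = u \<otimes>\<^bsub>R\<^esub> rep_class G (\<rho> i) \<and>
      restrict_virtual K0 (rep_class G (\<rho> i)) = class_of_module K0 (cohomology i X0) (A0 i) \<and>
      (carrier (cohomology i X0) = {\<zero>\<^bsub>cohomology i X0\<^esub>} \<longrightarrow> rep_class G (\<rho> i) = \<zero>\<^bsub>R\<^esub>)" ..
    hence \<rho>: "is_rep G (\<rho> i)"
      "class_of_module G (cohomology i X) (A i) = u \<otimes>\<^bsub>R\<^esub> rep_class G (\<rho> i)"
      "restrict_virtual K0 (rep_class G (\<rho> i)) = class_of_module K0 (cohomology i X0) (A0 i)"
      "carrier (cohomology i X0) = {\<zero>\<^bsub>cohomology i X0\<^esub>} \<Longrightarrow> rep_class G (\<rho> i) = \<zero>\<^bsub>R\<^esub>" for i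
      by blast+
    define P where "P i = rep_class G (\<rho> i)" for i
    \<comment> \<open>Above \<open>N\<close> the cohomology of \<open>T\<close> vanishes, hence so
      do the lifted classes; this makes \<open>P\<close> a polynomial and not just a
      sequence.\<close>
    obtain N where "\<And>i. i > N \<Longrightarrow> carrier (cohomology i X0) = {\<zero>\<^bsub>cohomology i X0\<^esub>}"
      using True by (auto simp: finite_total_cohomology_def)
    hence "bound \<zero>\<^bsub>R\<^esub> N P" using \<rho>(4) by (auto intro!: bound.intro simp: P_def)
    hence PUP: "P \<in> carrier (UP R)"
      using rep_class_closed[OF \<rho>(1)] by (auto simp: UP_carrier_iff P_def R_def)
    hence "P \<in> rep_poly_pos G"
      using \<rho>(1) unfolding rep_poly_pos_def R_def[symmetric]
      by (auto simp: UP_coeff rep_ring_pos_def P_def)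
    moreover have "poincare_poly G act S = up_ring.monom (UP R) u 0 \<otimes>\<^bsub>UP R\<^esub> P"
      using True unfolding R.UP_const_mult[OF u PUP] poincare_poly_def finite_total_iff
      by (simp add: \<rho>(2) P_def)
    moreover have "restrict_poly K0 P = poincare_poly K0 act T"
      using True unfolding restrict_poly_def poincare_poly_def by (simp add: \<rho>(3) P_def)
    ultimately show ?thesis by blast
  next
    case False
    let ?P = "\<lambda>i::nat. \<zero>\<^bsub>R\<^esub>"
    have PUP: "?P \<in> carrier (UP R)" by (auto simp: UP_carrier_iff intro!: exI bound.intro)
    have z: "\<zero>\<^bsub>UP R\<^esub> = ?P" "\<zero>\<^bsub>UP (rep_ring K0)\<^esub> = (\<lambda>i. \<zero>\<^bsub>rep_ring K0\<^esub>)" by (simp_all add: UP_def)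
    \<comment> \<open>Zero counts as the class of an actual representation because degree 0 is
      allowed.\<close>
    have "\<zero>\<^bsub>R\<^esub> \<in> rep_ring_pos G"
      unfolding rep_ring_pos_def R_def using rep_zero(1) by (auto simp: rep_ring_def)
    hence "?P \<in> rep_poly_pos G"
      using PUP unfolding rep_poly_pos_def R_def[symmetric] by (auto simp: UP_coeff)
    moreover have "poincare_poly G act S = up_ring.monom (UP R) u 0 \<otimes>\<^bsub>UP R\<^esub> ?P"
      using False unfolding R.UP_const_mult[OF u PUP] poincare_poly_def finite_total_iff
      by (simp add: z u R_def[symmetric])
    moreover have "restrict_poly K0 ?P = poincare_poly K0 act T"
      using False unfolding restrict_poly_def poincare_poly_def by (simp add: z)
    ultimately show ?thesis by blast
  qed
qed

text \<open>Evaluation of the factorization at -1. Evaluation is multiplicative, and it commutes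
  with restriction since restriction fixes -1 as a ring homomorphism.\<close>

corollary equivariant_euler_factorization:
  defines "R \<equiv> rep_ring G"
    and "u \<equiv> rep_class G rep_one \<oplus>\<^bsub>rep_ring G\<^esub> rep_class G sign_rep"
  shows "\<exists>e\<^sub>0 \<in> carrier R.
      equivariant_euler G act S = u \<otimes>\<^bsub>R\<^esub> e\<^sub>0 \<and> restrict_virtual K0 e\<^sub>0 = equivariant_euler K0 act T"
proof -
  interpret R: cring R unfolding R_def by (rule cring_rep_ring)
  interpret h: ring_hom_cring R "rep_ring K0" "restrict_virtual K0"
    unfolding R_def by (rule restrict_virtual_ring_hom[OF subgroup_H])
  have u: "u \<in> carrier R"
    unfolding u_def R_def by (rule R.a_closed[unfolded R_def]) (simp_all add: rep_class_closed rep_one sign_rep)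
  have "\<exists>P\<^sub>0 \<in> rep_poly_pos G.
      poincare_poly G act S = up_ring.monom (UP R) u 0 \<otimes>\<^bsub>UP R\<^esub> P\<^sub>0 \<and>
      restrict_poly K0 P\<^sub>0 = poincare_poly K0 act T"
    unfolding R_def u_def by (rule poincare_poly_factorization)
  then obtain P where P: "P \<in> rep_poly_pos G"
      "poincare_poly G act S = up_ring.monom (UP R) u 0 \<otimes>\<^bsub>UP R\<^esub> P"
      "restrict_poly K0 P = poincare_poly K0 act T" by blast
  have PUP: "P \<in> carrier (UP R)" using P(1) by (simp add: rep_poly_pos_def R_def)
  have t: "\<ominus>\<^bsub>R\<^esub> \<one>\<^bsub>R\<^esub> \<in> carrier R" by simp
  have "equivariant_euler G act S = u \<otimes>\<^bsub>R\<^esub> eval R R id (\<ominus>\<^bsub>R\<^esub> \<one>\<^bsub>R\<^esub>) P"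
    unfolding equivariant_euler_def P(2) R_def[symmetric] by (rule R.eval_const_mult(1)[OF u PUP t])
  moreover have "restrict_virtual K0 (eval R R id (\<ominus>\<^bsub>R\<^esub> \<one>\<^bsub>R\<^esub>) P) = equivariant_euler K0 act T"
    unfolding h.hom_eval[OF PUP t] equivariant_euler_def P(3)[symmetric] restrict_poly_def by simp
  ultimately show ?thesis using R.eval_const_mult(2)[OF u PUP t] by blast
qed

end

section \<open>Reflection groups with reflections of order two\<close>

abbreviation cart_id :: "complex^'n^'n" where "cart_id \<equiv> Finite_Cartesian_Product.mat 1"

lemma matrix_inv_mult:
  fixes g :: "complex^'n^'n"
  assumes "invertible g"
  shows "g ** matrix_inv g = cart_id" "matrix_inv g ** g = cart_id"
proof -
  have "g ** matrix_inv g = cart_id \<and> matrix_inv g ** g = cart_id"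
    unfolding matrix_inv_def by (rule someI_ex) (use assms in \<open>simp add: invertible_def\<close>)
  thus "g ** matrix_inv g = cart_id" "matrix_inv g ** g = cart_id"
    by auto
qed

lemma invertible_matrix_inv: "invertible g \<Longrightarrow> invertible (matrix_inv (g :: complex^'n^'n))"
  unfolding invertible_def[of "matrix_inv g"] using matrix_inv_mult by blast

lemma group_GL: "group (GL_group :: (complex^'n^'n) monoid)"
proof (rule groupI)
  fix g :: "complex^'n^'n" assume "g \<in> carrier GL_group"
  hence "invertible g" by (simp add: GL_group_def)
  thus "\<exists>h\<in>carrier GL_group. h \<otimes>\<^bsub>GL_group\<^esub> g = \<one>\<^bsub>GL_group\<^esub>"
    by (intro bexI[of _ "matrix_inv g"]) (simp_all add: GL_group_def matrix_inv_mult invertible_matrix_inv)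
next
  have "invertible (cart_id :: complex^'n^'n)"
    unfolding invertible_def by (rule exI[of _ "cart_id"]) simp
  thus "\<one>\<^bsub>GL_group\<^esub> \<in> carrier (GL_group :: (complex^'n^'n) monoid)" by (simp add: GL_group_def)
qed (simp_all add: GL_group_def matrix_mul_assoc invertible_mult)

lemma inv_GL: "invertible g \<Longrightarrow> inv\<^bsub>GL_group\<^esub> g = matrix_inv (g :: complex^'n^'n)"
  by (rule group.inv_equality[OF group_GL])
    (simp_all add: GL_group_def matrix_inv_mult invertible_matrix_inv)

text \<open>For \<open>m = 0\<close> the carrier would consist of all complex numbers, including
  0.\<close>

lemma group_roots_of_unity:
  assumes "m > 0" shows "group (roots_of_unity_group m)"
proof (rule groupI)
  fix x assume "x \<in> carrier (roots_of_unity_group m)"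
  hence x: "x ^ m = 1" by (simp add: roots_of_unity_group_def)
  hence "x \<noteq> 0" using assms by (auto simp: power_0_left)
  thus "\<exists>y\<in>carrier (roots_of_unity_group m). y \<otimes>\<^bsub>roots_of_unity_group m\<^esub> x = \<one>\<^bsub>roots_of_unity_group m\<^esub>"
    using x by (intro bexI[of _ "inverse x"]) (simp_all add: roots_of_unity_group_def power_inverse)
qed (simp_all add: roots_of_unity_group_def power_mult_distrib)

lemma scaleR_eq_vector_scalar: "r *\<^sub>R v = complex_of_real r *s (v :: complex^'n)"
  by (simp add: Finite_Cartesian_Product.vec_eq_iff scaleR_conv_of_real[where 'a = complex])

lemma clinear_form_props:
  assumes "Vector_Spaces.linear (*s) (*) (f :: complex^'n \<Rightarrow> complex)"
  shows "f (v + w) = f v + f w" "f (c *s v) = c * f v" "continuous_on A f"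
proof -
  interpret f: Vector_Spaces.linear "(*s)" "(*)" f by fact
  show 1: "f (v + w) = f v + f w" for v w by (rule f.add)
  show 2: "f (c *s v) = c * f v" for c v by (rule f.scale)
  have "linear f"
    by (intro linearI) (simp_all add: 1 2 scaleR_eq_vector_scalar scaleR_conv_of_real[where 'a = complex])
  thus "continuous_on A f" by (simp add: linear_continuous_on linear_conv_bounded_linear)
qed

text \<open>If \<open>f w\<close> is nonzero, subtracting a suitable multiple of \<open>w\<close>
  moves any \<open>v\<close> into the kernel of \<open>f\<close>, hence of \<open>f'\<close>. This
  determines \<open>f v\<close> from \<open>f' v\<close> up to a fixed factor.\<close>

lemma clinear_form_proportional:
  fixes f f' :: "complex^'n \<Rightarrow> complex"
  assumes f: "Vector_Spaces.linear (*s) (*) f" and f': "Vector_Spaces.linear (*s) (*) f'"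
    and ker: "{v. f v = 0} = {v. f' v = 0}"
  shows "\<exists>c. c \<noteq> 0 \<and> (\<forall>v. f v = c * f' v)"
proof (cases "\<exists>w. f w \<noteq> 0")
  case True
  then obtain w where w: "f w \<noteq> 0" by blast
  have k: "f v = 0 \<longleftrightarrow> f' v = 0" for v using ker by blast
  have "f v = f w / f' w * f' v" for v
  proof -
    have "f (v + (- (f v / f w)) *s w) = 0" using w by (simp only: clinear_form_props(1,2)[OF f]) simp
    hence "f' (v + (- (f v / f w)) *s w) = 0" using k by blast
    hence "f' v = f v / f w * f' w" by (simp only: clinear_form_props(1,2)[OF f']) simp
    thus ?thesis using w k[of w] by simp
  qed
  moreover have "f w / f' w \<noteq> 0" using w k[of w] by simp
  ultimately show ?thesis by blast
next
  case False
  hence "\<forall>v. f v = 0" "\<forall>v. f' v = 0" using ker by auto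
  thus ?thesis by (intro exI[of _ 1]) simp
qed

text \<open>Finitely many hyperplanes do not cover the space. If \<open>v\<close> misses those of
  \<open>A\<close> but lies on the new one, the line \<open>t *s v + w\<close> with \<open>w\<close>
  off the new hyperplane never meets it, and meets each of the others at most once.\<close>

lemma clinear_forms_common_nonzero:
  fixes l :: "'b \<Rightarrow> complex^'n \<Rightarrow> complex"
  assumes "finite A" "\<And>H. H \<in> A \<Longrightarrow> Vector_Spaces.linear (*s) (*) (l H)" "\<And>H. H \<in> A \<Longrightarrow> \<exists>w. l H w \<noteq> 0"
  shows "\<exists>v. \<forall>H\<in>A. l H v \<noteq> 0"
  using assms
proof (induction A)
  case (insert a A)
  then obtain v where v: "\<forall>H\<in>A. l H v \<noteq> 0" by auto
  obtain w where w: "l a w \<noteq> 0" using insert.prems by auto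
  show ?case
  proof (cases "l a v = 0")
    case False
    thus ?thesis using v by auto
  next
    case True
    have "finite ((\<lambda>H. - l H w / l H v) ` A)" using insert.hyps by simp
    hence "finite (insert 0 ((\<lambda>H. - l H w / l H v) ` A))" by simp
    then obtain t where t: "t \<notin> insert 0 ((\<lambda>H. - l H w / l H v) ` A)"
      using infinite_UNIV_char_0[where 'a = complex] ex_new_if_finite by blast
    have e: "l H (t *s v + w) = t * l H v + l H w" if "H \<in> insert a A" for H
      using clinear_form_props(1,2)[OF insert.prems(1)[OF that]] by simp
    have "l H (t *s v + w) \<noteq> 0" if "H \<in> insert a A" for H
    proof (cases "H = a")
      case True
      thus ?thesis using e[OF that] \<open>l a v = 0\<close> w by simp
    next
      case False
      hence H: "H \<in> A" using that by simp
      show ?thesis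
      proof
        assume "l H (t *s v + w) = 0"
        hence "t = - l H w / l H v" using e[OF that] v H by (simp add: field_simps eq_neg_iff_add_eq_0)
        thus False using t H by blast
      qed
    qed
    thus ?thesis by blast
  qed
qed auto

section \<open>The product of the linear forms and its character\<close>

locale order_two_reflection_group =
  fixes G :: "(complex^'n^'n) set" and l :: "(complex^'n) set \<Rightarrow> complex^'n \<Rightarrow> complex"
  assumes refl: "finite_reflection_group G" and nonempty: "reflecting_hyperplanes G \<noteq> {}"
    and forms: "defining_forms G l"
    and order2: "\<forall>H \<in> reflecting_hyperplanes G. stabiliser_order G H = 2"
begin

abbreviation "arr \<equiv> reflecting_hyperplanes G"
text \<open>This is the reduced product Q_0. The polynomial that defines the Milnor fibre is its
  square, see \<open>defining_poly_eq\<close>.\<close>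

abbreviation "Q \<equiv> reduced_poly G l"

definition "d = card arr"

lemma finite_G: "finite G" and subgroup_G: "subgroup G GL_group"
  and generate_G: "generate GL_group {g \<in> G. is_reflection g} = G"
  using refl by (auto simp: finite_reflection_group_def)

lemma finite_arr: "finite arr" using finite_G by (simp add: reflecting_hyperplanes_def)

lemma d_pos: "d > 0" using finite_arr nonempty by (simp add: d_def card_gt_0_iff)

lemma degree: "poly_degree G = 2 * d"
  using order2 by (simp add: poly_degree_def d_def)

lemma G_closed:
  shows "g \<in> G \<Longrightarrow> invertible g" "g \<in> G \<Longrightarrow> h \<in> G \<Longrightarrow> g ** h \<in> G"
    "cart_id \<in> G" "g \<in> G \<Longrightarrow> matrix_inv g \<in> G"
proof -
  interpret subgroup G GL_group by (rule subgroup_G)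
  show 1: "g \<in> G \<Longrightarrow> invertible g" for g using subset by (auto simp: GL_group_def)
  show "g \<in> G \<Longrightarrow> h \<in> G \<Longrightarrow> g ** h \<in> G" using m_closed[of g h] by (simp add: GL_group_def)
  show "cart_id \<in> G" using one_closed by (simp add: GL_group_def)
  show "g \<in> G \<Longrightarrow> matrix_inv g \<in> G" using m_inv_closed[of g] 1 inv_GL[of g] by simp
qed

lemma inv_apply:
  assumes "g \<in> G" shows "matrix_inv g *v (g *v v) = v" "g *v (matrix_inv g *v v) = v"
  using matrix_inv_mult[OF G_closed(1)[OF assms]] by (simp_all add: matrix_vector_mul_assoc)

lemma form: "H \<in> arr \<Longrightarrow> Vector_Spaces.linear (*s) (*) (l H)" "H \<in> arr \<Longrightarrow> {v. l H v = 0} = H"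
  using forms by (auto simp: defining_forms_def)

text \<open>The image of the fixed space of \<open>r\<close> under \<open>g\<close> is the fixed
  space of the conjugate of \<open>r\<close> by \<open>g\<close>, which is again a
  reflection.\<close>

lemma image_hyperplane:
  assumes g: "g \<in> G" and H: "H \<in> arr" shows "(*v) g ` H \<in> arr"
proof -
  obtain r where r: "r \<in> G" "is_reflection r" "H = fixed_space r" using H by (auto simp: reflecting_hyperplanes_def)
  let ?r = "g ** r ** matrix_inv g"
  have rG: "?r \<in> G" by (intro G_closed(2,4) g r)
  have fs: "fixed_space ?r = (*v) g ` H"
  proof (intro equalityI subsetI)
    fix v assume "v \<in> fixed_space ?r"
    hence "g *v (r *v (matrix_inv g *v v)) = v" by (simp add: fixed_space_def matrix_vector_mul_assoc[symmetric])
    hence "matrix_inv g *v (g *v (r *v (matrix_inv g *v v))) = matrix_inv g *v v" by (rule arg_cong)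
    hence "r *v (matrix_inv g *v v) = matrix_inv g *v v" by (simp only: inv_apply(1)[OF g])
    thus "v \<in> (*v) g ` H" using inv_apply(2)[OF g, of v] r by (auto simp: fixed_space_def intro!: image_eqI[of _ _ "matrix_inv g *v v"])
  next
    fix v assume "v \<in> (*v) g ` H"
    thus "v \<in> fixed_space ?r" using r inv_apply(1)[OF g]
      by (auto simp: fixed_space_def matrix_vector_mul_assoc[symmetric])
  qed
  have "vec.dim ((*v) g ` H) = vec.dim H"
    by (rule vec.dim_image_eq[OF matrix_vector_mul_linear_gen]) (metis inj_onI inv_apply(1) g)
  hence "is_reflection ?r" using r G_closed(1)[OF rG] by (simp add: is_reflection_def fs)
  thus ?thesis using rG fs unfolding reflecting_hyperplanes_def by (intro image_eqI[of _ _ ?r]) auto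
qed

text \<open>This makes the definite description in \<open>eps\<close> unique. Each form is nonzero
  because its kernel has dimension one less than the whole space.\<close>

lemma exists_nonzero: "\<exists>v. Q v \<noteq> 0"
proof -
  have w: "\<exists>w. l H w \<noteq> 0" if H: "H \<in> arr" for H
  proof (rule ccontr)
    assume "\<not> ?thesis"
    hence "H = UNIV" using form(2)[OF H] by auto
    moreover have "vec.dim H = CARD('n) - 1" using H by (auto simp: reflecting_hyperplanes_def is_reflection_def)
    ultimately have "CARD('n) = CARD('n) - 1" using vec_dim_card[where 'a = complex and 'n = 'n] by simp
    thus False using zero_less_card_finite[where 'a = 'n] by linarith
  qed
  have "\<exists>v. \<forall>H\<in>arr. l H v \<noteq> 0" by (rule clinear_forms_common_nonzero[OF finite_arr form(1) w])
  thus ?thesis using finite_arr by (auto simp: reduced_poly_def)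
qed

text \<open>Composing the form of \<open>H\<close> with the inverse of \<open>g\<close> gives a form
  with kernel \<open>g H\<close>, hence a multiple of the form of that hyperplane. Since
  \<open>g\<close> permutes the hyperplanes, the product changes only by the product of these
  factors.\<close>

lemma semi_invariant:
  assumes g: "g \<in> G"
  shows "\<exists>c. c \<noteq> 0 \<and> (\<forall>v. Q (matrix_inv g *v v) = c * Q v)"
proof -
  let ?p = "\<lambda>H. (*v) g ` H"
  have "\<exists>c. c \<noteq> 0 \<and> (\<forall>v. l H (matrix_inv g *v v) = c * l (?p H) v)" if H: "H \<in> arr" for H
  proof (rule clinear_form_proportional[OF _ form(1)[OF image_hyperplane[OF g H]]])
    show "Vector_Spaces.linear (*s) (*) (\<lambda>v. l H (matrix_inv g *v v))"
      using Vector_Spaces.linear_compose[OF matrix_vector_mul_linear_gen form(1)[OF H], of "matrix_inv g"]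
      by (simp add: o_def)
    have "{v. l H (matrix_inv g *v v) = 0} = {v. matrix_inv g *v v \<in> H}" using form(2)[OF H] by blast
    also have "\<dots> = ?p H" using inv_apply[OF g] by (auto intro!: image_eqI[of _ "(*v) g" "matrix_inv g *v _"])
    finally show "{v. l H (matrix_inv g *v v) = 0} = {v. l (?p H) v = 0}"
      using form(2)[OF image_hyperplane[OF g H]] by simp
  qed
  then obtain c where c: "\<And>H. H \<in> arr \<Longrightarrow> c H \<noteq> 0" "\<And>H v. H \<in> arr \<Longrightarrow> l H (matrix_inv g *v v) = c H * l (?p H) v"
    by metis
  have inj: "inj_on ?p arr"
  proof (rule inj_onI)
    fix H H' assume "?p H = ?p H'"
    hence "(*v) (matrix_inv g) ` ?p H = (*v) (matrix_inv g) ` ?p H'" by simp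
    thus "H = H'" by (simp add: image_image inv_apply(1)[OF g])
  qed
  have "?p ` arr \<subseteq> arr" using image_hyperplane[OF g] by blast
  hence img: "?p ` arr = arr" using endo_inj_surj[OF finite_arr _ inj] by blast
  have "Q (matrix_inv g *v v) = prod c arr * Q v" for v
  proof -
    have "Q (matrix_inv g *v v) = (\<Prod>H\<in>arr. c H * l (?p H) v)"
      unfolding reduced_poly_def by (rule prod.cong) (auto simp: c)
    also have "\<dots> = prod c arr * (\<Prod>H\<in>arr. l (?p H) v)" by (rule prod.distrib)
    also have "(\<Prod>H\<in>arr. l (?p H) v) = (\<Prod>H\<in>?p ` arr. l H v)" by (simp add: prod.reindex[OF inj])
    finally show ?thesis unfolding img reduced_poly_def .
  qed
  thus ?thesis using c(1) finite_arr by (intro exI[of _ "prod c arr"]) auto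
qed

definition E where "E g = (THE c. \<forall>v. Q (matrix_inv g *v v) = c * Q v)"

lemma E_unique:
  assumes "\<forall>v. Q (matrix_inv g *v v) = c * Q v" shows "E g = c"
proof -
  obtain v where v: "Q v \<noteq> 0" using exists_nonzero by blast
  show ?thesis unfolding E_def
  proof (rule the_equality)
    show "\<forall>v. Q (matrix_inv g *v v) = c * Q v" by (fact assms)
    fix c' assume "\<forall>v. Q (matrix_inv g *v v) = c' * Q v"
    hence "c' * Q v = c * Q v" using assms by metis
    thus "c' = c" using v by simp
  qed
qed

lemma E: "g \<in> G \<Longrightarrow> Q (matrix_inv g *v v) = E g * Q v"
  using semi_invariant[of g] E_unique[of g] by blast

lemma E_one: "E (cart_id) = 1"
proof (rule E_unique)
  have "matrix_inv (cart_id :: complex^'n^'n) = cart_id"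
    using matrix_inv_mult(1)[OF G_closed(1)[OF G_closed(3)]] by simp
  thus "\<forall>v. Q (matrix_inv (cart_id) *v v) = 1 * Q v" by simp
qed

lemma matrix_inv_prod:
  assumes "g \<in> G" "h \<in> G" shows "matrix_inv (g ** h) = matrix_inv h ** matrix_inv g"
proof -
  interpret GL: group "GL_group :: (complex^'n^'n) monoid" by (rule group_GL)
  have c: "g \<in> carrier GL_group" "h \<in> carrier GL_group" using assms G_closed(1) by (auto simp: GL_group_def)
  have "inv\<^bsub>GL_group\<^esub> (g \<otimes>\<^bsub>GL_group\<^esub> h) = inv\<^bsub>GL_group\<^esub> h \<otimes>\<^bsub>GL_group\<^esub> inv\<^bsub>GL_group\<^esub> g"
    by (rule GL.inv_mult_group[OF c])
  moreover have "x \<otimes>\<^bsub>GL_group\<^esub> y = x ** y" for x y :: "complex^'n^'n" by (simp add: GL_group_def)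
  ultimately show ?thesis using assms G_closed(1,2) by (simp add: inv_GL)
qed

lemma E_mult:
  assumes "g \<in> G" "h \<in> G" shows "E (g ** h) = E g * E h"
  by (rule E_unique)
    (use E assms in \<open>simp add: matrix_inv_prod matrix_vector_mul_assoc[symmetric] mult.assoc mult.left_commute\<close>)

text \<open>The pointwise stabiliser of the hyperplane has two elements, which must be 1 and
  \<open>r\<close>. It also contains the square of \<open>r\<close>, so \<open>r\<close> is an
  involution.\<close>

lemma E_reflection:
  assumes r: "r \<in> G" "is_reflection r" shows "E r = 1 \<or> E r = -1"
proof -
  let ?H = "fixed_space r" and ?I = "cart_id :: complex^'n^'n"
  let ?St = "{g \<in> G. \<forall>v \<in> ?H. g *v v = v}"
  have "?H \<in> arr" using r by (auto simp: reflecting_hyperplanes_def)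
  hence card: "card ?St = 2" using order2 by (simp add: stabiliser_order_def)
  have "r \<noteq> ?I"
  proof
    assume "r = ?I"
    hence "?H = UNIV" by (simp add: fixed_space_def)
    hence "CARD('n) = CARD('n) - 1"
      using r(2) vec_dim_card[where 'a = complex and 'n = 'n] by (simp add: is_reflection_def)
    thus False using zero_less_card_finite[where 'a = 'n] by linarith
  qed
  moreover have mem: "?I \<in> ?St" "r \<in> ?St" "r ** r \<in> ?St"
    using r G_closed by (auto simp: fixed_space_def matrix_vector_mul_assoc[symmetric])
  ultimately have "card {?I, r} = card ?St" "{?I, r} \<subseteq> ?St" using card by auto
  moreover have "finite ?St" using finite_G by simp
  ultimately have "{?I, r} = ?St" using card_subset_eq by blast
  moreover have "r ** r \<noteq> r"
  proof
    assume "r ** r = r"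
    hence "matrix_inv r ** (r ** r) = matrix_inv r ** r" by simp
    hence "r = ?I" using matrix_inv_mult(2)[OF G_closed(1)[OF r(1)]] by (simp add: matrix_mul_assoc)
    thus False using \<open>r \<noteq> ?I\<close> by simp
  qed
  ultimately have "r ** r = ?I" using mem(3) by blast
  hence "E r * E r = 1" using E_mult[OF r(1) r(1)] E_one by simp
  thus ?thesis by (simp add: square_eq_1_iff)
qed

text \<open>The elements with value 1 or -1 form a subgroup, and it contains the reflections, which
  generate \<open>G\<close>.\<close>

lemma E_cases: "g \<in> G \<Longrightarrow> E g = 1 \<or> E g = -1"
proof -
  interpret GL: group "GL_group :: (complex^'n^'n) monoid" by (rule group_GL)
  let ?K = "{g \<in> G. E g = 1 \<or> E g = -1}"
  have "subgroup ?K GL_group"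
  proof (rule GL.subgroupI)
    show "?K \<subseteq> carrier GL_group" using G_closed(1) by (auto simp: GL_group_def)
    show "?K \<noteq> {}" using G_closed(3) E_one by auto
  next
    fix g assume g: "g \<in> ?K"
    hence "E g * E (matrix_inv g) = 1" "matrix_inv g \<in> G"
      using E_mult[of g "matrix_inv g"] E_one G_closed matrix_inv_mult(1)[of g] by auto
    thus "inv\<^bsub>GL_group\<^esub> g \<in> ?K" using g G_closed(1)[of g] by (auto simp: inv_GL) (metis add.inverse_inverse mult_minus_left mult_1)
  next
    fix g h assume "g \<in> ?K" "h \<in> ?K"
    thus "g \<otimes>\<^bsub>GL_group\<^esub> h \<in> ?K" using G_closed(2) E_mult by (auto simp: GL_group_def)
  qed
  hence "generate GL_group {g \<in> G. is_reflection g} \<subseteq> ?K"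
    by (intro GL.generate_subgroup_incl) (use E_reflection in auto)
  thus "g \<in> G \<Longrightarrow> E g = 1 \<or> E g = -1" unfolding generate_G by auto
qed

lemma Q_apply: assumes "g \<in> G" shows "Q (g *v v) = E g * Q v"
proof -
  have "E g * Q (g *v v) = Q v" using E[OF assms, of "g *v v"] inv_apply(1)[OF assms] by simp
  moreover have "E g * E g = 1" using E_cases[OF assms] by auto
  ultimately show ?thesis by (metis mult.assoc mult_1)
qed

lemma Q_scale: "Q (c *s v) = c ^ d * Q v"
proof -
  have "Q (c *s v) = (\<Prod>H\<in>arr. c * l H v)"
    unfolding reduced_poly_def by (rule prod.cong) (auto simp: clinear_form_props(2)[OF form(1)])
  thus ?thesis by (simp add: prod.distrib reduced_poly_def d_def)
qed

lemma Q_continuous: "continuous_on A Q"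
  unfolding reduced_poly_def by (intro continuous_on_prod clinear_form_props(3) form(1))

lemma defining_poly_eq: "defining_poly G l v = (Q v)\<^sup>2"
  unfolding defining_poly_def reduced_poly_def using order2 by (simp add: prod_power_distrib)

section \<open>The sign character and the action on the two pieces of the Milnor fibre\<close>

definition theta :: "(complex^'n^'n) \<times> complex \<Rightarrow> complex" where
  "theta = (\<lambda>(g, \<xi>). \<xi> ^ d * E g)"

abbreviation "\<Gamma> \<equiv> Gamma_group G"

lemma Gamma_simps:
  "carrier \<Gamma> = {(g, \<xi>). g \<in> G \<and> \<xi> ^ (2 * d) = 1}"
  "(g, \<xi>) \<otimes>\<^bsub>\<Gamma>\<^esub> (g', \<xi>') = (g ** g', \<xi> * \<xi>')"
  "\<one>\<^bsub>\<Gamma>\<^esub> = (cart_id, 1)"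
  by (auto simp: Gamma_group_def DirProd_def GL_group_def roots_of_unity_group_def degree)

lemma group_Gamma: "group \<Gamma>"
proof -
  interpret subgroup G GL_group by (rule subgroup_G)
  show ?thesis unfolding Gamma_group_def
    by (intro DirProd_group subgroup_is_group[OF group_GL] group_roots_of_unity) (simp add: degree d_pos)
qed

lemma root_power: "\<xi> ^ (2 * d) = 1 \<Longrightarrow> \<xi> ^ d = 1 \<or> \<xi> ^ d = (-1 :: complex)"
  by (simp add: power_mult_distrib mult.commute[of 2] power_mult power2_eq_1_iff)

lemma theta_cases: "k \<in> carrier \<Gamma> \<Longrightarrow> theta k = 1 \<or> theta k = -1"
proof -
  assume "k \<in> carrier \<Gamma>"
  then obtain g \<xi> where k: "k = (g, \<xi>)" "g \<in> G" "\<xi> ^ (2 * d) = 1" by (auto simp: Gamma_simps)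
  show ?thesis using root_power[OF k(3)] E_cases[OF k(2)] by (auto simp: k(1) theta_def)
qed

text \<open>The action scales by the inverse of the root of unity, whereas the character uses the
  root itself. Their \<open>d\<close>-th powers agree because they are 1 or -1.\<close>

lemma Q_act:
  assumes "k \<in> carrier \<Gamma>" shows "Q (Gamma_act k v) = theta k * Q v"
proof -
  obtain g \<xi> where k: "k = (g, \<xi>)" "g \<in> G" "\<xi> ^ (2 * d) = 1" using assms by (auto simp: Gamma_simps)
  have "(inverse \<xi>) ^ d = \<xi> ^ d" using root_power[OF k(3)] by (auto simp: power_inverse)
  thus ?thesis by (simp add: k Gamma_act_def Q_scale Q_apply theta_def)
qed

lemma act_continuous: "continuous_on A (Gamma_act k :: complex^'n \<Rightarrow> complex^'n)"
proof -
  obtain g \<xi> where k: "k = (g, \<xi>)" by (cases k)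
  have "linear (\<lambda>v. inverse \<xi> *s (g *v v))"
    by (intro linearI)
      (simp_all add: scaleR_eq_vector_scalar vec.add vec.scale vec.scale_right_distrib mult.commute)
  thus ?thesis unfolding k Gamma_act_def by (simp add: linear_continuous_on linear_conv_bounded_linear)
qed

lemma swapped_cover_Gamma:
  "swapped_cover \<Gamma> Gamma_act (milnor_fibre G l) (reduced_fibre G l) theta
     (cart_id, cis (pi / d)) (2 * d)"
proof -
  interpret group \<Gamma> by (rule group_Gamma)
  \<comment> \<open>With m = \<open>2 * d\<close> this is a primitive m-th root of unity; its
    \<open>d\<close>-th power is \<open>cis pi\<close>, that is -1, so its sign is -1.\<close>
  let ?\<xi> = "cis (pi / d)" and ?I = "cart_id :: complex^'n^'n"
  have \<xi>: "?\<xi> ^ d = -1" using d_pos by (simp add: Complex.DeMoivre)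
  hence \<xi>2: "?\<xi> ^ (2 * d) = 1" by (simp add: mult.commute[of 2] power_mult)
  have mem: "(?I, ?\<xi>) \<in> carrier \<Gamma>" using G_closed(3) \<xi>2 by (simp add: Gamma_simps)
  have S: "v \<in> milnor_fibre G l \<longleftrightarrow> Q v = 1 \<or> Q v = -1" and T: "v \<in> reduced_fibre G l \<longleftrightarrow> Q v = 1" for v
    by (auto simp: milnor_fibre_def reduced_fibre_def defining_poly_eq power2_eq_1_iff)
  \<comment> \<open>On the fibre \<open>Q\<close> takes only the values 1 and -1. The first
    description of the piece is by a closed condition, the second by an open one.\<close>
  have TS: "reduced_fibre G l = milnor_fibre G l \<inter> {v. Q v = 1}"
    "reduced_fibre G l = milnor_fibre G l \<inter> {v. Q v \<noteq> -1}" using S T by auto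
  show ?thesis
  proof
    fix k v assume k: "k \<in> carrier \<Gamma>" and v: "v \<in> milnor_fibre G l"
    show "Gamma_act k v \<in> milnor_fibre G l"
      using v theta_cases[OF k] by (auto simp: S Q_act[OF k])
    show "Gamma_act k v \<in> reduced_fibre G l \<longleftrightarrow> (v \<in> reduced_fibre G l \<longleftrightarrow> theta k = 1)"
      using v theta_cases[OF k] by (auto simp: S T Q_act[OF k])
  next
    fix k k' and v :: "complex^'n" assume "k \<in> carrier \<Gamma>" "k' \<in> carrier \<Gamma>"
    show "Gamma_act (k \<otimes>\<^bsub>\<Gamma>\<^esub> k') v = Gamma_act k (Gamma_act k' v)"
      by (cases k; cases k') (simp add: Gamma_simps Gamma_act_def vec.scale matrix_vector_mul_assoc mult.commute)
  next
    fix k k' assume "k \<in> carrier \<Gamma>" "k' \<in> carrier \<Gamma>"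
    thus "theta (k \<otimes>\<^bsub>\<Gamma>\<^esub> k') = theta k * theta k'"
      by (auto simp: Gamma_simps theta_def E_mult power_mult_distrib)
  next
    show "openin (top_of_set (milnor_fibre G l)) (reduced_fibre G l)"
      unfolding TS(2) by (intro openin_open_Int open_Collect_neq Q_continuous continuous_on_const)
    show "closedin (top_of_set (milnor_fibre G l)) (reduced_fibre G l)"
      unfolding TS(1) by (intro closedin_closed_Int closed_Collect_eq Q_continuous continuous_on_const)
    show "theta (?I, ?\<xi>) = -1" by (simp add: theta_def \<xi> E_one)
    have "(?I, ?\<xi>) [^]\<^bsub>\<Gamma>\<^esub> j = (?I, ?\<xi> ^ j)" for j :: nat
      by (induction j) (simp_all add: Gamma_simps mult.commute)
    thus "(?I, ?\<xi>) [^]\<^bsub>\<Gamma>\<^esub> (2 * d) = \<one>\<^bsub>\<Gamma>\<^esub>" by (simp only: \<xi>2 Gamma_simps)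
  next
    fix k assume "k \<in> carrier \<Gamma>"
    show "(?I, ?\<xi>) \<otimes>\<^bsub>\<Gamma>\<^esub> k = k \<otimes>\<^bsub>\<Gamma>\<^esub> (?I, ?\<xi>)" by (cases k) (simp add: Gamma_simps mult.commute)
  qed (use mem theta_cases act_continuous d_pos in \<open>auto simp: Gamma_simps Gamma_act_def\<close>)
qed

lemma twist_eps: "twist (eps G l) d k = theta k \<cdot>\<^sub>m 1\<^sub>m 1"
  by (cases k) (auto simp: twist_def eps_def theta_def E_def intro!: eq_matI)

lemma twist_one: "twist rep_one 0 = rep_one"
  by (auto simp: twist_def rep_one_def fun_eq_iff intro!: eq_matI)

end

theorem proposition2p20:
  fixes G :: "(complex^'n^'n) set"
    and l :: "(complex^'n) set \<Rightarrow> complex^'n \<Rightarrow> complex"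
  assumes "finite_reflection_group G"
    and "acts_irreducibly G"
    and "reflecting_hyperplanes G \<noteq> {}"
    and "defining_forms G l"
    and "\<forall>H \<in> reflecting_hyperplanes G. stabiliser_order G H = 2"
  shows
    "let \<Gamma> = Gamma_group G;
         \<Gamma>\<^sub>0 = \<Gamma>\<lparr>carrier := Gamma0 G l\<rparr>;
         R = rep_ring \<Gamma>;
         u = rep_class \<Gamma> (twist rep_one 0) \<oplus>\<^bsub>R\<^esub> rep_class \<Gamma> (twist (eps G l) (poly_degree G div 2))
     in (\<exists>P\<^sub>0 \<in> rep_poly_pos \<Gamma>.
           poincare_poly \<Gamma> Gamma_act (milnor_fibre G l) = up_ring.monom (UP R) u 0 \<otimes>\<^bsub>UP R\<^esub> P\<^sub>0 \<and>
           restrict_poly \<Gamma>\<^sub>0 P\<^sub>0 = poincare_poly \<Gamma>\<^sub>0 Gamma_act (reduced_fibre G l)) \<and>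
        (\<exists>\<chi>\<^sub>0 \<in> carrier R.
           equivariant_euler \<Gamma> Gamma_act (milnor_fibre G l) = u \<otimes>\<^bsub>R\<^esub> \<chi>\<^sub>0 \<and>
           restrict_virtual \<Gamma>\<^sub>0 \<chi>\<^sub>0 = equivariant_euler \<Gamma>\<^sub>0 Gamma_act (reduced_fibre G l))"
proof -
  interpret order_two_reflection_group G l using assms by unfold_locales
  interpret cover: swapped_cover "Gamma_group G" Gamma_act "milnor_fibre G l" "reduced_fibre G l" theta
    "(cart_id, cis (pi / d))" "2 * d"
    by (rule swapped_cover_Gamma)
  have half: "poly_degree G div 2 = d" by (simp add: degree)
  have eps: "twist (eps G l) (poly_degree G div 2) = cover.sign_rep"
    unfolding half by (rule ext) (simp only: twist_eps cover.sign_rep_def)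
  \<comment> \<open>The kernel in \<open>Gamma0\<close> is that of a character with values in
    matrices of size 1; here it is compared with the condition that the sign is 1.\<close>
  have "c \<cdot>\<^sub>m 1\<^sub>m 1 = 1\<^sub>m 1 \<longleftrightarrow> c = 1" for c :: complex
  proof
    assume "c \<cdot>\<^sub>m 1\<^sub>m 1 = 1\<^sub>m 1"
    hence "(c \<cdot>\<^sub>m 1\<^sub>m 1) $$ (0, 0) = 1\<^sub>m 1 $$ (0, 0)" by simp
    thus "c = 1" by simp
  qed auto
  hence "Gamma0 G l = cover.H"
    unfolding Gamma0_def kernel_def cover.H_def eps by (simp add: ring_mat_simps cover.sign_rep_def)
  thus ?thesis
    using cover.poincare_poly_factorization cover.equivariant_euler_factorization
    unfolding Let_def eps twist_one by simp
qed

end
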